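(* Let $\Omega$ be a bounded Lipschitz domain in $\mathbb{R}^n$, $n\ge2$. Let $F$ be a fixed closed subset of $\partial\Omega$ with $H_{n-1}(F)=\epsilon>0$, and let $\mathcal{H}$ be the closure in the $H^{1,2}(\Omega)$-norm of the space $$\mathcal{H}'=\{\varphi\in\mathrm{Lip}(\Omega):\ \mathrm{supp}\,\varphi\cap F=\emptyset\}.$$ Let $u\in\mathcal{H}$, $u\ge0$. Then $\tilde u\in H^{1,2}_0(\tilde\Omega)$ and $$\int_{\tilde\Omega}|D\tilde u|^2\,dx\ \le\ L^2\int_\Omega|Du|^2\,dx,\qquad L=\max\left\{Q\,n\,c_n^{1/n},\ \frac{\mathcal{C}\,n\,c_n^{1/n}\,|\Omega|^{1-1/n}}{\epsilon}\right\},$$ where $Q$ is a positive constant such that $$Q\,P_\Omega(E)\ \ge\ \min\big(|E|,|\Omega\setminus E|\big)^{1-1/n}\qquad\text{for every measurable } E\subseteq\Omega ,$$ and $\mathcal{C}$ is a positive constant such that $$H_{n-1}\big(\partial E\cap\partial\Omega\big)\ \le\ \mathcal{C}\,P_\Omega(E)\qquad\text{for every measurable } E\subseteq\Omega \text{ with } |E|\le \tfrac{|\Omega|}{2}.$$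
   Context: $|\cdot|$ denotes Lebesgue measure of sets, $H_{n-1}$ is $(n-1)$-dimensional Hausdorff measure, $c_n$ is the measure of the unit ball of $\mathbb{R}^n$, $D$ denotes the gradient, and $\partial E$ is the boundary of $E$. $\mathrm{Lip}(\Omega)$ is the set of Lipschitz functions on $\Omega$ (extended continuously to $\overline\Omega$; $\mathrm{supp}\,\varphi$ is the closed support in $\overline\Omega$). $P_\Omega(E)$ is the De Giorgi perimeter of $E$ relative to $\Omega$. For a real measurable function $u$ on $\Omega$: the distribution function is $\mu(t)=|\{x\in\Omega:u(x)>t\}|$, $t\in\mathbb{R}$; the decreasing rearrangement is $u^*(s)=\inf\{t\in\mathbb{R}:\mu(t)\le s\}$, $s\in[0,|\Omega|]$; the Schwarz symmetrization is $\tilde u(x)=u^*(c_n|x|^n)$, $x\in\tilde\Omega$, where $\tilde\Omega$ is the ball centred at the origin with the same measure as $\Omega$. $H^{1,2}(\Omega)$ is the usual Sobolev space and $H^{1,2}_0$ the closure of $C_c^\infty$ in it. *)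

theory Defs
  imports "HOL-Analysis.Analysis"
begin

section \<open>Smooth functions and test functions\<close>

text \<open>
  In finite dimension a function is of class \<open>C\<^sup>k\<^sup>+\<^sup>1\<close> on the whole space iff it is differentiable
  everywhere and all its directional derivatives are of class \<open>C\<^sup>k\<close>.
\<close>

primrec Ck :: "nat \<Rightarrow> ('a::euclidean_space \<Rightarrow> 'b::real_normed_vector) \<Rightarrow> bool" where
  "Ck 0 f \<longleftrightarrow> continuous_on UNIV f"
| "Ck (Suc k) f \<longleftrightarrow>
     (\<forall>x. f differentiable (at x)) \<and> (\<forall>v. Ck k (\<lambda>x. frechet_derivative f (at x) v))"

definition compactly_supported_in ::
    "'a::euclidean_space set \<Rightarrow> ('a \<Rightarrow> 'b::real_normed_vector) \<Rightarrow> bool" where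
  "compactly_supported_in \<Omega> f \<longleftrightarrow> (\<exists>K. compact K \<and> K \<subseteq> \<Omega> \<and> (\<forall>x. x \<notin> K \<longrightarrow> f x = 0))"

definition Cc_infinity :: "'a::euclidean_space set \<Rightarrow> ('a \<Rightarrow> real) set" where
  "Cc_infinity \<Omega> = {\<phi>. (\<forall>k. Ck k \<phi>) \<and> compactly_supported_in \<Omega> \<phi>}"


section \<open>The Sobolev space \<open>H\<^sup>1\<^sup>,\<^sup>2\<close>\<close>

text \<open>
  Functions on \<open>\<Omega>\<close> are total functions whose values outside \<open>\<Omega>\<close> never matter; the elements of the
  Sobolev space are functions rather than classes modulo null sets.
\<close>

definition L2_on ::
    "'a::euclidean_space set \<Rightarrow> ('a \<Rightarrow> 'b::{second_countable_topology, real_normed_vector}) \<Rightarrow> bool"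
  where
  "L2_on \<Omega> f \<longleftrightarrow> f \<in> borel_measurable (lebesgue_on \<Omega>) \<and>
     integrable (lebesgue_on \<Omega>) (\<lambda>x. (norm (f x))\<^sup>2)"

definition has_L2_gradient ::
    "'a::euclidean_space set \<Rightarrow> ('a \<Rightarrow> real) \<Rightarrow> ('a \<Rightarrow> 'a) \<Rightarrow> bool" where
  "has_L2_gradient \<Omega> u G \<longleftrightarrow> L2_on \<Omega> u \<and> L2_on \<Omega> G \<and>
     (\<forall>\<phi>\<in>Cc_infinity \<Omega>. \<forall>b\<in>Basis.
        (LINT x|lebesgue_on \<Omega>. u x * frechet_derivative \<phi> (at x) b)
          = - (LINT x|lebesgue_on \<Omega>. (G x \<bullet> b) * \<phi> x))"

definition H12 :: "'a::euclidean_space set \<Rightarrow> ('a \<Rightarrow> real) set" where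
  "H12 \<Omega> = {u. \<exists>G. has_L2_gradient \<Omega> u G}"

text \<open>The weak gradient is unique only almost everywhere on \<open>\<Omega>\<close>; one representative is chosen.\<close>

definition weak_grad :: "'a::euclidean_space set \<Rightarrow> ('a \<Rightarrow> real) \<Rightarrow> 'a \<Rightarrow> 'a" where
  "weak_grad \<Omega> u = (SOME G. has_L2_gradient \<Omega> u G)"

definition H12_norm :: "'a::euclidean_space set \<Rightarrow> ('a \<Rightarrow> real) \<Rightarrow> real" where
  "H12_norm \<Omega> u = sqrt ((LINT x|lebesgue_on \<Omega>. (u x)\<^sup>2)
                       + (LINT x|lebesgue_on \<Omega>. (norm (weak_grad \<Omega> u x))\<^sup>2))"

definition H12_closure ::
    "'a::euclidean_space set \<Rightarrow> ('a \<Rightarrow> real) set \<Rightarrow> ('a \<Rightarrow> real) set" where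
  "H12_closure \<Omega> S =
     {u \<in> H12 \<Omega>. \<forall>e>0. \<exists>\<phi> \<in> S \<inter> H12 \<Omega>. H12_norm \<Omega> (\<lambda>x. u x - \<phi> x) < e}"

definition H12_0 :: "'a::euclidean_space set \<Rightarrow> ('a \<Rightarrow> real) set" where
  "H12_0 \<Omega> = H12_closure \<Omega> (Cc_infinity \<Omega>)"

text \<open>
  Since \<open>\<phi>\<close> is continuous, the closed support in the closure of \<open>\<Omega>\<close> of its continuous extension is the
  closure of \<open>{x \<in> \<Omega>. \<phi> x \<noteq> 0}\<close>, so the extension itself need not be mentioned.
\<close>

definition Lip_vanishing_near ::
    "'a::euclidean_space set \<Rightarrow> 'a set \<Rightarrow> ('a \<Rightarrow> real) set" where
  "Lip_vanishing_near \<Omega> F =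
     {\<phi>. (\<exists>K. K-lipschitz_on \<Omega> \<phi>) \<and> closure {x \<in> \<Omega>. \<phi> x \<noteq> 0} \<inter> F = {}}"


section \<open>Bounded Lipschitz domains\<close>

text \<open>
  Near each boundary point the domain is the region above the graph of a Lipschitz function defined
  on the hyperplane orthogonal to some unit vector \<open>\<nu>\<close>; here \<open>y - (y \<bullet> \<nu>) \<nu>\<close> is the orthogonal
  projection of \<open>y\<close> to that hyperplane.
\<close>

definition bounded_lipschitz_domain :: "'a::euclidean_space set \<Rightarrow> bool" where
  "bounded_lipschitz_domain \<Omega> \<longleftrightarrow>
     open \<Omega> \<and> connected \<Omega> \<and> \<Omega> \<noteq> {} \<and> bounded \<Omega> \<and>
     (\<forall>x\<in>frontier \<Omega>. \<exists>r>0. \<exists>\<nu> (g :: 'a \<Rightarrow> real) K.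
        norm \<nu> = 1 \<and> K-lipschitz_on {z. z \<bullet> \<nu> = 0} g \<and>
        \<Omega> \<inter> ball x r = {y \<in> ball x r. g (y - (y \<bullet> \<nu>) *\<^sub>R \<nu>) < y \<bullet> \<nu>})"


section \<open>Hausdorff measure\<close>

text \<open>
  Normalised so that in dimension \<open>k\<close> it agrees with Lebesgue measure. The empty set is treated
  separately because \<open>0 ^ 0 = 1\<close>.
\<close>

definition hausdorff_premeasure :: "nat \<Rightarrow> real \<Rightarrow> 'a::metric_space set \<Rightarrow> ennreal" where
  "hausdorff_premeasure k \<delta> A =
     (INF C \<in> {C :: nat \<Rightarrow> 'a set. A \<subseteq> (\<Union>i. C i) \<and> (\<forall>i. bounded (C i) \<and> diameter (C i) \<le> \<delta>)}.
        \<Sum>i. if C i = {} then 0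
            else ennreal (unit_ball_vol (real k) * (diameter (C i) / 2) ^ k))"

definition hausdorff_measure :: "nat \<Rightarrow> 'a::metric_space set \<Rightarrow> ennreal" where
  "hausdorff_measure k A = (SUP \<delta>\<in>{0<..}. hausdorff_premeasure k \<delta> A)"


section \<open>Perimeter and measure-theoretic boundary\<close>

definition divergence :: "('a::euclidean_space \<Rightarrow> 'a) \<Rightarrow> 'a \<Rightarrow> real" where
  "divergence \<phi> x = (\<Sum>b\<in>Basis. frechet_derivative \<phi> (at x) b \<bullet> b)"

definition perimeter :: "'a::euclidean_space set \<Rightarrow> 'a set \<Rightarrow> ennreal" where
  "perimeter \<Omega> E =
     (SUP \<phi> \<in> {\<phi> :: 'a \<Rightarrow> 'a. Ck 1 \<phi> \<and> compactly_supported_in \<Omega> \<phi> \<and> (\<forall>x. norm (\<phi> x) \<le> 1)}.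
        ennreal (LINT x|lebesgue_on E. divergence \<phi> x))"

text \<open>
  The boundary of a measurable set, a set being identified with those that differ from it by a
  null set: the points at which its Lebesgue density is neither \<open>0\<close> nor \<open>1\<close>. The topological boundary
  would not do in an inequality that bounds the boundary of an arbitrary measurable set by its
  perimeter: a countable dense subset of \<open>\<Omega>\<close> has perimeter \<open>0\<close>, while its topological boundary
  contains that of \<open>\<Omega>\<close>.
\<close>

definition ess_boundary :: "'a::euclidean_space set \<Rightarrow> 'a set" where
  "ess_boundary E =
     {x. \<not> ((\<lambda>r. measure lebesgue (E \<inter> ball x r) / measure lebesgue (ball x r)) \<longlongrightarrow> 0) (at_right 0) \<and>
         \<not> ((\<lambda>r. measure lebesgue (E \<inter> ball x r) / measure lebesgue (ball x r)) \<longlongrightarrow> 1) (at_right 0)}"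

lemma ess_boundary_subset_frontier: "ess_boundary E \<subseteq> frontier E"
proof
  fix x assume x: "x \<in> ess_boundary E"
  let ?d = "\<lambda>r. measure lebesgue (E \<inter> ball x r) / measure lebesgue (ball x r)"
  show "x \<in> frontier E"
  proof (rule ccontr)
    assume "x \<notin> frontier E"
    then consider "x \<in> interior E" | "x \<in> - closure E"
      by (auto simp: frontier_def)
    then show False
    proof cases
      case 1
      then obtain e where e: "e > 0" "ball x e \<subseteq> E"
        by (auto simp: mem_interior)
      have "?d r = 1" if "0 < r" "r < e" for r
      proof -
        have "E \<inter> ball x r = ball x r"
          using e that by auto
        then show ?thesis
          using content_ball_pos[OF that(1), of x] by simp
      qed
      then have "eventually (\<lambda>r. ?d r = 1) (at_right 0)"
        unfolding eventually_at_right_field using e(1) by blast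
      then have "(?d \<longlongrightarrow> 1) (at_right 0)"
        by (rule tendsto_eventually)
      then show False
        using x unfolding ess_boundary_def by blast
    next
      case 2
      then obtain e where e: "e > 0" "ball x e \<subseteq> - closure E"
        using open_contains_ball[of "- closure E"] by auto
      have "?d r = 0" if "0 < r" "r < e" for r
      proof -
        have "E \<inter> ball x r = {}"
          using e that closure_subset[of E] subset_ball[of r e x] by fastforce
        then show ?thesis by simp
      qed
      then have "eventually (\<lambda>r. ?d r = 0) (at_right 0)"
        unfolding eventually_at_right_field using e(1) by blast
      then have "(?d \<longlongrightarrow> 0) (at_right 0)"
        by (rule tendsto_eventually)
      then show False
        using x unfolding ess_boundary_def by blast
    qed
  qed
qed


section \<open>Rearrangements\<close>

definition distribution_fun :: "'a::euclidean_space set \<Rightarrow> ('a \<Rightarrow> real) \<Rightarrow> real \<Rightarrow> real" where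
  "distribution_fun \<Omega> u t = measure lebesgue {x \<in> \<Omega>. u x > t}"

text \<open>
  For \<open>0 < s < |\<Omega>|\<close> the infimum is taken over a nonempty set that is bounded below. At \<open>s = 0\<close> the set
  may be empty and at \<open>s = |\<Omega>|\<close> it is unbounded; these values are immaterial below, since they affect
  the symmetrization only at the centre of the open ball.
\<close>

definition decreasing_rearrangement ::
    "'a::euclidean_space set \<Rightarrow> ('a \<Rightarrow> real) \<Rightarrow> real \<Rightarrow> real" where
  "decreasing_rearrangement \<Omega> u s = Inf {t. distribution_fun \<Omega> u t \<le> s}"

definition schwarz_symmetrization ::
    "'a::euclidean_space set \<Rightarrow> ('a \<Rightarrow> real) \<Rightarrow> 'a \<Rightarrow> real" where
  "schwarz_symmetrization \<Omega> u x =
     decreasing_rearrangement \<Omega> u (unit_ball_vol (real DIM('a)) * norm x ^ DIM('a))"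

definition symmetrized_ball :: "'a::euclidean_space set \<Rightarrow> 'a set" where
  "symmetrized_ball \<Omega> =
     ball 0 (root DIM('a) (measure lebesgue \<Omega> / unit_ball_vol (real DIM('a))))"

lemma measure_symmetrized_ball:
  fixes \<Omega> :: "'a::euclidean_space set"
  shows "measure lebesgue (symmetrized_ball \<Omega>) = measure lebesgue \<Omega>"
proof -
  have "unit_ball_vol (real DIM('a)) \<noteq> 0"
    using unit_ball_vol_pos[of "real DIM('a)"] by linarith
  then show ?thesis
    by (simp add: symmetrized_ball_def content_ball)
qed

end

theory Submission
  imports Defs
begin

text \<open>
  The proof measures how fast the decreasing rearrangement \<open>u\<^sup>*\<close> can drop by the energy that \<open>u\<close>
  spends on the strip between two levels, and it never differentiates \<open>u\<^sup>*\<close> itself. Write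
  \<open>\<alpha> = 1 - 1/n\<close>, \<open>\<mu>(t) = |{u > t}|\<close> and \<open>K = max Q (C |\<Omega>|\<^sup>\<alpha> / \<epsilon>)\<close>, so that \<open>L = n c\<^sup>1\<^sup>/\<^sup>n K\<close>
  with \<open>c\<close> the volume of the unit ball.
  
  A single isoperimetric inequality replaces the two hypotheses: if \<open>\<phi>\<close> is Lipschitz and vanishes near
  \<open>F\<close>, then \<open>|E|\<^sup>\<alpha> \<le> K P(E)\<close> for every superlevel set \<open>E = {\<phi> > t}\<close> with \<open>t \<ge> 0\<close>
  (\<open>isoperimetric_superlevel\<close>). When \<open>E\<close> fills at most half of \<open>\<Omega>\<close> this is the inequality with \<open>Q\<close>.
  Otherwise the complement of \<open>E\<close> fills at most half of \<open>\<Omega>\<close>, has the same perimeter, and coincides with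
  \<open>\<Omega>\<close> near \<open>F\<close>; a Lipschitz domain has density bounded away from \<open>0\<close> and \<open>1\<close> at its boundary points, so
  \<open>F\<close> belongs to the measure-theoretic boundary of the complement
  (\<open>frontier_subset_ess_boundary\<close>), and the inequality with \<open>C\<close> gives \<open>\<epsilon> \<le> C P(E)\<close>.
  
  Testing the perimeter with ramps in place of the indicator of \<open>E\<close> shows that \<open>P({\<phi> > t})\<close> is at most
  the lower right derivative of \<open>t \<mapsto> \<integral>\<^sub>{\<^sub>\<phi> \<^sub>\<le> \<^sub>t\<^sub>} |D\<phi>|\<close>, for every \<open>t\<close>
  (\<open>perimeter_less_imp_gradient_mass\<close>). Integrated over \<open>t\<close> this becomes
  \<open>(b - a) s\<^sup>\<alpha> \<le> K \<integral>\<^sub>{\<^sub>a \<^sub>< \<^sub>\<phi> \<^sub>\<le> \<^sub>b\<^sub>} |D\<phi>|\<close> whenever all superlevel sets between \<open>a\<close> and \<open>b\<close> have measure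
  more than \<open>s\<close>. In this form the inequality survives convergence in \<open>H\<^sup>1\<^sup>,\<^sup>2\<close> and so holds for \<open>u\<close>
  (\<open>closure_gradient_mass_strip\<close>).
  
  With \<open>a = u\<^sup>*(s + h)\<close> and \<open>b = u\<^sup>*(s)\<close> the strip \<open>{a < u < b}\<close> has measure at most \<open>h\<close>, and the
  Cauchy-Schwarz inequality yields
  \<open>(u\<^sup>*(s) - u\<^sup>*(s + h))\<^sup>2 s\<^sup>2\<^sup>\<alpha> \<le> K\<^sup>2 h \<integral>\<^sub>{\<^sub>a \<^sub>< \<^sub>u \<^sub>< \<^sub>b\<^sub>} |Du|\<^sup>2\<close>. Divide by \<open>h\<^sup>2\<close> and integrate over \<open>s\<close>: a
  given point lies in the strips of a set of \<open>s\<close> of length at most \<open>h\<close>, so by Tonelli the difference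
  quotient of \<open>u\<^sup>*\<close> has weighted energy at most \<open>K\<^sup>2 \<integral> |Du|\<^sup>2\<close> (\<open>difference_quotient_energy\<close>). That
  quotient is the derivative of the moving average of \<open>u\<^sup>*\<close> over an interval of length \<open>h\<close>. The same
  estimate with \<open>a = 0\<close> shows that \<open>u\<^sup>*\<close> tends to \<open>0\<close> at the right end, which is where the vanishing of
  \<open>u\<close> on \<open>F\<close> yields zero boundary values.
  
  Composed with \<open>x \<mapsto> c |x|\<^sup>n\<close>, moving averages of truncations of \<open>u\<^sup>*\<close> become \<open>C\<^sup>1\<close> functions with compact
  support in the ball and energy at most \<open>L\<^sup>2 \<integral> |Du|\<^sup>2\<close>. They converge in \<open>L\<^sup>2\<close> to the symmetrization,
  and a bounded energy together with convergence in \<open>L\<^sup>2\<close> is enough for the limit to lie in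
  \<open>H\<^sub>0\<^sup>1\<^sup>,\<^sup>2\<close> with the same bound (\<open>H12_0_closed\<close>).
\<close>

section \<open>Functions of class \<open>C\<^sup>k\<close> and compact support\<close>

text \<open>
  The direction comes first so that \<open>ddir v f\<close> is again a function on the space.
\<close>

abbreviation ddir :: "'a::euclidean_space \<Rightarrow> ('a \<Rightarrow> 'b::real_normed_vector) \<Rightarrow> 'a \<Rightarrow> 'b" where
  "ddir v f \<equiv> \<lambda>x. frechet_derivative f (at x) v"

lemma Ck_SucI:
  assumes "\<And>x. (f has_derivative f' x) (at x)" "\<And>v. Ck k (\<lambda>x. f' x v)"
  shows "Ck (Suc k) f"
proof -
  have "frechet_derivative f (at x) = f' x" for x
    using frechet_derivative_at[OF assms(1)] by simp
  with assms show ?thesis by (auto simp: differentiable_def)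
qed

lemma Ck_has_derivative:
  assumes "Ck (Suc k) f" shows "(f has_derivative frechet_derivative f (at x)) (at x)"
  using assms frechet_derivative_works by auto

lemma Ck_ddir: "Ck (Suc k) f \<Longrightarrow> Ck k (ddir v f)"
  by simp

lemma Ck_SucD: "Ck (Suc k) f \<Longrightarrow> Ck k f"
proof (induction k arbitrary: f)
  case 0
  then show ?case by (auto intro!: differentiable_imp_continuous_on simp: differentiable_on_def differentiable_at_withinI)
next
  case (Suc k)
  then show ?case by (metis Ck.simps(2))
qed

lemma Ck_le: "Ck k f \<Longrightarrow> j \<le> k \<Longrightarrow> Ck j f"
  by (induction k rule: nat_induct) (auto simp: le_Suc_eq simp del: Ck.simps dest: Ck_SucD)

lemma Ck_1_continuous: "Ck 1 f \<Longrightarrow> continuous_on UNIV f"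
  using Ck_SucD[of 0 f] by simp

lemma Ck_const: "Ck k (\<lambda>x. c)"
proof (induction k arbitrary: c)
  case 0 show ?case by simp
next
  case (Suc k)
  show ?case by (rule Ck_SucI[where f'="\<lambda>x v. 0"]) (auto intro: Suc)
qed

lemma Ck_bounded_linear:
  assumes L: "bounded_linear L"
  shows "Ck k f \<Longrightarrow> Ck k (\<lambda>x. L (f x))"
proof (induction k arbitrary: f)
  case 0
  then show ?case using bounded_linear.continuous_on[OF L] by simp
next
  case (Suc k)
  show ?case
    by (rule Ck_SucI[where f'="\<lambda>x v. L (ddir v f x)"])
       (use Suc bounded_linear.has_derivative[OF L Ck_has_derivative[OF Suc.prems]] in auto)
qed

lemma Ck_ident: "Ck k (\<lambda>x. x)"
proof (cases k)
  case (Suc j)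
  show ?thesis unfolding Suc by (rule Ck_SucI[where f'="\<lambda>x v. v"]) (auto intro: Ck_const)
qed simp

lemma Ck_add: "Ck k f \<Longrightarrow> Ck k g \<Longrightarrow> Ck k (\<lambda>x. f x + g x)"
proof (induction k arbitrary: f g)
  case 0
  then show ?case by (simp add: continuous_on_add)
next
  case (Suc k)
  show ?case
    by (rule Ck_SucI[where f'="\<lambda>x v. ddir v f x + ddir v g x"])
       (use Suc Ck_has_derivative[OF Suc.prems(1)] Ck_has_derivative[OF Suc.prems(2)] 
         in \<open>auto intro: has_derivative_add\<close>)
qed

lemma Ck_scaleR: "Ck k (f :: _ \<Rightarrow> real) \<Longrightarrow> Ck k g \<Longrightarrow> Ck k (\<lambda>x. f x *\<^sub>R g x)"
proof (induction k arbitrary: f g)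
  case 0
  then show ?case by (simp add: continuous_on_scaleR)
next
  case (Suc k)
  show ?case
    by (rule Ck_SucI[where f'="\<lambda>x v. f x *\<^sub>R ddir v g x + ddir v f x *\<^sub>R g x"])
       (use Suc Ck_has_derivative[OF Suc.prems(1)] Ck_has_derivative[OF Suc.prems(2)] 
         in \<open>auto intro!: has_derivative_scaleR Ck_add Suc.IH dest: Ck_SucD simp del: Ck.simps simp: Ck_ddir\<close>)
qed

lemma Ck_mult: "Ck k (f :: _ \<Rightarrow> real) \<Longrightarrow> Ck k g \<Longrightarrow> Ck k (\<lambda>x. f x * g x)"
  using Ck_scaleR[of k f g] by simp

lemma Ck_uminus: "Ck k f \<Longrightarrow> Ck k (\<lambda>x. - f x)"
  using Ck_bounded_linear[OF bounded_linear_minus[OF bounded_linear_ident]] by blast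

lemma Ck_diff: "Ck k f \<Longrightarrow> Ck k g \<Longrightarrow> Ck k (\<lambda>x. f x - g x)"
  using Ck_add[OF _ Ck_uminus, of k f g] by simp

lemma Ck_norm_sq: "Ck k (\<lambda>x::'a::euclidean_space. x \<bullet> x)"
proof (cases k)
  case (Suc j)
  show ?thesis unfolding Suc
    by (rule Ck_SucI[where f'="\<lambda>x v. 2 * (x \<bullet> v)"])
       (auto intro!: derivative_eq_intros Ck_mult Ck_const Ck_bounded_linear[OF bounded_linear_inner_left Ck_ident], simp add: inner_commute)
qed (auto intro!: continuous_intros)

text \<open>
  The function \<open>exp (- 1/t)\<close>, continued by \<open>0\<close>, divided by all powers of \<open>t\<close>: the derivative of a
  member of this family is a combination of two others, so smoothness of all of them follows by one
  induction.
\<close>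

definition flat_exp :: "nat \<Rightarrow> real \<Rightarrow> real" where
  "flat_exp j t = (if t > 0 then exp (- inverse t) * inverse t ^ j else 0)"

lemma flat_exp_tendsto: "(flat_exp j \<longlongrightarrow> 0) (at_right 0)"
proof -
  have "((\<lambda>t::real. inverse t ^ j / exp (inverse t)) \<longlongrightarrow> 0) (at_right 0)"
    by (rule filterlim_compose[OF tendsto_power_div_exp_0 filterlim_inverse_at_top_right])
  then show ?thesis
    by (rule Lim_transform_eventually)
       (auto simp: eventually_at_right_field flat_exp_def exp_minus field_simps intro!: exI[of _ 1])
qed

lemma flat_exp_deriv:
  "(flat_exp j has_real_derivative (flat_exp (j + 2) t - real j * flat_exp (j + 1) t)) (at t)"
proof -
  consider "t > 0" | "t < 0" | "t = 0" by linarith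
  then show ?thesis
  proof cases
    case 1
    have "((\<lambda>t. exp (- inverse t) * inverse t ^ j) has_real_derivative
           (flat_exp (j + 2) t - real j * flat_exp (j + 1) t)) (at t)"
    proof (cases j)
      case 0 then show ?thesis using 1
        by (auto intro!: derivative_eq_intros simp: flat_exp_def power2_eq_square field_simps)
    next
      case (Suc i)
      show ?thesis unfolding Suc
        by (insert 1, rule DERIV_cong[OF DERIV_mult[OF DERIV_fun_exp[OF DERIV_minus[OF DERIV_inverse]]
                DERIV_power[OF DERIV_inverse]]])
           (auto simp: flat_exp_def field_simps)
    qed
    then show ?thesis
      by (rule has_field_derivative_transform_within_open[where S="{0<..}"]) (use 1 in \<open>auto simp: flat_exp_def\<close>)
  next
    case 2
    have "((\<lambda>t. 0) has_real_derivative 0) (at t)" by simp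
    then have "(flat_exp j has_real_derivative 0) (at t)"
      by (rule has_field_derivative_transform_within_open[where S="{..<0}"]) (use 2 in \<open>auto simp: flat_exp_def\<close>)
    with 2 show ?thesis by (simp add: flat_exp_def)
  next
    case 3
    have "((\<lambda>t. (flat_exp j t - flat_exp j 0) / (t - 0)) \<longlongrightarrow> 0) (at 0)"
      unfolding filterlim_at_split
    proof
      show "((\<lambda>t. (flat_exp j t - flat_exp j 0) / (t - 0)) \<longlongrightarrow> 0) (at_left 0)"
        by (rule tendsto_eventually) (auto simp: eventually_at_left_field flat_exp_def intro!: exI[of _ "-1"])
      show "((\<lambda>t. (flat_exp j t - flat_exp j 0) / (t - 0)) \<longlongrightarrow> 0) (at_right 0)"
        by (rule Lim_transform_eventually[OF flat_exp_tendsto[of "Suc j"]])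
           (auto simp: eventually_at_right_field flat_exp_def field_simps intro!: exI[of _ 1])
    qed
    then show ?thesis unfolding 3 has_field_derivative_iff by (simp add: flat_exp_def)
  qed
qed

lemma Ck_flat_exp: "(\<And>k. Ck k (q :: 'a::euclidean_space \<Rightarrow> real)) \<Longrightarrow> Ck k (\<lambda>x. flat_exp j (q x))"
proof (induction k arbitrary: j)
  case 0
  have "continuous_on UNIV (flat_exp j)"
    by (meson DERIV_continuous continuous_at_imp_continuous_on flat_exp_deriv)
  with 0[of 0] show ?case by (auto intro: continuous_on_compose2)
next
  case (Suc k)
  have d: "(q has_derivative frechet_derivative q (at x)) (at x)" for x
    using Ck_has_derivative[OF Suc.prems] .
  show ?case
  proof (rule Ck_SucI[where f'="\<lambda>x v. ddir v q x * (flat_exp (j + 2) (q x) - real j * flat_exp (j + 1) (q x))"])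
    show "((\<lambda>x. flat_exp j (q x)) has_derivative
         (\<lambda>v. ddir v q x * (flat_exp (j + 2) (q x) - real j * flat_exp (j + 1) (q x)))) (at x)" for x
      using has_derivative_compose[OF d flat_exp_deriv[THEN has_field_derivative_imp_has_derivative]] 
      by (simp add: mult.commute)
    show "Ck k (\<lambda>x. ddir v q x * (flat_exp (j + 2) (q x) - real j * flat_exp (j + 1) (q x)))" for v
      by (intro Ck_mult Ck_diff Ck_const Suc.IH Suc.prems Ck_ddir)
  qed
qed

lemma compactly_supported_in_mono: "compactly_supported_in A f \<Longrightarrow> A \<subseteq> B \<Longrightarrow> compactly_supported_in B f"
  unfolding compactly_supported_in_def by blast

lemma uniformly_continuous_compact_support:
  fixes f :: "'a::euclidean_space \<Rightarrow> 'b::real_normed_vector"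
  assumes "continuous_on UNIV f" "compactly_supported_in UNIV f"
  shows "uniformly_continuous_on UNIV f"
proof -
  obtain K where K: "compact K" "\<And>x. x \<notin> K \<Longrightarrow> f x = 0"
    using assms(2) unfolding compactly_supported_in_def by blast
  (* two points at distance less than 1 are both in the larger ball, or f vanishes at both *)
  obtain R where R: "K \<subseteq> cball 0 R"
    using compact_imp_bounded[OF K(1)] unfolding bounded_iff by (auto simp: subset_iff)
  have uc: "uniformly_continuous_on (cball 0 (R + 1)) f"
    by (intro compact_uniformly_continuous continuous_on_subset[OF assms(1)]) auto
  show ?thesis unfolding uniformly_continuous_on_def
  proof (intro allI impI)
    fix e :: real assume "e > 0"
    then obtain d where d: "d > 0" "\<And>x y. x \<in> cball 0 (R+1) \<Longrightarrow> y \<in> cball 0 (R+1) \<Longrightarrow> dist y x < d \<Longrightarrow> dist (f y) (f x) < e"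
      using uc unfolding uniformly_continuous_on_def by metis
    show "\<exists>d>0. \<forall>x\<in>UNIV. \<forall>y\<in>UNIV. dist y x < d \<longrightarrow> dist (f y) (f x) < e"
    proof (intro exI[of _ "min d 1"] conjI ballI impI)
      fix x y :: 'a assume xy: "dist y x < min d 1"
      show "dist (f y) (f x) < e"
      proof (cases "x \<in> cball 0 R \<or> y \<in> cball 0 R")
        case True
        have "norm x \<le> norm y + dist y x" "norm y \<le> norm x + dist y x"
          using norm_triangle_ineq2[of x y] norm_triangle_ineq2[of y x] by (auto simp: dist_norm norm_minus_commute)
        with True xy show ?thesis by (intro d) auto
      next
        case False
        then have "x \<notin> K" "y \<notin> K" using R by blast+
        then have "f x = 0" "f y = 0" using K by blast+
        then show ?thesis using \<open>e > 0\<close> by simp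
      qed
    qed (use d in auto)
  qed
qed

lemma bounded_compact_support:
  fixes f :: "'a::euclidean_space \<Rightarrow> 'b::real_normed_vector"
  assumes "continuous_on UNIV f" "compactly_supported_in UNIV f"
  obtains B where "B > 0" "\<And>x. norm (f x) \<le> B"
proof -
  obtain K where K: "compact K" "\<And>x. x \<notin> K \<Longrightarrow> f x = 0"
    using assms(2) unfolding compactly_supported_in_def by blast
  have "bounded (f ` K)" 
    by (intro compact_imp_bounded compact_continuous_image K continuous_on_subset[OF assms(1)]) auto
  then obtain B where "B > 0" "\<And>y. y \<in> f ` K \<Longrightarrow> norm y \<le> B" unfolding bounded_pos by blast
  then have "norm (f x) \<le> B" for x using K(2)[of x] by (cases "x \<in> K") auto
  with \<open>B > 0\<close> show ?thesis using that by blast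
qed

lemma integrable_compact_support:
  fixes f :: "'a::euclidean_space \<Rightarrow> 'b::euclidean_space"
  assumes "continuous_on UNIV f" "compactly_supported_in UNIV f"
  shows "integrable lborel f"
proof -
  obtain K where K: "compact K" "\<And>x. x \<notin> K \<Longrightarrow> f x = 0"
    using assms(2) unfolding compactly_supported_in_def by blast
  have "integrable lborel (\<lambda>x. indicator K x *\<^sub>R f x)"
    by (rule borel_integrable_compact[OF K(1)]) (use assms(1) continuous_on_subset in blast)
  moreover have "(\<lambda>x. indicator K x *\<^sub>R f x) = f" using K(2) by (auto simp: indicator_def)
  ultimately show ?thesis by simp
qed

lemma ddir_support:
  assumes "compactly_supported_in \<Omega> f"
  shows "compactly_supported_in \<Omega> (ddir v f)"
proof -
  obtain K where K: "compact K" "K \<subseteq> \<Omega>" "\<And>x. x \<notin> K \<Longrightarrow> f x = 0"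
    using assms unfolding compactly_supported_in_def by blast
  have "ddir v f x = 0" if "x \<notin> K" for x
  proof -
    have "((\<lambda>x. 0) has_derivative (\<lambda>x. 0)) (at x)" by simp
    then have "(f has_derivative (\<lambda>x. 0)) (at x)"
      by (rule has_derivative_transform_within_open[OF _ open_Compl[OF compact_imp_closed[OF K(1)]]])
         (use K that in auto)
    then show ?thesis using frechet_derivative_at by metis
  qed
  with K show ?thesis unfolding compactly_supported_in_def by blast
qed

text \<open>
  The partial derivatives are uniformly continuous because they have compact support; hence the
  error of the linear approximation is small uniformly in the base point. Every limit of difference
  quotients below rests on this uniformity.
\<close>

lemma uniform_derivative:
  fixes f :: "'a::euclidean_space \<Rightarrow> real"
  assumes f: "Ck 1 f" "compactly_supported_in UNIV f" and "e > 0"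
  obtains d where "d > 0" "\<And>x z. norm z < d \<Longrightarrow> \<bar>f (x + z) - f x - ddir z f x\<bar> \<le> e * norm z"
proof -
  let ?e = "e / real DIM('a)"
  have e: "?e > 0" using \<open>e > 0\<close> by simp
  have "\<exists>d>0. \<forall>x y. dist y x < d \<longrightarrow> dist (ddir b f y) (ddir b f x) < ?e" for b
    using uniformly_continuous_compact_support[OF _ ddir_support[OF f(2)], of b] f(1) e
    unfolding uniformly_continuous_on_def by simp
  then obtain D where D: "\<And>b. D b > 0" "\<And>b x y. dist y x < D b \<Longrightarrow> dist (ddir b f y) (ddir b f x) < ?e"
    by metis
  define d where "d = Min (D ` (Basis::'a set))"
  have d: "d > 0" "\<And>b. b \<in> Basis \<Longrightarrow> d \<le> D b" unfolding d_def using D(1) by auto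
  have der: "(f has_derivative frechet_derivative f (at x)) (at x)" for x
    using Ck_has_derivative f(1) by (metis One_nat_def)
  have lin: "bounded_linear (frechet_derivative f (at x))" for x
    using der has_derivative_bounded_linear by blast
  show ?thesis
  proof (rule that[OF d(1)])
    fix x z :: 'a assume z: "norm z < d"
    have on: "onorm (frechet_derivative f (at y) - frechet_derivative f (at x)) \<le> e"
      if "y \<in> closed_segment x (x + z)" for y
    proof -
      have "dist y x < d" using that z dist_in_closed_segment[OF that] by (auto simp: dist_norm norm_minus_commute)
      then have *: "norm (ddir b f y - ddir b f x) \<le> ?e" if "b \<in> Basis" for b
        using D(2)[of y x b] d(2)[OF that] by (auto simp: dist_norm)
      have "onorm (\<lambda>v. frechet_derivative f (at y) v - frechet_derivative f (at x) v) \<le> 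
            (\<Sum>b\<in>Basis. norm (ddir b f y - ddir b f x))"
        by (rule onorm_componentwise) (intro bounded_linear_sub lin)
      also have "\<dots> \<le> (\<Sum>b\<in>(Basis::'a set). ?e)" by (rule sum_mono) (use * in auto)
      finally show ?thesis by (simp add: fun_diff_def)
    qed
    have seg: "x + t *\<^sub>R (x + z - x) \<in> closed_segment x (x + z)" if "t \<in> {0..1}" for t
      using that by (auto simp: closed_segment_def algebra_simps intro!: exI[of _ t])
    have "norm (f (x + z) - f x - frechet_derivative f (at x) (x + z - x)) \<le> norm (x + z - x) * e"
      by (rule differentiable_bound_linearization[where S="closed_segment x (x + z)",
            OF seg has_derivative_at_withinI[OF der] on]) auto
    then show "\<bar>f (x + z) - f x - ddir z f x\<bar> \<le> e * norm z" by (simp add: mult.commute)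
  qed
qed

section \<open>Convolution and mollification\<close>

lemma integrable_mult_bounded:
  fixes f g :: "'a \<Rightarrow> real"
  assumes "integrable M f" "g \<in> borel_measurable M" "\<And>x. x \<in> space M \<Longrightarrow> \<bar>g x\<bar> \<le> B"
  shows "integrable M (\<lambda>x. f x * g x)"
proof (rule Bochner_Integration.integrable_bound)
  show "integrable M (\<lambda>x. B * f x)" using assms by simp
  show "(\<lambda>x. f x * g x) \<in> borel_measurable M" using assms by (auto dest: borel_measurable_integrable)
  show "AE x in M. norm (f x * g x) \<le> norm (B * f x)"
  proof (rule AE_I2)
    fix x assume "x \<in> space M"
    then have "\<bar>g x\<bar> \<le> \<bar>B\<bar>" using assms(3)[of x] by linarith
    then have "\<bar>f x\<bar> * \<bar>g x\<bar> \<le> \<bar>f x\<bar> * \<bar>B\<bar>" by (intro mult_left_mono) auto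
    then show "norm (f x * g x) \<le> norm (B * f x)" by (simp add: abs_mult mult.commute)
  qed
qed

lemma abs_integral_mult_le:
  fixes f h :: "'a \<Rightarrow> real"
  assumes f: "integrable M f" and fh: "integrable M (\<lambda>x. f x * h x)"
    and h: "\<And>x. x \<in> space M \<Longrightarrow> \<bar>h x\<bar> \<le> c"
  shows "\<bar>LINT x|M. f x * h x\<bar> \<le> c * (LINT x|M. \<bar>f x\<bar>)"
proof -
  have "\<bar>LINT x|M. f x * h x\<bar> \<le> (LINT x|M. c * \<bar>f x\<bar>)"
  proof (rule order_trans[OF integral_abs_bound], rule integral_mono)
    show "\<bar>f x * h x\<bar> \<le> c * \<bar>f x\<bar>" if "x \<in> space M" for x
      using mult_left_mono[OF h[OF that], of "\<bar>f x\<bar>"] by (simp add: abs_mult mult.commute)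
  qed (use f fh in auto)
  then show ?thesis by simp
qed

text \<open>
  The usual last line of an approximation argument in which the error is \<open>e\<close> times a fixed integral.
\<close>

lemma eq_0_if_le_mult_epsilon:
  fixes x c :: real
  assumes "0 \<le> c" and le: "\<And>e. 0 < e \<Longrightarrow> \<bar>x\<bar> \<le> e * c"
  shows "x = 0"
proof -
  have "\<bar>x\<bar> \<le> 0"
  proof (rule field_le_epsilon)
    fix e :: real assume "e > 0"
    then have "\<bar>x\<bar> \<le> e / (1 + c) * c" using assms(1) by (intro le) auto
    also have "\<dots> \<le> e" using assms(1) \<open>e > 0\<close> by (auto simp: field_simps)
    finally show "\<bar>x\<bar> \<le> 0 + e" by simp
  qed
  then show ?thesis by simp
qed

definition conv :: "('a::euclidean_space \<Rightarrow> real) \<Rightarrow> ('a \<Rightarrow> real) \<Rightarrow> 'a \<Rightarrow> real" where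
  "conv f g x = (LINT y|lborel. f y * g (x - y))"

lemma conv_integrable:
  fixes g :: "'a::euclidean_space \<Rightarrow> real"
  assumes "integrable lborel f" "continuous_on UNIV g" "compactly_supported_in UNIV g"
  shows "integrable lborel (\<lambda>y. f y * g (x - y))"
proof -
  obtain B where B: "\<And>x. norm (g x) \<le> B" using bounded_compact_support assms by metis
  have "continuous_on UNIV (\<lambda>y. g (x - y))"
    by (rule continuous_on_compose2[OF assms(2)]) (auto intro!: continuous_intros)
  then show ?thesis using B
    by (intro integrable_mult_bounded[OF assms(1), of _ B]) (auto simp: borel_measurable_continuous_onI)
qed

lemma lborel_integral_reflect:
  fixes h :: "'a::euclidean_space \<Rightarrow> real"
  assumes "h \<in> borel_measurable borel"
  shows "(LINT y|lborel. h (x - y)) = (LINT y|lborel. h y)"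
proof -
  have "(lborel :: 'a measure) = distr lborel borel (\<lambda>y. x - y)"
    using lborel_affine[of "-1" x] by (simp add: density_1)
  then have "(LINT y|lborel. h y) = (LINT y|distr lborel borel (\<lambda>y. x - y). h y)" by simp
  also have "\<dots> = (LINT y|lborel. h (x - y))"
    by (rule integral_distr) (use assms in auto)
  finally show ?thesis by simp
qed

lemma conv_commute:
  assumes [measurable]: "f \<in> borel_measurable borel" "g \<in> borel_measurable borel"
  shows "conv f g x = conv g f x"
proof -
  have "(\<lambda>y. f y * g (x - y)) \<in> borel_measurable borel" by measurable
  from lborel_integral_reflect[OF this, of x] show ?thesis
    unfolding conv_def by (simp add: mult.commute)
qed

text \<open>
  Only the second factor has to be differentiable. By commutativity the derivative may therefore be
  put on either factor: on the mollifier to see smoothness, on the mollified function to see that its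
  derivatives are approximated too.
\<close>

lemma conv_has_derivative:
  fixes f g :: "'a::euclidean_space \<Rightarrow> real"
  assumes f: "integrable lborel f" and g: "Ck 1 g" "compactly_supported_in UNIV g"
  shows "(conv f g has_derivative (\<lambda>v. conv f (ddir v g) x)) (at x)"
  unfolding has_derivative_at_alt
proof (intro conjI allI impI)
  have gd: "(g has_derivative frechet_derivative g (at y)) (at y)" for y
    using Ck_has_derivative g(1) by (metis One_nat_def)
  have lin: "linear (frechet_derivative g (at y))" for y
    using gd has_derivative_linear by blast
  have intd: "integrable lborel (\<lambda>y. f y * ddir v g (x - y))" for v x
    by (rule conv_integrable[OF f _ ddir_support[OF g(2)]]) (use g in simp)
  have intg: "integrable lborel (\<lambda>y. f y * g (x - y))" for x
    by (rule conv_integrable[OF f Ck_1_continuous[OF g(1)] g(2)])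
  have "linear (\<lambda>v. conv f (ddir v g) x)"
  proof (rule linearI)
    show "conv f (ddir (v + w) g) x = conv f (ddir v g) x + conv f (ddir w g) x" for v w
      unfolding conv_def by (simp add: linear_add[OF lin] distrib_left Bochner_Integration.integral_add[OF intd intd])
    show "conv f (ddir (r *\<^sub>R v) g) x = r *\<^sub>R conv f (ddir v g) x" for r v
      unfolding conv_def by (simp add: linear_scale[OF lin] mult.left_commute)
  qed
  then show "bounded_linear (\<lambda>v. conv f (ddir v g) x)"
    by (rule linear_conv_bounded_linear[THEN iffD1])
  fix e :: real assume "e > 0"
  define I where "I = (LINT y|lborel. \<bar>f y\<bar>)"
  have "I \<ge> 0" unfolding I_def by (simp add: integral_nonneg)
  then have e': "e / (1 + I) > 0" using \<open>e > 0\<close> by simp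
  obtain d where d: "d > 0" "\<And>x z. norm z < d \<Longrightarrow> \<bar>g (x + z) - g x - ddir z g x\<bar> \<le> e / (1 + I) * norm z"
    using uniform_derivative[OF g e'] by blast
  show "\<exists>d>0. \<forall>y. norm (y - x) < d \<longrightarrow>
       norm (conv f g y - conv f g x - conv f (ddir (y - x) g) x) \<le> e * norm (y - x)"
  proof (intro exI[of _ d] conjI allI impI d(1))
    fix x' assume x': "norm (x' - x) < d"
    let ?h = "\<lambda>y. g (x' - y) - g (x - y) - ddir (x' - x) g (x - y)"
    have i: "integrable lborel (\<lambda>y. f y * ?h y)"
      unfolding right_diff_distrib by (intro Bochner_Integration.integrable_diff intg intd)
    have eqI: "conv f g x' - conv f g x - conv f (ddir (x' - x) g) x = (LINT y|lborel. f y * ?h y)"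
      unfolding conv_def right_diff_distrib using intg intd by simp
    have "\<bar>conv f g x' - conv f g x - conv f (ddir (x' - x) g) x\<bar> \<le> e / (1 + I) * norm (x' - x) * I"
      unfolding eqI
    proof (subst (2) I_def, rule abs_integral_mult_le[OF f i])
      show "\<bar>?h y\<bar> \<le> e / (1 + I) * norm (x' - x)" for y
        using d(2)[OF x', of "x - y"] by (simp add: algebra_simps)
    qed
    also have "\<dots> = I / (1 + I) * e * norm (x' - x)" by simp
    also have "\<dots> \<le> e * norm (x' - x)"
      using \<open>I \<ge> 0\<close> \<open>e > 0\<close> by (intro mult_right_mono) (auto simp: field_simps)
    finally show "norm (conv f g x' - conv f g x - conv f (ddir (x' - x) g) x) \<le> e * norm (x' - x)"
      by simp
  qed
qed

lemma ddir_conv: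
  assumes "integrable lborel f" "Ck 1 g" "compactly_supported_in UNIV g"
  shows "ddir v (conv f g) = conv f (ddir v g)"
proof
  fix x show "ddir v (conv f g) x = conv f (ddir v g) x"
    using frechet_derivative_at[OF conv_has_derivative[OF assms], of x, symmetric] by simp
qed

lemma Ck_conv:
  assumes f: "integrable lborel f"
  shows "Ck k g \<Longrightarrow> compactly_supported_in UNIV g \<Longrightarrow> Ck k (conv f g)"
proof (induction k arbitrary: g)
  case 0
  define I where "I = (LINT y|lborel. \<bar>f y\<bar>)"
  have I: "I \<ge> 0" unfolding I_def by (simp add: integral_nonneg)
  have intg: "integrable lborel (\<lambda>y. f y * g (x - y))" for x
    by (rule conv_integrable[OF f _ 0(2)]) (use 0 in simp)
  have "\<exists>d>0. \<forall>x'. dist x' x < d \<longrightarrow> dist (conv f g x') (conv f g x) \<le> e" if "e > 0" for e x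
  proof -
    have e': "e / (1 + I) > 0" using \<open>e > 0\<close> I by simp
    obtain d where d: "d > 0" "\<And>x y. dist y x < d \<Longrightarrow> dist (g y) (g x) < e / (1 + I)"
      using uniformly_continuous_compact_support[OF _ 0(2)] 0(1) e' unfolding uniformly_continuous_on_def by auto
    show ?thesis
    proof (intro exI[of _ d] conjI allI impI d(1))
      fix x' assume x': "dist x' x < d"
      have i: "integrable lborel (\<lambda>y. f y * (g (x' - y) - g (x - y)))" by (simp add: right_diff_distrib intg)
      have eqI: "conv f g x' - conv f g x = (LINT y|lborel. f y * (g (x' - y) - g (x - y)))"
        unfolding conv_def right_diff_distrib using intg by simp
      have "\<bar>conv f g x' - conv f g x\<bar> \<le> e / (1 + I) * I" unfolding eqI
      proof (subst (2) I_def, rule abs_integral_mult_le[OF f i])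
        show "\<bar>g (x' - y) - g (x - y)\<bar> \<le> e / (1 + I)" for y
          using d(2)[of "x' - y" "x - y"] x' by (auto simp: dist_norm)
      qed
      also have "\<dots> = I / (1 + I) * e" by simp
      also have "\<dots> \<le> e" using I \<open>e > 0\<close> by (auto simp: field_simps)
      finally show "dist (conv f g x') (conv f g x) \<le> e" by (simp add: dist_norm)
    qed
  qed
  then have "\<exists>d>0. \<forall>x'. dist x' x < d \<longrightarrow> dist (conv f g x') (conv f g x) < e" if "e > 0" for e x
    using that by (metis field_sum_of_halves half_gt_zero less_add_same_cancel1 order_le_less_trans)
  then show ?case by (simp add: continuous_on_iff)
next
  case (Suc k)
  have g1: "Ck 1 g" by (rule Ck_le[OF Suc.prems(1)]) simp
  show ?case
  proof (rule Ck_SucI)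
    show "(conv f g has_derivative (\<lambda>v. conv f (ddir v g) x)) (at x)" for x
      by (rule conv_has_derivative[OF f g1 Suc.prems(2)])
    show "Ck k (\<lambda>x. conv f (ddir v g) x)" for v
      by (rule Suc.IH) (use Suc.prems ddir_support in auto)
  qed
qed

definition bump :: "real \<Rightarrow> 'a::euclidean_space \<Rightarrow> real" where
  "bump \<epsilon> x = flat_exp 0 (\<epsilon>\<^sup>2 - x \<bullet> x)"

definition mollifier :: "real \<Rightarrow> 'a::euclidean_space \<Rightarrow> real" where
  "mollifier \<epsilon> x = bump \<epsilon> x / (LINT y|lborel. bump \<epsilon> (y::'a))"

lemma Ck_bump: "Ck k (bump \<epsilon>)"
  unfolding bump_def by (intro Ck_flat_exp Ck_diff Ck_const Ck_norm_sq)

lemma bump_pos_iff: "\<epsilon> > 0 \<Longrightarrow> bump \<epsilon> x > 0 \<longleftrightarrow> norm x < \<epsilon>"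
  by (auto simp: bump_def flat_exp_def dot_square_norm intro: power_less_imp_less_base power_strict_mono)

lemma bump_nonneg: "bump \<epsilon> x \<ge> 0"
  by (auto simp: bump_def flat_exp_def)

lemma bump_support: "\<epsilon> > 0 \<Longrightarrow> x \<notin> cball 0 \<epsilon> \<Longrightarrow> bump \<epsilon> x = 0"
  using bump_pos_iff[of \<epsilon> x] bump_nonneg[of \<epsilon> x] by auto

lemma bump_compact: "\<epsilon> > 0 \<Longrightarrow> compactly_supported_in UNIV (bump \<epsilon>)"
  unfolding compactly_supported_in_def using bump_support by (intro exI[of _ "cball 0 \<epsilon>"]) auto

lemma integrable_bump: "\<epsilon> > 0 \<Longrightarrow> integrable lborel (bump \<epsilon> :: 'a::euclidean_space \<Rightarrow> real)"
  by (intro integrable_compact_support bump_compact) (use Ck_bump[of 0] in auto)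

lemma bump_integral_pos:
  assumes "\<epsilon> > 0" shows "(LINT y|lborel. bump \<epsilon> (y::'a::euclidean_space)) > 0"
proof (rule ccontr)
  assume "\<not> ?thesis"
  then have "(LINT y|lborel. bump \<epsilon> (y::'a)) = 0"
    using Bochner_Integration.integral_nonneg[of lborel "bump \<epsilon> :: 'a \<Rightarrow> real", OF bump_nonneg] by linarith
  then have "AE y in lborel. bump \<epsilon> (y::'a) = 0"
    using integral_nonneg_eq_0_iff_AE[OF integrable_bump[OF assms, where 'a='a]] bump_nonneg by auto
  moreover have "y \<notin> ball 0 \<epsilon>" if "bump \<epsilon> y = 0" for y :: 'a
    using bump_pos_iff[OF assms, of y] that by auto
  ultimately have "AE y in lborel. (y::'a) \<notin> ball 0 \<epsilon>"
    by (auto elim!: eventually_mono)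
  then have "emeasure lborel (ball (0::'a) \<epsilon>) = 0"
    by (subst (asm) AE_iff_measurable[of "ball 0 \<epsilon>"]) auto
  then have "emeasure lebesgue (ball (0::'a) \<epsilon>) = 0" by simp
  then show False using content_ball_pos[OF assms, of "0::'a"] by (simp add: measure_def)
qed

lemma mollifier:
  assumes "\<epsilon> > 0"
  shows Ck_mollifier: "Ck k (mollifier \<epsilon> :: 'a::euclidean_space \<Rightarrow> real)"
    and mollifier_nonneg: "mollifier \<epsilon> (x::'a) \<ge> 0"
    and mollifier_support: "(x::'a) \<notin> cball 0 \<epsilon> \<Longrightarrow> mollifier \<epsilon> x = 0"
    and mollifier_compact: "compactly_supported_in UNIV (mollifier \<epsilon> :: 'a \<Rightarrow> real)"
    and integrable_mollifier: "integrable lborel (mollifier \<epsilon> :: 'a \<Rightarrow> real)"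
    and integral_mollifier: "(LINT y|lborel. mollifier \<epsilon> (y::'a)) = 1"
proof -
  let ?I = "LINT y|lborel. bump \<epsilon> (y::'a)"
  have I: "?I > 0" by (rule bump_integral_pos[OF assms])
  have eq: "(mollifier \<epsilon> :: 'a \<Rightarrow> real) = (\<lambda>x. (1 / ?I) * bump \<epsilon> x)" by (auto simp: mollifier_def)
  show "Ck k (mollifier \<epsilon> :: 'a \<Rightarrow> real)" unfolding eq by (intro Ck_mult Ck_const Ck_bump)
  show "mollifier \<epsilon> (x::'a) \<ge> 0" using I bump_nonneg[of \<epsilon> x] by (simp add: mollifier_def)
  show "mollifier \<epsilon> x = 0" if "(x::'a) \<notin> cball 0 \<epsilon>" using bump_support[OF assms that] by (simp add: mollifier_def)
  show "compactly_supported_in UNIV (mollifier \<epsilon> :: 'a \<Rightarrow> real)"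
    using bump_compact[OF assms, where 'a='a] unfolding compactly_supported_in_def mollifier_def by auto
  show "integrable lborel (mollifier \<epsilon> :: 'a \<Rightarrow> real)" unfolding eq using integrable_bump[OF assms, where 'a='a] by simp
  show "(LINT y|lborel. mollifier \<epsilon> (y::'a)) = 1" unfolding eq using I by simp
qed

text \<open>
  An average over a ball of radius \<open>\<epsilon>\<close> differs from the centre value by at most the oscillation there.
\<close>

lemma mollify_close:
  fixes f :: "'a::euclidean_space \<Rightarrow> real"
  assumes f: "continuous_on UNIV f" "compactly_supported_in UNIV f" and "\<epsilon> > 0"
    and e: "\<And>x y. dist x y \<le> \<epsilon> \<Longrightarrow> \<bar>f x - f y\<bar> \<le> e"
  shows "\<bar>conv (mollifier \<epsilon>) f x - f x\<bar> \<le> e"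
proof -
  note m = mollifier[where 'a='a, OF \<open>\<epsilon> > 0\<close>]
  have int: "integrable lborel (\<lambda>y. mollifier \<epsilon> y * f (x - y))"
    by (rule conv_integrable[OF m(5) f])
  have int2: "integrable lborel (\<lambda>y::'a. mollifier \<epsilon> y * f x)" using m(5) by simp
  have eqI: "conv (mollifier \<epsilon>) f x - f x = (LINT y|lborel. mollifier \<epsilon> y * f (x - y) - mollifier \<epsilon> y * f x)"
    unfolding conv_def using int int2 m(6) by simp
  have "\<bar>conv (mollifier \<epsilon>) f x - f x\<bar> \<le> (LINT y|lborel. \<bar>mollifier \<epsilon> y * f (x - y) - mollifier \<epsilon> y * f x\<bar>)"
    unfolding eqI by (rule integral_abs_bound)
  also have "\<dots> \<le> (LINT y|lborel. mollifier \<epsilon> (y::'a) * e)"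
  proof (rule integral_mono)
    show "integrable lborel (\<lambda>y. \<bar>mollifier \<epsilon> y * f (x - y) - mollifier \<epsilon> y * f x\<bar>)" using int int2 by simp
    show "integrable lborel (\<lambda>y::'a. mollifier \<epsilon> y * e)" using m(5) by simp
    show "\<bar>mollifier \<epsilon> y * f (x - y) - mollifier \<epsilon> y * f x\<bar> \<le> mollifier \<epsilon> y * e" for y
    proof (cases "y \<in> cball 0 \<epsilon>")
      case True
      then have "\<bar>f (x - y) - f x\<bar> \<le> e" by (intro e) (auto simp: dist_norm)
      then have "mollifier \<epsilon> y * \<bar>f (x - y) - f x\<bar> \<le> mollifier \<epsilon> y * e" by (intro mult_left_mono m)
      then show ?thesis using m(2)[of y] by (simp add: abs_mult flip: right_diff_distrib)
    next
      case False
      then show ?thesis using m(3) by simp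
    qed
  qed
  also have "\<dots> = e" using m(6) by simp
  finally show ?thesis .
qed

lemma conv_mollifier_support:
  fixes f :: "'a::euclidean_space \<Rightarrow> real"
  assumes "\<epsilon> > 0" "compact K" "\<And>x. x \<notin> K \<Longrightarrow> f x = 0" "(\<Union>x\<in>K. cball x \<epsilon>) \<subseteq> \<Omega>"
  shows "compactly_supported_in \<Omega> (conv (mollifier \<epsilon>) f)"
  unfolding compactly_supported_in_def
proof (intro exI conjI allI impI)
  show "compact (\<Union>x\<in>K. cball x \<epsilon>)" by (rule compact_minkowski_sum_cball[OF assms(2)])
  show "(\<Union>x\<in>K. cball x \<epsilon>) \<subseteq> \<Omega>" by fact
  fix x assume x: "x \<notin> (\<Union>x\<in>K. cball x \<epsilon>)"
  have "mollifier \<epsilon> y * f (x - y) = 0" for y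
  proof (cases "x - y \<in> K")
    case True
    then have "y \<notin> cball 0 \<epsilon>" using x by (auto simp: dist_norm)
    then show ?thesis using mollifier_support[where 'a='a, OF assms(1)] by simp
  qed (use assms(3) in simp)
  then show "conv (mollifier \<epsilon>) f x = 0" by (simp only: conv_def integral_zero)
qed

lemma Ck_conv_mollifier:
  fixes f :: "'a::euclidean_space \<Rightarrow> real"
  assumes "\<epsilon> > 0" "continuous_on UNIV f" "compactly_supported_in UNIV f"
  shows "Ck k (conv (mollifier \<epsilon>) f)"
proof -
  note m = mollifier[where 'a='a, OF \<open>\<epsilon> > 0\<close>]
  have "conv (mollifier \<epsilon>) f = conv f (mollifier \<epsilon>)"
    using conv_commute[OF borel_measurable_continuous_onI[OF assms(2)] borel_measurable_continuous_onI] m(1)[of 0]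
    by auto
  then show ?thesis using Ck_conv[OF integrable_compact_support[OF assms(2,3)] m(1) m(4)] by simp
qed

text \<open>
  One mollifier serves for the function and, if it is \<open>C\<^sup>1\<close>, for finitely many of its directional
  derivatives at once. The radius is below the distance from the support to the complement of \<open>\<Omega>\<close> and
  below the moduli of continuity that belong to \<open>e\<close>.
\<close>

lemma smooth_approx_uniform:
  fixes f :: "'a::euclidean_space \<Rightarrow> real" and S :: "'a set"
  assumes f: "continuous_on UNIV f" "compactly_supported_in \<Omega> f" and "open \<Omega>" "e > 0"
  shows "\<exists>\<epsilon>>0. conv (mollifier \<epsilon>) f \<in> Cc_infinity \<Omega> \<and> (\<forall>x. \<bar>conv (mollifier \<epsilon>) f x - f x\<bar> \<le> e) \<and>
           (Ck 1 f \<longrightarrow> finite S \<longrightarrow> (\<forall>v\<in>S. \<forall>x. \<bar>ddir v (conv (mollifier \<epsilon>) f) x - ddir v f x\<bar> \<le> e))"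
proof -
  obtain K where K: "compact K" "K \<subseteq> \<Omega>" "\<And>x. x \<notin> K \<Longrightarrow> f x = 0"
    using f(2) unfolding compactly_supported_in_def by blast
  have fU: "compactly_supported_in UNIV f" using f(2) compactly_supported_in_mono by blast
  obtain \<rho> where \<rho>: "\<rho> > 0" "(\<Union>x\<in>K. cball x \<rho>) \<subseteq> \<Omega>"
    using compact_subset_open_imp_cball_epsilon_subset[OF K(1) \<open>open \<Omega>\<close> K(2)] by blast
  have uc: "\<exists>d>0. \<forall>x y. dist x y < d \<longrightarrow> \<bar>h x - h y\<bar> \<le> e"
    if "continuous_on UNIV h" "compactly_supported_in UNIV h" for h :: "'a \<Rightarrow> real"
    using uniformly_continuous_compact_support[OF that] \<open>e > 0\<close>
    unfolding uniformly_continuous_on_def dist_real_def by (metis UNIV_I less_imp_le)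
  obtain d where d: "d > 0" "\<And>x y. dist x y < d \<Longrightarrow> \<bar>f x - f y\<bar> \<le> e" using uc[OF f(1) fU] by blast
  have "\<exists>d'>0. Ck 1 f \<longrightarrow> finite S \<longrightarrow> (\<forall>v\<in>S. \<forall>x y. dist x y < d' \<longrightarrow> \<bar>ddir v f x - ddir v f y\<bar> \<le> e)"
  proof (cases "Ck 1 f \<and> finite S")
    case True
    then have "\<forall>v. \<exists>d>0. \<forall>x y. dist x y < d \<longrightarrow> \<bar>ddir v f x - ddir v f y\<bar> \<le> e"
      using uc[OF _ ddir_support[OF fU]] by simp
    then obtain D where D: "\<And>v. D v > 0" "\<And>v x y. dist x y < D v \<Longrightarrow> \<bar>ddir v f x - ddir v f y\<bar> \<le> e"
      by metis
    show ?thesis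
      by (rule exI[of _ "Min (insert 1 (D ` S))"]) (use True D in auto)
  qed (auto intro: exI[of _ 1])
  then obtain d' where d': "d' > 0" "Ck 1 f \<longrightarrow> finite S \<longrightarrow> (\<forall>v\<in>S. \<forall>x y. dist x y < d' \<longrightarrow> \<bar>ddir v f x - ddir v f y\<bar> \<le> e)"
    by blast
  define \<epsilon> where "\<epsilon> = min \<rho> (min d d' / 2)"
  have \<epsilon>: "\<epsilon> > 0" "\<epsilon> \<le> \<rho>" "\<epsilon> < d" "\<epsilon> < d'" unfolding \<epsilon>_def using \<rho> d d' by auto
  have "compactly_supported_in \<Omega> (conv (mollifier \<epsilon>) f)"
    by (rule conv_mollifier_support[OF \<epsilon>(1) K(1,3)]) (use \<rho>(2) \<epsilon>(2) in \<open>auto, force\<close>)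
  then have 1: "conv (mollifier \<epsilon>) f \<in> Cc_infinity \<Omega>"
    unfolding Cc_infinity_def using Ck_conv_mollifier[OF \<epsilon>(1) f(1) fU] by auto
  have 2: "\<bar>conv (mollifier \<epsilon>) f x - f x\<bar> \<le> e" for x
    by (rule mollify_close[OF f(1) fU \<epsilon>(1)]) (use d(2) \<epsilon>(3) in auto)
  have 3: "\<bar>ddir v (conv (mollifier \<epsilon>) f) x - ddir v f x\<bar> \<le> e" if "Ck 1 f" "finite S" "v \<in> S" for v x
  proof -
    have "ddir v (conv (mollifier \<epsilon>) f) x = conv (mollifier \<epsilon>) (ddir v f) x"
      by (rule fun_cong[OF ddir_conv[OF integrable_mollifier[OF \<epsilon>(1)] that(1) fU]])
    moreover have "\<bar>conv (mollifier \<epsilon>) (ddir v f) x - ddir v f x\<bar> \<le> e"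
      by (rule mollify_close[OF _ ddir_support[OF fU] \<epsilon>(1)]) (use that d'(2) \<epsilon>(4) in auto)
    ultimately show ?thesis by simp
  qed
  show ?thesis using 1 2 3 \<epsilon>(1) by blast
qed

section \<open>Integration by parts\<close>

lemma lebesgue_on_integral_indicator:
  fixes f :: "'a::euclidean_space \<Rightarrow> real"
  assumes "open \<Omega>" "(\<lambda>x. indicator \<Omega> x * f x) \<in> borel_measurable borel"
  shows "(LINT x|lebesgue_on \<Omega>. f x) = (LINT x|lborel. indicator \<Omega> x * f x)"
    and "integrable (lebesgue_on \<Omega>) f \<longleftrightarrow> integrable lborel (\<lambda>x. indicator \<Omega> x * f x)"
proof -
  have s: "\<Omega> \<inter> space lebesgue \<in> sets lebesgue" using assms(1) by simp
  show "(LINT x|lebesgue_on \<Omega>. f x) = (LINT x|lborel. indicator \<Omega> x * f x)"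
    unfolding integral_restrict_space[OF s] using integral_completion[of _ lborel] assms(2) by simp
  show "integrable (lebesgue_on \<Omega>) f \<longleftrightarrow> integrable lborel (\<lambda>x. indicator \<Omega> x * f x)"
    unfolding integrable_restrict_space[OF s] using integrable_completion[of _ lborel] assms(2) by simp
qed

lemma lebesgue_on_integral_borel:
  fixes f :: "'a::euclidean_space \<Rightarrow> real"
  assumes "open \<Omega>" "f \<in> borel_measurable borel" "\<And>x. x \<notin> \<Omega> \<Longrightarrow> f x = 0"
  shows "(LINT x|lebesgue_on \<Omega>. f x) = (LINT x|lborel. f x)"
    and "integrable (lebesgue_on \<Omega>) f \<longleftrightarrow> integrable lborel f"
proof -
  have "indicator \<Omega> x * f x = f x" for x using assms(3)[of x] by (cases "x \<in> \<Omega>") auto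
  then have "(\<lambda>x. indicator \<Omega> x * f x) = f" by blast
  with lebesgue_on_integral_indicator[OF assms(1), of f] assms(2)
  show "(LINT x|lebesgue_on \<Omega>. f x) = (LINT x|lborel. f x)"
    "integrable (lebesgue_on \<Omega>) f \<longleftrightarrow> integrable lborel f" by auto
qed

lemma finite_measure_lebesgue_on_open: "open \<Omega> \<Longrightarrow> bounded \<Omega> \<Longrightarrow> finite_measure (lebesgue_on \<Omega>)"
  by (intro finite_measure_lebesgue_on lmeasurable_open)

lemma borel_lebesgue_on: "f \<in> borel_measurable borel \<Longrightarrow> f \<in> borel_measurable (lebesgue_on \<Omega>)"
  by (intro measurable_restrict_space1 measurable_completion) simp

lemma Ck_borel_lebesgue_on: "Ck k f \<Longrightarrow> f \<in> borel_measurable (lebesgue_on \<Omega>)"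
  using borel_lebesgue_on[OF borel_measurable_continuous_onI] Ck_le[of k f 0] by auto

lemma L2_integrable:
  assumes "finite_measure (lebesgue_on \<Omega>)" "L2_on \<Omega> (f :: 'a::euclidean_space \<Rightarrow> real)"
  shows "integrable (lebesgue_on \<Omega>) f"
  by (rule finite_measure.square_integrable_imp_integrable[OF assms(1)]) (use assms(2) in \<open>auto simp: L2_on_def\<close>)

lemma L2_norm: "L2_on \<Omega> G \<Longrightarrow> L2_on \<Omega> (\<lambda>x. norm (G x))"
  by (auto simp: L2_on_def)

lemma L2_inner:
  fixes G :: "'a::euclidean_space \<Rightarrow> 'a"
  assumes "L2_on \<Omega> G" "b \<in> Basis" shows "L2_on \<Omega> (\<lambda>x. G x \<bullet> b)"
  unfolding L2_on_def
proof
  show m: "(\<lambda>x. G x \<bullet> b) \<in> borel_measurable (lebesgue_on \<Omega>)" using assms by (auto simp: L2_on_def)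
  show "integrable (lebesgue_on \<Omega>) (\<lambda>x. (norm (G x \<bullet> b))\<^sup>2)"
  proof (rule Bochner_Integration.integrable_bound)
    show "integrable (lebesgue_on \<Omega>) (\<lambda>x. (norm (G x))\<^sup>2)" using assms by (auto simp: L2_on_def)
    show "AE x in lebesgue_on \<Omega>. norm ((norm (G x \<bullet> b))\<^sup>2) \<le> norm ((norm (G x))\<^sup>2)"
      using Basis_le_norm[OF assms(2)] by (intro AE_I2) (auto simp: abs_le_square_iff[symmetric])
  qed (use m in simp)
qed

text \<open>
  A translation moves the difference quotient from \<open>f\<close> to the test function \<open>\<psi>\<close>, where it converges
  uniformly. For functions without any regularity this takes the place of integration by parts.
\<close>

lemma difference_quotient_tendsto:
  fixes f \<psi> :: "'a::euclidean_space \<Rightarrow> real"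
  assumes f: "integrable lborel f" and \<psi>: "Ck 1 \<psi>" "compactly_supported_in UNIV \<psi>"
  shows "((\<lambda>\<tau>. (LINT x|lborel. \<psi> x * (f (x + \<tau> *\<^sub>R v) - f x)) / \<tau>) \<longlongrightarrow>
            - (LINT x|lborel. f x * ddir v \<psi> x)) (at_right 0)"
proof (rule tendstoI)
  fix e :: real assume "e > 0"
  have [measurable]: "f \<in> borel_measurable borel" using f by (auto dest: borel_measurable_integrable)
  have \<psi>c: "continuous_on UNIV \<psi>" by (rule Ck_1_continuous[OF \<psi>(1)])
  then have [measurable]: "\<psi> \<in> borel_measurable borel" by (rule borel_measurable_continuous_onI)
  have dc: "continuous_on UNIV (ddir v \<psi>)" using \<psi>(1) by simp
  obtain B where B: "\<And>x. norm (\<psi> x) \<le> B" using bounded_compact_support[OF \<psi>c \<psi>(2)] by metis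
  obtain B' where B': "\<And>x. norm (ddir v \<psi> x) \<le> B'" using bounded_compact_support[OF dc ddir_support[OF \<psi>(2)]] by metis
  define I where "I = (LINT y|lborel. \<bar>f y\<bar>)"
  have "I \<ge> 0" unfolding I_def by (simp add: integral_nonneg)
  define e' where "e' = e / ((1 + I) * (1 + norm v))"
  have e': "e' > 0" using \<open>e > 0\<close> \<open>I \<ge> 0\<close> by (simp add: e'_def add_pos_nonneg)
  obtain d where d: "d > 0" "\<And>x z. norm z < d \<Longrightarrow> \<bar>\<psi> (x + z) - \<psi> x - ddir z \<psi> x\<bar> \<le> e' * norm z"
    using uniform_derivative[OF \<psi> e'] by blast
  have lin: "linear (frechet_derivative \<psi> (at y))" for y
    using Ck_has_derivative[of 0 \<psi> y] \<psi>(1) has_derivative_linear by (metis One_nat_def)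
  have i1: "integrable lborel (\<lambda>x. f x * \<psi> (x - w))" for w
    by (rule integrable_mult_bounded[OF f, of _ B]) (use B in auto)
  have i2: "integrable lborel (\<lambda>x. f x * \<psi> x)" using i1[of 0] by simp
  have i3: "integrable lborel (\<lambda>x. f x * ddir v \<psi> x)"
    by (rule integrable_mult_bounded[OF f, of _ B']) (use B' borel_measurable_continuous_onI[OF dc] in auto)
  have lp: "lborel = distr lborel borel (\<lambda>x. w + x)" for w :: 'a
    using lborel_distr_plus[of w] by simp
  have shift: "(LINT x|lborel. f x * \<psi> (x - w)) = (LINT x|lborel. f (x + w) * \<psi> x)" 
    "integrable lborel (\<lambda>x. f (x + w) * \<psi> x)" for w
  proof -
    have "(LINT x|lborel. f x * \<psi> (x - w)) = (LINT x|distr lborel borel (\<lambda>x. w + x). f x * \<psi> (x - w))"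
      using lp[of w] by simp
    also have "\<dots> = (LINT x|lborel. f (w + x) * \<psi> (w + x - w))" by (rule integral_distr) auto
    finally show "(LINT x|lborel. f x * \<psi> (x - w)) = (LINT x|lborel. f (x + w) * \<psi> x)" by (simp add: add.commute)
    have "integrable (distr lborel borel (\<lambda>x. w + x)) (\<lambda>x. f x * \<psi> (x - w))" using lp[of w] i1 by simp
    then have "integrable lborel (\<lambda>x. f (w + x) * \<psi> (w + x - w))" 
      by (subst (asm) integrable_distr_eq) auto
    then show "integrable lborel (\<lambda>x. f (x + w) * \<psi> x)" by (simp add: add.commute)
  qed
  show "\<forall>\<^sub>F \<tau> in at_right 0. dist ((LINT x|lborel. \<psi> x * (f (x + \<tau> *\<^sub>R v) - f x)) / \<tau>)
            (- (LINT x|lborel. f x * ddir v \<psi> x)) < e"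
    unfolding eventually_at_right_field
  proof (intro exI[of _ "d / (1 + norm v)"] conjI allI impI)
    show "d / (1 + norm v) > 0" using d(1) by (simp add: add_pos_nonneg)
    fix \<tau> :: real assume \<tau>: "\<tau> > 0" "\<tau> < d / (1 + norm v)"
    have "\<tau> * norm v \<le> \<tau> * (1 + norm v)" using \<tau> by simp
    also have "\<dots> < d" using \<tau>(2) by (simp add: field_simps add_pos_nonneg)
    finally have small: "norm (- (\<tau> *\<^sub>R v)) < d" using \<tau> by simp
    have "(\<lambda>x. \<psi> x * (f (x + \<tau> *\<^sub>R v) - f x)) = (\<lambda>x. f (x + \<tau> *\<^sub>R v) * \<psi> x - f x * \<psi> x)"
      by (auto simp: algebra_simps)
    then have A: "(LINT x|lborel. \<psi> x * (f (x + \<tau> *\<^sub>R v) - f x)) =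
      (LINT x|lborel. f x * \<psi> (x - \<tau> *\<^sub>R v)) - (LINT x|lborel. f x * \<psi> x)"
      using shift i2 by simp
    let ?h = "\<lambda>x. (\<psi> (x - \<tau> *\<^sub>R v) - \<psi> x) / \<tau> + ddir v \<psi> x"
    have fh: "f x * ?h x = (f x * \<psi> (x - \<tau> *\<^sub>R v) - f x * \<psi> x) / \<tau> + f x * ddir v \<psi> x" for x
      using \<tau>(1) by (simp add: field_simps)
    have eqI: "(LINT x|lborel. \<psi> x * (f (x + \<tau> *\<^sub>R v) - f x)) / \<tau> - (- (LINT x|lborel. f x * ddir v \<psi> x)) = (LINT x|lborel. f x * ?h x)"
      unfolding A fh using i1 i2 i3 by simp
    have "\<bar>(LINT x|lborel. \<psi> x * (f (x + \<tau> *\<^sub>R v) - f x)) / \<tau> - (- (LINT x|lborel. f x * ddir v \<psi> x))\<bar>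
        \<le> e' * norm v * I"
      unfolding eqI I_def
    proof (rule abs_integral_mult_le[OF f])
      show "integrable lborel (\<lambda>x. f x * ?h x)" unfolding fh using i1 i2 i3 by simp
      fix x
      have "ddir (- (\<tau> *\<^sub>R v)) \<psi> x = - (\<tau> * ddir v \<psi> x)"
        using linear_scale[OF lin, of x "-\<tau>" v] by simp
      then have "\<bar>\<psi> (x - \<tau> *\<^sub>R v) - \<psi> x + \<tau> * ddir v \<psi> x\<bar> \<le> e' * (\<tau> * norm v)"
        using d(2)[OF small, of x] \<tau>(1) by simp
      then have "\<bar>\<psi> (x - \<tau> *\<^sub>R v) - \<psi> x + \<tau> * ddir v \<psi> x\<bar> / \<tau> \<le> e' * norm v"
        using \<tau>(1) by (simp add: field_simps)
      moreover have "?h x = (\<psi> (x - \<tau> *\<^sub>R v) - \<psi> x + \<tau> * ddir v \<psi> x) / \<tau>"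
        using \<tau>(1) by (simp add: field_simps)
      ultimately show "\<bar>?h x\<bar> \<le> e' * norm v" using \<tau>(1) by simp
    qed
    also have "\<dots> = e' * (I * norm v)" by simp
    also have "\<dots> < e' * ((1 + I) * (1 + norm v))"
      using e' \<open>I \<ge> 0\<close> by (intro mult_strict_left_mono) (auto simp: algebra_simps add_pos_nonneg)
    also have "\<dots> = e"
    proof -
      have "(1 + I) * (1 + norm v) > 0" using \<open>I \<ge> 0\<close> by (intro mult_pos_pos) (auto simp: add_pos_nonneg)
      then show ?thesis unfolding e'_def by (metis less_numeral_extra(3) nonzero_eq_divide_eq)
    qed
    finally show "dist ((LINT x|lborel. \<psi> x * (f (x + \<tau> *\<^sub>R v) - f x)) / \<tau>)
            (- (LINT x|lborel. f x * ddir v \<psi> x)) < e" by (simp add: dist_norm)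
  qed
qed

text \<open>
  The difference quotient of an indicator that equals \<open>1\<close> around the support of \<open>\<psi>\<close> vanishes
  against \<open>\<psi>\<close>.
\<close>

lemma integral_ddir_zero:
  fixes \<psi> :: "'a::euclidean_space \<Rightarrow> real"
  assumes \<psi>: "Ck 1 \<psi>" "compactly_supported_in UNIV \<psi>"
  shows "(LINT x|lborel. ddir v \<psi> x) = 0"
proof -
  obtain K where K: "compact K" "\<And>x. x \<notin> K \<Longrightarrow> \<psi> x = 0"
    using \<psi>(2) unfolding compactly_supported_in_def by blast
  have "\<exists>K'. compact K' \<and> (\<forall>x. x \<notin> K' \<longrightarrow> ddir v \<psi> x = 0)"
    using ddir_support[OF \<psi>(2), of v] unfolding compactly_supported_in_def by blast
  then obtain K' where K': "compact K'" "\<And>x. x \<notin> K' \<Longrightarrow> ddir v \<psi> x = 0" by blast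
  have "bounded (K \<union> K')" using K K' compact_imp_bounded by blast
  then obtain R where R: "\<And>x. x \<in> K \<union> K' \<Longrightarrow> norm x \<le> R" unfolding bounded_iff by blast
  define f :: "'a \<Rightarrow> real" where "f = indicator (cball 0 (R + norm v))"
  have f1: "f x = 1" if "norm x \<le> R + norm v" for x using that by (simp add: f_def)
  have f: "integrable lborel f" unfolding f_def
    using emeasure_lborel_cball_finite[of "0::'a" "R + norm v"]
    by (intro integrable_real_indicator) (auto simp: top.not_eq_extremum)
  have dq0: "(LINT x|lborel. \<psi> x * (f (x + \<tau> *\<^sub>R v) - f x)) / \<tau> = 0"
    if \<tau>: "0 < \<tau>" "\<tau> < 1" for \<tau>
  proof -
    have "\<psi> x * (f (x + \<tau> *\<^sub>R v) - f x) = 0" for x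
    proof (cases "x \<in> K")
      case True
      then have x: "norm x \<le> R" using R by blast
      have "norm (\<tau> *\<^sub>R v) \<le> norm v" using \<tau> by (simp add: mult_left_le_one_le)
      then have "norm (x + \<tau> *\<^sub>R v) \<le> R + norm v" using x norm_triangle_ineq[of x "\<tau> *\<^sub>R v"] by linarith
      moreover have "norm x \<le> R + norm v" using x norm_ge_zero[of v] by linarith
      ultimately show ?thesis using f1 by simp
    qed (use K in simp)
    then show ?thesis by (simp only: integral_zero div_0)
  qed
  have ev: "\<forall>\<^sub>F \<tau> in at_right 0. (LINT x|lborel. \<psi> x * (f (x + \<tau> *\<^sub>R v) - f x)) / \<tau> = 0"
    unfolding eventually_at_right_field by (rule exI[of _ 1], intro conjI allI impI dq0) auto
  have "- (LINT x|lborel. f x * ddir v \<psi> x) = 0"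
    by (rule tendsto_unique[OF _ difference_quotient_tendsto[OF f \<psi>] tendsto_eventually[OF ev]]) simp
  moreover have "(\<lambda>x. f x * ddir v \<psi> x) = ddir v \<psi>"
  proof
    fix x show "f x * ddir v \<psi> x = ddir v \<psi> x"
    proof (cases "x \<in> K'")
      case True
      then have "norm x \<le> R" using R by blast
      then have "f x = 1" using norm_ge_zero[of v] by (intro f1) linarith
      then show ?thesis by simp
    next
      case False
      show ?thesis unfolding K'(2)[OF False] by simp
    qed
  qed
  ultimately show ?thesis by (metis neg_equal_0_iff_equal)
qed

lemma ddir_mult:
  assumes "Ck 1 f" "Ck 1 (g :: 'a::euclidean_space \<Rightarrow> real)"
  shows "ddir v (\<lambda>x. f x * g x) x = f x * ddir v g x + ddir v f x * g x"
proof -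
  have "(f has_derivative frechet_derivative f (at x)) (at x)" "(g has_derivative frechet_derivative g (at x)) (at x)"
    using assms Ck_has_derivative by (metis One_nat_def)+
  from frechet_derivative_at[OF has_derivative_mult[OF this], symmetric] show ?thesis by simp
qed

lemma integration_by_parts:
  fixes f g :: "'a::euclidean_space \<Rightarrow> real"
  assumes f: "Ck 1 f" "compactly_supported_in UNIV f" and g: "Ck 1 g" "compactly_supported_in UNIV g"
  shows "(LINT x|lborel. f x * ddir v g x) = - (LINT x|lborel. ddir v f x * g x)"
proof -
  obtain K where K: "compact K" "\<And>x. x \<notin> K \<Longrightarrow> f x = 0"
    using f(2) unfolding compactly_supported_in_def by blast
  have fg: "Ck 1 (\<lambda>x. f x * g x)" by (rule Ck_mult[OF f(1) g(1)])
  have cs: "compactly_supported_in UNIV (\<lambda>x. f x * g x)"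
    unfolding compactly_supported_in_def using K by (intro exI[of _ K]) auto
  have c: "continuous_on UNIV (ddir v f)" "continuous_on UNIV (ddir v g)"
    "continuous_on UNIV f" "continuous_on UNIV g"
    using f(1) g(1) Ck_1_continuous by auto
  have "\<exists>K'. compact K' \<and> (\<forall>x. x \<notin> K' \<longrightarrow> ddir v f x = 0)"
    using ddir_support[OF f(2), of v] unfolding compactly_supported_in_def by blast
  then obtain K' where K': "compact K'" "\<And>x. x \<notin> K' \<Longrightarrow> ddir v f x = 0" by blast
  have "compactly_supported_in UNIV (\<lambda>x. f x * ddir v g x)" "compactly_supported_in UNIV (\<lambda>x. ddir v f x * g x)"
    unfolding compactly_supported_in_def using K K' by (metis mult_zero_left subset_UNIV)+
  then have i: "integrable lborel (\<lambda>x. f x * ddir v g x)" "integrable lborel (\<lambda>x. ddir v f x * g x)"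
    by (auto intro!: integrable_compact_support continuous_on_mult c)
  show ?thesis
    using integral_ddir_zero[OF fg cs, of v] i unfolding ddir_mult[OF f(1) g(1)] by simp
qed

lemma Cc_infinityD: "\<phi> \<in> Cc_infinity \<Omega> \<Longrightarrow> Ck k \<phi>" "\<phi> \<in> Cc_infinity \<Omega> \<Longrightarrow> compactly_supported_in \<Omega> \<phi>"
  by (auto simp: Cc_infinity_def)

lemma compactly_supported_outside: "compactly_supported_in \<Omega> f \<Longrightarrow> x \<notin> \<Omega> \<Longrightarrow> f x = 0"
  unfolding compactly_supported_in_def by blast

section \<open>Uniqueness of the weak gradient\<close>

lemma integrable_mult_continuous_cs:
  assumes "integrable (lebesgue_on \<Omega>) V" "continuous_on UNIV \<zeta>" "compactly_supported_in \<Omega> (\<zeta> :: 'a::euclidean_space \<Rightarrow> real)"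
  shows "integrable (lebesgue_on \<Omega>) (\<lambda>x. V x * \<zeta> x)"
proof -
  have "compactly_supported_in UNIV \<zeta>" using assms(3) compactly_supported_in_mono by blast
  then obtain B where B: "\<And>x. norm (\<zeta> x) \<le> B" using bounded_compact_support[OF assms(2)] by metis
  show ?thesis
    by (rule integrable_mult_bounded[OF assms(1) borel_lebesgue_on[OF borel_measurable_continuous_onI[OF assms(2)]], of B])
       (use B in auto)
qed

lemma sets_lebesgue_on_open_iff: "open \<Omega> \<Longrightarrow> A \<in> sets (lebesgue_on \<Omega>) \<longleftrightarrow> A \<in> sets lebesgue \<and> A \<subseteq> \<Omega>"
  by (subst sets_restrict_space_iff) auto

lemma compact_sets_lebesgue: "compact (K :: 'a::euclidean_space set) \<Longrightarrow> K \<in> sets lebesgue"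
  using lmeasurable_compact by auto

lemma Cc_infinity_continuous: "\<phi> \<in> Cc_infinity \<Omega> \<Longrightarrow> continuous_on UNIV \<phi>"
  using Cc_infinityD(1)[of \<phi> \<Omega> 0] by simp

lemma integral_mult_continuous_eq_0:
  fixes V :: "'a::euclidean_space \<Rightarrow> real"
  assumes V: "integrable (lebesgue_on \<Omega>) V" and "open \<Omega>"
    and 0: "\<And>\<phi>. \<phi> \<in> Cc_infinity \<Omega> \<Longrightarrow> (LINT x|lebesgue_on \<Omega>. V x * \<phi> x) = 0"
    and \<zeta>: "continuous_on UNIV \<zeta>" "compactly_supported_in \<Omega> \<zeta>"
  shows "(LINT x|lebesgue_on \<Omega>. V x * \<zeta> x) = 0"
proof -
  define J where "J = (LINT x|lebesgue_on \<Omega>. \<bar>V x\<bar>)"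
  show ?thesis
  proof (rule eq_0_if_le_mult_epsilon)
    show "0 \<le> J" unfolding J_def by simp
    fix e :: real assume "e > 0"
    obtain \<phi> where \<phi>: "\<phi> \<in> Cc_infinity \<Omega>" "\<And>x. \<bar>\<phi> x - \<zeta> x\<bar> \<le> e"
      using smooth_approx_uniform[OF \<zeta> \<open>open \<Omega>\<close> \<open>e > 0\<close>] by metis
    have i: "integrable (lebesgue_on \<Omega>) (\<lambda>x. V x * \<zeta> x)" "integrable (lebesgue_on \<Omega>) (\<lambda>x. V x * \<phi> x)"
      by (intro integrable_mult_continuous_cs[OF V] \<zeta> Cc_infinityD(2)[OF \<phi>(1)] Cc_infinity_continuous[OF \<phi>(1)])+
    have D: "(LINT x|lebesgue_on \<Omega>. V x * \<zeta> x) = (LINT x|lebesgue_on \<Omega>. V x * (\<zeta> x - \<phi> x))"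
      using i 0[OF \<phi>(1)] by (simp add: right_diff_distrib)
    show "\<bar>LINT x|lebesgue_on \<Omega>. V x * \<zeta> x\<bar> \<le> e * J" unfolding D J_def
    proof (rule abs_integral_mult_le[OF V])
      show "integrable (lebesgue_on \<Omega>) (\<lambda>x. V x * (\<zeta> x - \<phi> x))" using i by (simp add: right_diff_distrib)
      show "\<bar>\<zeta> x - \<phi> x\<bar> \<le> e" for x using \<phi>(2)[of x] by (simp add: abs_minus_commute)
    qed
  qed
qed

text \<open>
  The hypothesis passes by uniform approximation to continuous test functions, by decreasing
  continuous cut-offs to indicators of compact sets, and by inner regularity to all measurable
  sets.
\<close>

lemma fundamental_lemma_calculus_of_variations:
  fixes V :: "'a::euclidean_space \<Rightarrow> real"
  assumes V: "integrable (lebesgue_on \<Omega>) V" and \<Omega>: "open \<Omega>" "bounded \<Omega>"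
    and 0: "\<And>\<phi>. \<phi> \<in> Cc_infinity \<Omega> \<Longrightarrow> (LINT x|lebesgue_on \<Omega>. V x * \<phi> x) = 0"
  shows "AE x in lebesgue_on \<Omega>. V x = 0"
proof -
  interpret finite_measure "lebesgue_on \<Omega>" by (rule finite_measure_lebesgue_on_open[OF \<Omega>])
  have [measurable]: "V \<in> borel_measurable (lebesgue_on \<Omega>)" using V by auto
  have cpt: "(LINT x|lebesgue_on \<Omega>. indicator K x * V x) = 0" if K: "compact K" "K \<subseteq> \<Omega>" for K
  proof (cases "K = {}")
    case False
    obtain \<rho> where \<rho>: "\<rho> > 0" "(\<Union>x\<in>K. cball x \<rho>) \<subseteq> \<Omega>"
      using compact_subset_open_imp_cball_epsilon_subset[OF K(1) \<Omega>(1) K(2)] by blast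
    obtain N where N: "N > 0" "1 / real N < \<rho>"
      using \<rho>(1) nat_approx_posE by (metis of_nat_0_less_iff zero_less_Suc)
    (* continuous functions that decrease to the indicator of K and vanish at distance 1/m from K *)
    define \<zeta> where "\<zeta> m x = max 0 (1 - real m * infdist x K)" for m x
    have c: "continuous_on UNIV (\<zeta> m)" for m
      unfolding \<zeta>_def by (intro continuous_intros)
    have sup: "compactly_supported_in \<Omega> (\<zeta> m)" if "m \<ge> N" for m
      unfolding compactly_supported_in_def
    proof (intro exI conjI allI impI)
      show "compact (\<Union>x\<in>K. cball x \<rho>)" by (rule compact_minkowski_sum_cball[OF K(1)])
      show "(\<Union>x\<in>K. cball x \<rho>) \<subseteq> \<Omega>" by fact
      fix x assume x: "x \<notin> (\<Union>x\<in>K. cball x \<rho>)"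
      obtain y where y: "y \<in> K" "infdist x K = dist x y"
        using infdist_attains_inf[OF compact_imp_closed[OF K(1)] False] by metis
      then have "\<rho> < infdist x K" using x by (force simp: dist_commute)
      then have "1 / real N \<le> infdist x K" using N by linarith
      then have "1 \<le> real N * infdist x K" using N by (simp add: field_simps)
      also have "\<dots> \<le> real m * infdist x K" using that by (intro mult_right_mono) (auto simp: infdist_nonneg)
      finally show "\<zeta> m x = 0" by (simp add: \<zeta>_def)
    qed
    have lim: "(\<lambda>m. \<zeta> m x) \<longlonglongrightarrow> indicator K x" for x
    proof (cases "x \<in> K")
      case True then show ?thesis by (simp add: \<zeta>_def)
    next
      case nx: False
      then have p: "infdist x K > 0"
        using in_closed_iff_infdist_zero[OF compact_imp_closed[OF K(1)] False] infdist_nonneg[of x K] by auto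
      obtain M where M: "1 < real M * infdist x K" using p reals_Archimedean3 by blast
      have "\<forall>\<^sub>F m in sequentially. \<zeta> m x = 0"
        unfolding eventually_sequentially
      proof (intro exI allI impI)
        fix m assume "m \<ge> M"
        then have "real M * infdist x K \<le> real m * infdist x K" by (intro mult_right_mono) (auto simp: infdist_nonneg)
        then show "\<zeta> m x = 0" using M by (simp add: \<zeta>_def)
      qed
      then show ?thesis using nx by (simp add: tendsto_eventually)
    qed
    have [measurable]: "\<zeta> m \<in> borel_measurable (lebesgue_on \<Omega>)" for m
      by (rule borel_lebesgue_on[OF borel_measurable_continuous_onI[OF c]])
    have [measurable]: "K \<in> sets (lebesgue_on \<Omega>) "
      using K by (simp add: sets_lebesgue_on_open_iff[OF \<Omega>(1)] compact_sets_lebesgue)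
    have lim': "(\<lambda>m. LINT x|lebesgue_on \<Omega>. V x * \<zeta> m x) \<longlonglongrightarrow> (LINT x|lebesgue_on \<Omega>. V x * indicator K x)"
    proof (rule integral_dominated_convergence[where w="\<lambda>x. \<bar>V x\<bar>"])
      show "integrable (lebesgue_on \<Omega>) (\<lambda>x. \<bar>V x\<bar>)" using V by simp
      show "AE x in lebesgue_on \<Omega>. (\<lambda>m. V x * \<zeta> m x) \<longlonglongrightarrow> V x * indicator K x"
        by (intro AE_I2 tendsto_mult tendsto_const lim)
      show "AE x in lebesgue_on \<Omega>. norm (V x * \<zeta> m x) \<le> \<bar>V x\<bar>" for m
      proof (rule AE_I2)
        fix x
        have "real m * infdist x K \<ge> 0" by (simp add: infdist_nonneg)
        then have "\<bar>\<zeta> m x\<bar> \<le> 1" by (auto simp: \<zeta>_def)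
        then show "norm (V x * \<zeta> m x) \<le> \<bar>V x\<bar>" by (simp add: abs_mult mult_left_le)
      qed
    qed auto
    have ev: "\<forall>\<^sub>F m in sequentially. (LINT x|lebesgue_on \<Omega>. V x * \<zeta> m x) = 0"
      unfolding eventually_sequentially
      using integral_mult_continuous_eq_0[OF V \<Omega>(1) 0 c sup] by blast
    have "(LINT x|lebesgue_on \<Omega>. V x * indicator K x) = 0"
      by (rule LIMSEQ_unique[OF lim' tendsto_eventually[OF ev]])
    then show ?thesis by (simp add: mult.commute)
  qed simp
  show ?thesis
  proof (rule density_zero[OF V])
    fix A assume A: "A \<in> sets (lebesgue_on \<Omega>)"
    have \<Omega>s: "\<Omega> \<in> sets lebesgue" using \<Omega>(1) by simp
    have AL: "A \<in> sets lebesgue" "A \<subseteq> \<Omega>" using A by (auto simp: sets_lebesgue_on_open_iff[OF \<Omega>(1)])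
    obtain S T where ST: "fsigma S" "T \<in> null_sets lebesgue" "S \<union> T = A"
      using lebesgue_set_almost_fsigma[OF AL(1)] by metis
    obtain F :: "nat \<Rightarrow> 'a set" where F: "\<And>i. compact (F i)" "S = (\<Union>i. F i)"
      using ST(1) fsigma_Union_compact by (metis (no_types, lifting) image_subset_iff mem_Collect_eq UNIV_I)
    define K where "K m = (\<Union>i\<le>m. F i)" for m
    have K: "compact (K m)" "K m \<subseteq> \<Omega>" for m
    proof -
      show "compact (K m)" unfolding K_def using F(1) by (intro compact_UN) auto
      show "K m \<subseteq> \<Omega>" unfolding K_def using F(2) ST(3) AL(2) by blast
    qed
    have [measurable]: "K m \<in> sets (lebesgue_on \<Omega>)" for m
      using K[of m] by (simp add: sets_lebesgue_on_open_iff[OF \<Omega>(1)] compact_sets_lebesgue)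
    have Ss[measurable]: "S \<in> sets (lebesgue_on \<Omega>)"
    proof -
      have "F i \<in> sets lebesgue" for i by (rule compact_sets_lebesgue[OF F(1)])
      then have "S \<in> sets lebesgue" unfolding F(2) by (intro sets.countable_UN) auto
      then show ?thesis using ST(3) AL(2) unfolding sets_lebesgue_on_open_iff[OF \<Omega>(1)] by blast
    qed
    have lim: "(\<lambda>m. indicator (K m) x :: real) \<longlonglongrightarrow> indicator S x" for x
    proof (cases "x \<in> S")
      case True
      then obtain i where "x \<in> F i" using F by blast
      then have "\<forall>\<^sub>F m in sequentially. indicator (K m) x = (1::real)"
        unfolding eventually_sequentially K_def by (intro exI[of _ i]) (auto simp: indicator_def)
      then show ?thesis using True by (simp add: tendsto_eventually)
    next
      case False
      then show ?thesis using F by (simp add: K_def)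
    qed
    have "(\<lambda>m. LINT x|lebesgue_on \<Omega>. indicator (K m) x * V x) \<longlonglongrightarrow> (LINT x|lebesgue_on \<Omega>. indicator S x * V x)"
    proof (rule integral_dominated_convergence[where w="\<lambda>x. \<bar>V x\<bar>"])
      show "integrable (lebesgue_on \<Omega>) (\<lambda>x. \<bar>V x\<bar>)" using V by simp
      show "AE x in lebesgue_on \<Omega>. (\<lambda>m. indicator (K m) x * V x) \<longlonglongrightarrow> indicator S x * V x"
        by (intro AE_I2 tendsto_mult tendsto_const lim)
      show "AE x in lebesgue_on \<Omega>. norm (indicator (K m) x * V x) \<le> \<bar>V x\<bar>" for m
        by (intro AE_I2) (auto simp: indicator_def)
    qed auto
    then have S0: "(LINT x|lebesgue_on \<Omega>. indicator S x * V x) = 0"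
      by (simp add: cpt[OF K] LIMSEQ_const_iff)
    have "AE x in lebesgue. x \<notin> T" using ST(2) by (rule AE_not_in)
    then have "AE x in lebesgue_on \<Omega>. x \<notin> T"
      by (subst AE_restrict_space_iff) (use \<Omega>s in auto)
    then have "AE x in lebesgue_on \<Omega>. indicator A x *\<^sub>R V x = indicator S x * V x"
      by eventually_elim (use ST(3) in \<open>auto simp: indicator_def\<close>)
    then have "(LINT x|lebesgue_on \<Omega>. indicator A x *\<^sub>R V x) = (LINT x|lebesgue_on \<Omega>. indicator S x * V x)"
      using A by (intro integral_cong_AE) auto
    then show "set_lebesgue_integral (lebesgue_on \<Omega>) A V = 0"
      using S0 by (simp add: set_lebesgue_integral_def)
  qed
qed

lemma has_L2_gradientD:
  assumes "has_L2_gradient \<Omega> u G" "\<phi> \<in> Cc_infinity \<Omega>" "b \<in> Basis"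
  shows "(LINT x|lebesgue_on \<Omega>. u x * ddir b \<phi> x) = - (LINT x|lebesgue_on \<Omega>. (G x \<bullet> b) * \<phi> x)"
  using assms unfolding has_L2_gradient_def by blast

lemma has_L2_gradient_unique:
  fixes G H :: "'a::euclidean_space \<Rightarrow> 'a"
  assumes G: "has_L2_gradient \<Omega> u G" and H: "has_L2_gradient \<Omega> u H" and \<Omega>: "open \<Omega>" "bounded \<Omega>"
  shows "AE x in lebesgue_on \<Omega>. G x = H x"
proof -
  note fin = finite_measure_lebesgue_on_open[OF \<Omega>]
  have "AE x in lebesgue_on \<Omega>. G x \<bullet> b - H x \<bullet> b = 0" if b: "b \<in> Basis" for b
  proof (rule fundamental_lemma_calculus_of_variations[OF _ \<Omega>])
    have i: "integrable (lebesgue_on \<Omega>) (\<lambda>x. G x \<bullet> b)" "integrable (lebesgue_on \<Omega>) (\<lambda>x. H x \<bullet> b)"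
      using G H b by (auto simp: has_L2_gradient_def intro!: L2_integrable[OF fin] L2_inner)
    then show "integrable (lebesgue_on \<Omega>) (\<lambda>x. G x \<bullet> b - H x \<bullet> b)" by simp
    fix \<phi> assume \<phi>: "\<phi> \<in> Cc_infinity \<Omega>"
    have "integrable (lebesgue_on \<Omega>) (\<lambda>x. (G x \<bullet> b) * \<phi> x)" "integrable (lebesgue_on \<Omega>) (\<lambda>x. (H x \<bullet> b) * \<phi> x)"
      by (intro integrable_mult_continuous_cs i Cc_infinityD(2)[OF \<phi>] Cc_infinity_continuous[OF \<phi>])+
    moreover have "(LINT x|lebesgue_on \<Omega>. (G x \<bullet> b) * \<phi> x) = (LINT x|lebesgue_on \<Omega>. (H x \<bullet> b) * \<phi> x)"
      using has_L2_gradientD[OF G \<phi> b] has_L2_gradientD[OF H \<phi> b] by linarith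
    ultimately show "(LINT x|lebesgue_on \<Omega>. (G x \<bullet> b - H x \<bullet> b) * \<phi> x) = 0"
      by (simp add: left_diff_distrib)
  qed
  then have "AE x in lebesgue_on \<Omega>. \<forall>b\<in>Basis. G x \<bullet> b - H x \<bullet> b = 0"
    by (intro AE_finite_allI) auto
  then show ?thesis by eventually_elim (auto intro: euclidean_eqI)
qed

section \<open>The chain rule for Lipschitz functions\<close>

lemma integrable_lborel_shift:
  fixes f :: "'a::euclidean_space \<Rightarrow> real"
  assumes "integrable lborel f"
  shows "integrable lborel (\<lambda>x. f (x + w))"
proof -
  have [measurable]: "f \<in> borel_measurable borel" using assms by (auto dest: borel_measurable_integrable)
  have "integrable (distr lborel borel ((+) w)) f" using assms unfolding lborel_distr_plus .
  then have "integrable lborel (\<lambda>x. f (w + x))" by (subst (asm) integrable_distr_eq) auto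
  then show ?thesis by (simp add: add.commute)
qed

lemma borel_indicator_continuous_on:
  fixes \<phi> :: "'a::euclidean_space \<Rightarrow> real"
  assumes "open \<Omega>" "continuous_on \<Omega> \<phi>"
  shows "(\<lambda>x. indicator \<Omega> x * \<phi> x) \<in> borel_measurable borel"
  using borel_measurable_continuous_on_indicator[of \<Omega> \<phi>] assms by simp

lemma abs_integral_indicator_bound:
  fixes h :: "'a::euclidean_space \<Rightarrow> real"
  assumes "open \<Omega>" "bounded \<Omega>" "integrable lborel h" "\<And>x. \<bar>h x\<bar> \<le> indicator \<Omega> x * c"
  shows "\<bar>LINT x|lborel. h x\<bar> \<le> measure lebesgue \<Omega> * c"
proof -
  have O: "\<Omega> \<in> sets lborel" using assms(1) by simp
  have fin: "emeasure lborel \<Omega> < \<infinity>" using emeasure_bounded_finite[OF assms(2)] .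
  have "\<bar>LINT x|lborel. h x\<bar> \<le> (LINT x|lborel. indicator \<Omega> x * c)"
  proof (rule order_trans[OF integral_abs_bound], rule integral_mono)
    show "integrable lborel (\<lambda>x. \<bar>h x\<bar>)" using assms(3) by simp
    show "integrable lborel (\<lambda>x. indicator \<Omega> x * c)" using O fin by simp
  qed (use assms in auto)
  also have "\<dots> = measure lborel \<Omega> * c" by simp
  also have "measure lborel \<Omega> = measure lebesgue \<Omega>" using O by simp
  finally show ?thesis .
qed

text \<open>
  Difference quotients of a Lipschitz function are bounded, so they may be tested with \<open>\<zeta>\<close> that is merely
  continuous: a smooth \<open>\<theta>\<close> uniformly close to \<open>\<zeta>\<close> changes the quotient by little, uniformly in the step,
  and for \<open>\<theta>\<close> the limit is the definition of the weak gradient.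
\<close>

lemma lipschitz_difference_quotient:
  fixes \<phi> \<zeta> :: "'a::euclidean_space \<Rightarrow> real"
  assumes lip: "L-lipschitz_on \<Omega> \<phi>" and grad: "has_L2_gradient \<Omega> \<phi> G"
    and \<Omega>: "open \<Omega>" "bounded \<Omega>" and \<zeta>: "continuous_on UNIV \<zeta>" "compactly_supported_in \<Omega> \<zeta>"
    and b: "b \<in> Basis"
  shows "((\<lambda>\<tau>. (LINT x|lborel. \<zeta> x * (indicator \<Omega> (x + \<tau> *\<^sub>R b) * \<phi> (x + \<tau> *\<^sub>R b) - indicator \<Omega> x * \<phi> x)) / \<tau>)
           \<longlongrightarrow> (LINT x|lebesgue_on \<Omega>. (G x \<bullet> b) * \<zeta> x)) (at_right 0)"
proof -
  define \<phi>0 where "\<phi>0 x = indicator \<Omega> x * \<phi> x" for x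
  define q where "q \<theta> \<tau> = (LINT x|lborel. \<theta> x * (\<phi>0 (x + \<tau> *\<^sub>R b) - \<phi>0 x)) / \<tau>" for \<theta> \<tau>
  have [measurable]: "\<phi>0 \<in> borel_measurable borel"
    unfolding \<phi>0_def by (rule borel_indicator_continuous_on[OF \<Omega>(1) lipschitz_on_continuous_on[OF lip]])
  note fin = finite_measure_lebesgue_on_open[OF \<Omega>]
  have i\<phi>: "integrable (lebesgue_on \<Omega>) \<phi>" and iG: "integrable (lebesgue_on \<Omega>) (\<lambda>x. G x \<bullet> b)"
    using grad b by (auto simp: has_L2_gradient_def intro!: L2_integrable[OF fin] L2_inner)
  have i0: "integrable lborel \<phi>0"
    using lebesgue_on_integral_indicator(2)[OF \<Omega>(1), of \<phi>] i\<phi> \<open>\<phi>0 \<in> borel_measurable borel\<close>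
    unfolding \<phi>0_def[abs_def] by blast
  have L: "L \<ge> 0" using lip lipschitz_on_nonneg by blast
  define J where "J = (LINT x|lebesgue_on \<Omega>. \<bar>G x \<bullet> b\<bar>)"
  have J: "J \<ge> 0" unfolding J_def by simp
  define m where "m = measure lebesgue \<Omega>"
  have m: "m \<ge> 0" unfolding m_def by simp
  have iq: "integrable lborel (\<lambda>x. \<theta> x * (\<phi>0 (x + \<tau> *\<^sub>R b) - \<phi>0 x))"
    if \<theta>: "continuous_on UNIV \<theta>" "compactly_supported_in \<Omega> \<theta>" for \<theta> \<tau>
  proof -
    have "compactly_supported_in UNIV \<theta>" using \<theta>(2) compactly_supported_in_mono by blast
    then obtain B where "\<And>x. norm (\<theta> x) \<le> B" using bounded_compact_support[OF \<theta>(1)] by metis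
    then have "integrable lborel (\<lambda>x. (\<phi>0 (x + \<tau> *\<^sub>R b) - \<phi>0 x) * \<theta> x)"
      by (intro integrable_mult_bounded[of _ _ _ B] Bochner_Integration.integrable_diff integrable_lborel_shift i0)
         (auto intro!: borel_measurable_continuous_onI[OF \<theta>(1)])
    then show ?thesis by (simp add: mult.commute)
  qed
  have "(q \<zeta> \<longlongrightarrow> (LINT x|lebesgue_on \<Omega>. (G x \<bullet> b) * \<zeta> x)) (at_right 0)"
  proof (rule tendstoI)
    fix e :: real assume "e > 0"
    (* the error made by replacing the test function is at most e/3 in the quotient and in the limit *)
    define e1 where "e1 = e / (3 * (1 + J + L * m))"
    have p: "1 + J + L * m > 0" using J L m by (simp add: add_pos_nonneg)
    have e1: "e1 > 0" unfolding e1_def using p \<open>e > 0\<close> by simp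
    have e1s: "e1 * (1 + J + L * m) = e / 3" unfolding e1_def using p by (simp add: field_simps)
    have e1J: "e1 * J \<le> e / 3" "e1 * (L * m) \<le> e / 3"
      unfolding e1s[symmetric] using e1 J L m by (auto intro!: mult_left_mono)
    obtain \<theta> where \<theta>: "\<theta> \<in> Cc_infinity \<Omega>" "\<And>x. \<bar>\<theta> x - \<zeta> x\<bar> \<le> e1"
      using smooth_approx_uniform[OF \<zeta> \<Omega>(1) e1] by metis
    have \<theta>': "continuous_on UNIV \<theta>" "compactly_supported_in \<Omega> \<theta>" "Ck 1 \<theta>"
      using Cc_infinity_continuous[OF \<theta>(1)] Cc_infinityD[OF \<theta>(1)] by auto
    have \<theta>U: "compactly_supported_in UNIV \<theta>" using \<theta>'(2) compactly_supported_in_mono by blast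
    obtain K1 where K1: "compact K1" "K1 \<subseteq> \<Omega>" "\<And>x. x \<notin> K1 \<Longrightarrow> \<zeta> x = 0"
      using \<zeta>(2) unfolding compactly_supported_in_def by blast
    obtain K2 where K2: "compact K2" "K2 \<subseteq> \<Omega>" "\<And>x. x \<notin> K2 \<Longrightarrow> \<theta> x = 0"
      using \<theta>'(2) unfolding compactly_supported_in_def by blast
    obtain \<rho> where \<rho>: "\<rho> > 0" "(\<Union>x\<in>K1 \<union> K2. cball x \<rho>) \<subseteq> \<Omega>"
      using compact_subset_open_imp_cball_epsilon_subset[OF compact_Un[OF K1(1) K2(1)] \<Omega>(1)] K1(2) K2(2) by blast
    have "(LINT x|lborel. \<phi>0 x * ddir b \<theta> x) = (LINT x|lebesgue_on \<Omega>. \<phi> x * ddir b \<theta> x)"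
    proof -
      have dm: "ddir b \<theta> \<in> borel_measurable borel"
        using \<theta>'(3) by (intro borel_measurable_continuous_onI) simp
      have e: "indicator \<Omega> x * (\<phi> x * ddir b \<theta> x) = \<phi>0 x * ddir b \<theta> x" for x by (simp add: \<phi>0_def)
      show ?thesis
        using lebesgue_on_integral_indicator(1)[OF \<Omega>(1), of "\<lambda>x. \<phi> x * ddir b \<theta> x"] dm unfolding e by simp
    qed
    also have "\<dots> = - (LINT x|lebesgue_on \<Omega>. (G x \<bullet> b) * \<theta> x)"
      by (rule has_L2_gradientD[OF grad \<theta>(1) b])
    finally have lim: "(q \<theta> \<longlongrightarrow> (LINT x|lebesgue_on \<Omega>. (G x \<bullet> b) * \<theta> x)) (at_right 0)"
      using difference_quotient_tendsto[OF i0 \<theta>'(3) \<theta>U, of b] unfolding q_def by simp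
    have near: "\<bar>(LINT x|lebesgue_on \<Omega>. (G x \<bullet> b) * \<theta> x) - (LINT x|lebesgue_on \<Omega>. (G x \<bullet> b) * \<zeta> x)\<bar> \<le> e / 3"
    proof -
      have i: "integrable (lebesgue_on \<Omega>) (\<lambda>x. (G x \<bullet> b) * \<theta> x)" "integrable (lebesgue_on \<Omega>) (\<lambda>x. (G x \<bullet> b) * \<zeta> x)"
        by (intro integrable_mult_continuous_cs iG \<zeta> \<theta>')+
      have D: "(LINT x|lebesgue_on \<Omega>. (G x \<bullet> b) * \<theta> x) - (LINT x|lebesgue_on \<Omega>. (G x \<bullet> b) * \<zeta> x)
          = (LINT x|lebesgue_on \<Omega>. (G x \<bullet> b) * (\<theta> x - \<zeta> x))"
        using i by (simp add: right_diff_distrib)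
      have "\<bar>LINT x|lebesgue_on \<Omega>. (G x \<bullet> b) * (\<theta> x - \<zeta> x)\<bar> \<le> e1 * J" unfolding J_def
        by (rule abs_integral_mult_le[OF iG]) (use i \<theta>(2) in \<open>auto simp: right_diff_distrib\<close>)
      then show ?thesis unfolding D using e1J by linarith
    qed
    have qq: "\<bar>q \<zeta> \<tau> - q \<theta> \<tau>\<bar> \<le> e / 3" if \<tau>: "0 < \<tau>" "\<tau> < \<rho>" for \<tau>
    proof -
      let ?h = "\<lambda>x. (\<zeta> x - \<theta> x) * (\<phi>0 (x + \<tau> *\<^sub>R b) - \<phi>0 x)"
      have ih: "integrable lborel ?h"
        using Bochner_Integration.integrable_diff[OF iq[OF \<zeta>, of \<tau>] iq[OF \<theta>'(1,2), of \<tau>]] by (simp add: left_diff_distrib)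
      have "q \<zeta> \<tau> - q \<theta> \<tau> = (LINT x|lborel. ?h x) / \<tau>"
        unfolding q_def using iq[OF \<zeta>, of \<tau>] iq[OF \<theta>'(1,2), of \<tau>]
        by (simp add: left_diff_distrib diff_divide_distrib)
      moreover have "\<bar>LINT x|lborel. ?h x\<bar> \<le> measure lebesgue \<Omega> * (e1 * (L * \<tau>))"
      proof (rule abs_integral_indicator_bound[OF \<Omega> ih])
        fix x show "\<bar>?h x\<bar> \<le> indicator \<Omega> x * (e1 * (L * \<tau>))"
        proof (cases "x \<in> K1 \<union> K2")
          case True
          have "dist x (x + \<tau> *\<^sub>R b) = \<tau>" using \<tau> b by (simp add: dist_norm)
          then have xx: "x \<in> \<Omega>" "x + \<tau> *\<^sub>R b \<in> \<Omega>" using \<rho> True \<tau> by (force)+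
          have "\<bar>\<phi>0 (x + \<tau> *\<^sub>R b) - \<phi>0 x\<bar> \<le> L * \<tau>"
            using lipschitz_onD[OF lip xx(2,1)] xx \<tau> b by (simp add: \<phi>0_def dist_norm)
          then have "\<bar>\<zeta> x - \<theta> x\<bar> * \<bar>\<phi>0 (x + \<tau> *\<^sub>R b) - \<phi>0 x\<bar> \<le> e1 * (L * \<tau>)"
            using \<theta>(2)[of x] e1 by (intro mult_mono) (auto simp: abs_minus_commute)
          then show ?thesis using xx by (simp add: abs_mult)
        next
          case False
          then show ?thesis using K1(3) K2(3) e1 L \<tau> by simp
        qed
      qed
      ultimately have "\<bar>q \<zeta> \<tau> - q \<theta> \<tau>\<bar> \<le> m * (e1 * (L * \<tau>)) / \<tau>"
        using \<tau> by (simp only: m_def abs_divide abs_of_pos divide_right_mono less_imp_le)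
      also have "\<dots> = e1 * (L * m)" using \<tau> by simp
      also have "\<dots> \<le> e / 3" by (rule e1J)
      finally show ?thesis .
    qed
    have "\<forall>\<^sub>F \<tau> in at_right 0. \<bar>q \<zeta> \<tau> - q \<theta> \<tau>\<bar> \<le> e / 3"
      unfolding eventually_at_right_field by (rule exI[of _ \<rho>]) (use \<rho>(1) qq in blast)
    moreover have "\<forall>\<^sub>F \<tau> in at_right 0. dist (q \<theta> \<tau>) (LINT x|lebesgue_on \<Omega>. (G x \<bullet> b) * \<theta> x) < e / 3"
      using lim \<open>e > 0\<close> by (intro tendstoD) auto
    ultimately show "\<forall>\<^sub>F \<tau> in at_right 0. dist (q \<zeta> \<tau>) (LINT x|lebesgue_on \<Omega>. (G x \<bullet> b) * \<zeta> x) < e"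
    proof eventually_elim
      case (elim \<tau>)
      then show ?case using near unfolding dist_real_def by linarith
    qed
  qed
  then show ?thesis unfolding q_def[abs_def] \<phi>0_def .
qed

text \<open>
  The difference quotient of \<open>F \<circ> \<phi>\<close> differs from \<open>F' \<circ> \<phi>\<close> times that of \<open>\<phi>\<close> by at most a constant times
  the step, by the quadratic bound on \<open>F\<close>. The quotient of \<open>F \<circ> \<phi>\<close> converges by integration by parts, and
  that of \<open>\<phi>\<close> is tested with the continuous function \<open>\<psi> (F' \<circ> \<phi>)\<close>.
\<close>

lemma lipschitz_chain_rule:
  fixes \<phi> \<psi> :: "'a::euclidean_space \<Rightarrow> real" and F F' :: "real \<Rightarrow> real"
  assumes lip: "L-lipschitz_on \<Omega> \<phi>" and grad: "has_L2_gradient \<Omega> \<phi> G"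
    and \<Omega>: "open \<Omega>" "bounded \<Omega>" and \<psi>: "Ck 1 \<psi>" "compactly_supported_in \<Omega> \<psi>"
    and b: "b \<in> Basis"
    and F: "continuous_on UNIV F" "continuous_on UNIV F'"
    and C: "\<And>x y. \<bar>F y - F x - F' x * (y - x)\<bar> \<le> C * (y - x)\<^sup>2"
  shows "(LINT x|lebesgue_on \<Omega>. F (\<phi> x) * ddir b \<psi> x) = - (LINT x|lebesgue_on \<Omega>. F' (\<phi> x) * (G x \<bullet> b) * \<psi> x)"
proof -
  have c\<phi>: "continuous_on \<Omega> \<phi>" by (rule lipschitz_on_continuous_on[OF lip])
  define f where "f x = indicator \<Omega> x * F (\<phi> x)" for x
  define \<zeta> where "\<zeta> x = indicator \<Omega> x * F' (\<phi> x) * \<psi> x" for x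
  have cF: "continuous_on \<Omega> (\<lambda>x. F (\<phi> x))" "continuous_on \<Omega> (\<lambda>x. F' (\<phi> x))"
    using continuous_on_compose2[OF F(1) c\<phi>] continuous_on_compose2[OF F(2) c\<phi>] by auto
  have fm[measurable]: "f \<in> borel_measurable borel"
    unfolding f_def by (rule borel_indicator_continuous_on[OF \<Omega>(1) cF(1)])
  have "bounded (\<phi> ` \<Omega>)"
    by (rule bounded_uniformly_continuous_image[OF lipschitz_on_uniformly_continuous[OF lip] \<Omega>(2)])
  then obtain R where R: "\<And>x. x \<in> \<Omega> \<Longrightarrow> \<bar>\<phi> x\<bar> \<le> R" unfolding bounded_iff by auto
  have "compact (F ` cball 0 R)" by (intro compact_continuous_image continuous_on_subset[OF F(1)]) auto
  then obtain B where B: "\<And>x. x \<in> cball 0 R \<Longrightarrow> \<bar>F x\<bar> \<le> B" 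
    using compact_imp_bounded[of "F ` cball 0 R"] unfolding bounded_iff ball_simps real_norm_def by blast
  have if_: "integrable lborel f"
  proof -
    have "integrable lborel (\<lambda>x. indicator \<Omega> x * f x)"
    proof (rule integrable_mult_bounded[of _ _ _ "\<bar>B\<bar>"])
      show "integrable lborel (indicator \<Omega> :: 'a \<Rightarrow> real)"
        using \<Omega> emeasure_bounded_finite[OF \<Omega>(2)] by (intro integrable_real_indicator) auto
      show "\<bar>f x\<bar> \<le> \<bar>B\<bar>" for x
        using B[of "\<phi> x"] R[of x] by (cases "x \<in> \<Omega>") (auto simp: f_def)
    qed simp
    moreover have "(\<lambda>x. indicator \<Omega> x * f x) = f" by (auto simp: f_def indicator_def)
    ultimately show ?thesis by simp
  qed
  obtain K where K: "compact K" "K \<subseteq> \<Omega>" "\<And>x. x \<notin> K \<Longrightarrow> \<psi> x = 0"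
    using \<psi>(2) unfolding compactly_supported_in_def by blast
  have \<psi>U: "compactly_supported_in UNIV \<psi>" using \<psi>(2) compactly_supported_in_mono by blast
  obtain B' where B': "\<And>x. norm (\<psi> x) \<le> B'" using bounded_compact_support[OF Ck_1_continuous[OF \<psi>(1)] \<psi>U] by metis
  have c\<psi>: "continuous_on UNIV \<psi>" by (rule Ck_1_continuous[OF \<psi>(1)])
  have c\<zeta>: "continuous_on UNIV \<zeta>"
  proof -
    have "continuous_on \<Omega> (\<lambda>x. F' (\<phi> x) * \<psi> x)"
      by (intro continuous_on_mult cF continuous_on_subset[OF c\<psi>]) auto
    then have 1: "continuous_on \<Omega> \<zeta>" by (rule continuous_on_eq) (auto simp: \<zeta>_def)
    have "continuous_on (- K) (\<lambda>x::'a. 0::real)" by simp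
    then have 2: "continuous_on (- K) \<zeta>" by (rule continuous_on_eq) (auto simp: \<zeta>_def K)
    have "\<Omega> \<union> - K = UNIV" using K by blast
    with continuous_on_open_Un[OF \<Omega>(1) _ 1 2] K(1) show ?thesis by (simp add: compact_imp_closed open_Compl)
  qed
  have s\<zeta>: "compactly_supported_in \<Omega> \<zeta>"
    unfolding compactly_supported_in_def using K by (intro exI[of _ K]) (auto simp: \<zeta>_def)
  let ?q1 = "\<lambda>\<tau>. (LINT x|lborel. \<psi> x * (f (x + \<tau> *\<^sub>R b) - f x)) / \<tau>"
  let ?q2 = "\<lambda>\<tau>. (LINT x|lborel. \<zeta> x * (indicator \<Omega> (x + \<tau> *\<^sub>R b) * \<phi> (x + \<tau> *\<^sub>R b) - indicator \<Omega> x * \<phi> x)) / \<tau>"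
  have l1: "(?q1 \<longlongrightarrow> - (LINT x|lborel. f x * ddir b \<psi> x)) (at_right 0)"
    by (rule difference_quotient_tendsto[OF if_ \<psi>(1) \<psi>U])
  have l2: "(?q2 \<longlongrightarrow> (LINT x|lebesgue_on \<Omega>. (G x \<bullet> b) * \<zeta> x)) (at_right 0)"
    by (rule lipschitz_difference_quotient[OF lip grad \<Omega> c\<zeta> s\<zeta> b])
  obtain \<rho> where \<rho>: "\<rho> > 0" "(\<Union>x\<in>K. cball x \<rho>) \<subseteq> \<Omega>"
    using compact_subset_open_imp_cball_epsilon_subset[OF K(1) \<Omega>(1) K(2)] by blast
  define D where "D = measure lebesgue \<Omega> * (B' * (\<bar>C\<bar> * L\<^sup>2))"
  have L: "L \<ge> 0" using lip lipschitz_on_nonneg by blast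
  have B'0: "B' \<ge> 0" using B'[of 0] norm_ge_zero order_trans by blast
  have i\<phi>: "integrable lborel (\<lambda>x. indicator \<Omega> x * \<phi> x)"
    using lebesgue_on_integral_indicator(2)[OF \<Omega>(1) borel_indicator_continuous_on[OF \<Omega>(1) c\<phi>]] 
      L2_integrable[OF finite_measure_lebesgue_on_open[OF \<Omega>], of \<phi>] grad unfolding has_L2_gradient_def by blast
  have d: "\<bar>?q1 \<tau> - ?q2 \<tau>\<bar> \<le> D * \<tau>" if \<tau>: "0 < \<tau>" "\<tau> < \<rho>" for \<tau>
  proof -
    let ?h1 = "\<lambda>x. \<psi> x * (f (x + \<tau> *\<^sub>R b) - f x)"
    let ?h2 = "\<lambda>x. \<zeta> x * (indicator \<Omega> (x + \<tau> *\<^sub>R b) * \<phi> (x + \<tau> *\<^sub>R b) - indicator \<Omega> x * \<phi> x)"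
    have "integrable lborel (\<lambda>x. (f (x + \<tau> *\<^sub>R b) - f x) * \<psi> x)"
      by (intro integrable_mult_bounded[of _ _ _ B'] Bochner_Integration.integrable_diff integrable_lborel_shift if_)
         (use B' borel_measurable_continuous_onI[OF c\<psi>] in auto)
    then have i1: "integrable lborel ?h1" by (simp add: mult.commute)
    have "compactly_supported_in UNIV \<zeta>" using s\<zeta> compactly_supported_in_mono by blast
    then obtain B'' where B'': "\<And>x. norm (\<zeta> x) \<le> B''" using bounded_compact_support[OF c\<zeta>] by metis
    have "integrable lborel (\<lambda>x. (indicator \<Omega> (x + \<tau> *\<^sub>R b) * \<phi> (x + \<tau> *\<^sub>R b) - indicator \<Omega> x * \<phi> x) * \<zeta> x)"
      by (intro integrable_mult_bounded[of _ _ _ B''] Bochner_Integration.integrable_diff integrable_lborel_shift[OF i\<phi>] i\<phi>)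
         (use B'' borel_measurable_continuous_onI[OF c\<zeta>] in auto)
    then have i2: "integrable lborel ?h2" by (simp only: mult.commute)
    have "?q1 \<tau> - ?q2 \<tau> = (LINT x|lborel. ?h1 x - ?h2 x) / \<tau>"
      using Bochner_Integration.integral_diff[OF i1 i2] by (simp only: diff_divide_distrib)
    moreover have "\<bar>LINT x|lborel. ?h1 x - ?h2 x\<bar> \<le> measure lebesgue \<Omega> * (B' * (\<bar>C\<bar> * (L * \<tau>)\<^sup>2))"
    proof (rule abs_integral_indicator_bound[OF \<Omega> Bochner_Integration.integrable_diff[OF i1 i2]])
      fix x show "\<bar>?h1 x - ?h2 x\<bar> \<le> indicator \<Omega> x * (B' * (\<bar>C\<bar> * (L * \<tau>)\<^sup>2))"
      proof (cases "x \<in> K")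
        case True
        have "dist x (x + \<tau> *\<^sub>R b) = \<tau>" using \<tau> b by (simp add: dist_norm)
        then have xx: "x \<in> \<Omega>" "x + \<tau> *\<^sub>R b \<in> \<Omega>" using \<rho> True \<tau> by (force)+
        let ?d = "\<phi> (x + \<tau> *\<^sub>R b) - \<phi> x"
        have "\<bar>?d\<bar> \<le> L * \<tau>"
          using lipschitz_onD[OF lip xx(2,1)] xx \<tau> b by (simp add: dist_norm)
        then have "?d\<^sup>2 \<le> (L * \<tau>)\<^sup>2" using abs_le_square_iff[of ?d "L * \<tau>"] by simp
        then have "\<bar>C\<bar> * ?d\<^sup>2 \<le> \<bar>C\<bar> * (L * \<tau>)\<^sup>2" by (intro mult_left_mono) auto
        moreover have "C * ?d\<^sup>2 \<le> \<bar>C\<bar> * ?d\<^sup>2" by (intro mult_right_mono) auto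
        ultimately have "\<bar>F (\<phi> (x + \<tau> *\<^sub>R b)) - F (\<phi> x) - F' (\<phi> x) * ?d\<bar> \<le> \<bar>C\<bar> * (L * \<tau>)\<^sup>2"
          using C[of "\<phi> (x + \<tau> *\<^sub>R b)" "\<phi> x"] by linarith
        then have "\<bar>\<psi> x\<bar> * \<bar>F (\<phi> (x + \<tau> *\<^sub>R b)) - F (\<phi> x) - F' (\<phi> x) * ?d\<bar> \<le> B' * (\<bar>C\<bar> * (L * \<tau>)\<^sup>2)"
          using B'[of x] B'0 by (intro mult_mono) auto
        moreover have "?h1 x - ?h2 x = \<psi> x * (F (\<phi> (x + \<tau> *\<^sub>R b)) - F (\<phi> x) - F' (\<phi> x) * ?d)"
          using xx by (simp add: f_def \<zeta>_def algebra_simps)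
        ultimately show ?thesis using xx by (simp add: abs_mult)
      next
        case False
        then show ?thesis using K(3) B'0 by (simp add: \<zeta>_def)
      qed
    qed
    ultimately have "\<bar>?q1 \<tau> - ?q2 \<tau>\<bar> \<le> measure lebesgue \<Omega> * (B' * (\<bar>C\<bar> * (L * \<tau>)\<^sup>2)) / \<tau>"
      using \<tau> by (simp only: abs_divide abs_of_pos divide_right_mono less_imp_le)
    also have "\<dots> = D * \<tau>" using \<tau> by (simp add: D_def power2_eq_square)
    finally show ?thesis .
  qed
  have "((\<lambda>\<tau>. D * \<tau>) \<longlongrightarrow> D * 0) (at_right 0)" by (intro tendsto_intros)
  then have "((\<lambda>\<tau>. D * \<tau>) \<longlongrightarrow> 0) (at_right 0)" by simp
  moreover have "\<forall>\<^sub>F \<tau> in at_right 0. norm (?q1 \<tau> - ?q2 \<tau>) \<le> D * \<tau>"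
    unfolding eventually_at_right_field real_norm_def by (rule exI[of _ \<rho>]) (use \<rho>(1) d in blast)
  ultimately have "((\<lambda>\<tau>. ?q1 \<tau> - ?q2 \<tau>) \<longlongrightarrow> 0) (at_right 0)" by (rule Lim_null_comparison[rotated])
  from tendsto_unique[OF _ tendsto_diff[OF l1 l2] this]
  have e: "(LINT x|lborel. f x * ddir b \<psi> x) = - (LINT x|lebesgue_on \<Omega>. (G x \<bullet> b) * \<zeta> x)" by simp
  have dm: "ddir b \<psi> \<in> borel_measurable borel"
    using \<psi>(1) by (intro borel_measurable_continuous_onI) simp
  have "(LINT x|lebesgue_on \<Omega>. F (\<phi> x) * ddir b \<psi> x) = (LINT x|lborel. indicator \<Omega> x * (F (\<phi> x) * ddir b \<psi> x))"
  proof (rule lebesgue_on_integral_indicator(1)[OF \<Omega>(1)])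
    have "(\<lambda>x. f x * ddir b \<psi> x) \<in> borel_measurable borel" using dm by simp
    then show "(\<lambda>x. indicator \<Omega> x * (F (\<phi> x) * ddir b \<psi> x)) \<in> borel_measurable borel"
      by (simp only: f_def mult.assoc)
  qed
  also have "\<dots> = (LINT x|lborel. f x * ddir b \<psi> x)" by (simp only: f_def mult.assoc)
  also note e
  also have "(LINT x|lebesgue_on \<Omega>. (G x \<bullet> b) * \<zeta> x) = (LINT x|lebesgue_on \<Omega>. F' (\<phi> x) * (G x \<bullet> b) * \<psi> x)"
    by (rule Bochner_Integration.integral_cong) (auto simp: \<zeta>_def)
  finally show ?thesis .
qed

section \<open>Boundary density and an isoperimetric inequality for superlevel sets\<close>

lemma hausdorff_measure_mono: "A \<subseteq> B \<Longrightarrow> hausdorff_measure k A \<le> hausdorff_measure k B"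
  unfolding hausdorff_measure_def hausdorff_premeasure_def
  by (intro SUP_mono' INF_superset_mono) auto

text \<open>
  Above the graph of a function with Lipschitz constant \<open>K\<close> there is a cone with vertex at each point of
  the graph, and below it the opposite cone. Both contain balls whose radius is a fixed multiple of
  the distance \<open>\<rho>\<close> to the vertex.
\<close>

lemma lipschitz_graph_cones:
  assumes \<Omega>: "bounded_lipschitz_domain (\<Omega> :: 'a::euclidean_space set)" and x: "x \<in> frontier \<Omega>"
  obtains \<nu> \<kappa> \<rho>0 where "norm \<nu> = 1" "0 < \<kappa>" "\<kappa> \<le> 1/2" "0 < \<rho>0"
    "\<And>\<rho>. 0 < \<rho> \<Longrightarrow> \<rho> < \<rho>0 \<Longrightarrow> ball (x + (\<rho>/2) *\<^sub>R \<nu>) (\<kappa> * \<rho>) \<subseteq> \<Omega> \<inter> ball x \<rho>"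
    "\<And>\<rho>. 0 < \<rho> \<Longrightarrow> \<rho> < \<rho>0 \<Longrightarrow> ball (x - (\<rho>/2) *\<^sub>R \<nu>) (\<kappa> * \<rho>) \<subseteq> ball x \<rho> - \<Omega>"
proof -
  have "\<exists>r>0. \<exists>\<nu> (g :: 'a \<Rightarrow> real) K. norm \<nu> = 1 \<and> K-lipschitz_on {z. z \<bullet> \<nu> = 0} g \<and>
        \<Omega> \<inter> ball x r = {y \<in> ball x r. g (y - (y \<bullet> \<nu>) *\<^sub>R \<nu>) < y \<bullet> \<nu>}"
    by (rule bspec[OF conjunct2[OF conjunct2[OF conjunct2[OF conjunct2[OF \<Omega>[unfolded bounded_lipschitz_domain_def]]]]] x])
  then obtain r \<nu> and g :: "'a \<Rightarrow> real" and K where r: "r > 0" and \<nu>: "norm \<nu> = 1" and g: "K-lipschitz_on {z. z \<bullet> \<nu> = 0} g"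
    and eq: "\<Omega> \<inter> ball x r = {y \<in> ball x r. g (y - (y \<bullet> \<nu>) *\<^sub>R \<nu>) < y \<bullet> \<nu>}"
    by (elim exE conjE) (rule that)
  have K: "K \<ge> 0" using g lipschitz_on_nonneg by blast
  define p where "p y = y - (y \<bullet> \<nu>) *\<^sub>R \<nu>" for y
  have \<nu>\<nu>: "\<nu> \<bullet> \<nu> = 1" using \<nu> by (simp add: dot_square_norm)
  have p0: "p y \<bullet> \<nu> = 0" for y by (simp add: p_def inner_diff_left \<nu>\<nu>)
  have pdiff: "p y - p z = p (y - z)" for y z by (simp add: p_def inner_diff_left algebra_simps)
  have pnorm: "norm (p y) \<le> norm y" for y
  proof -
    have "(norm (p y))\<^sup>2 = (norm y)\<^sup>2 - (y \<bullet> \<nu>)\<^sup>2"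
      unfolding p_def power2_norm_eq_inner
      by (simp add: inner_diff_left inner_diff_right \<nu>\<nu> inner_commute power2_eq_square)
    then have "(norm (p y))\<^sup>2 \<le> (norm y)\<^sup>2" by simp
    then show ?thesis using power2_le_imp_le by auto
  qed
  have glip: "\<bar>g (p y) - g (p z)\<bar> \<le> K * norm (p (y - z))" for y z
    using lipschitz_onD[OF g, of "p y" "p z"] p0 by (simp add: dist_norm pdiff)
  have op: "open \<Omega>" using \<Omega> by (simp add: bounded_lipschitz_domain_def)
  have in_iff: "y \<in> \<Omega> \<longleftrightarrow> g (p y) < y \<bullet> \<nu>" if "y \<in> ball x r" for y
    using eq that unfolding p_def by blast
  have xr: "x \<in> ball x r" using r by simp
  have "x \<notin> \<Omega>" using x op by (simp add: frontier_def interior_open)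
  (* a boundary point lies on the graph: it is not in the open set, and it is a limit of points of the set *)
  then have ge: "x \<bullet> \<nu> \<le> g (p x)" using in_iff[OF xr] by linarith
  have le: "g (p x) \<le> x \<bullet> \<nu>"
  proof (rule ccontr)
    assume c: "\<not> ?thesis"
    define \<delta> where "\<delta> = min r ((g (p x) - x \<bullet> \<nu>) / (K + 1))"
    have \<delta>: "\<delta> > 0" using c r K by (simp add: \<delta>_def)
    have "x \<in> closure \<Omega>" using x by (simp add: frontier_def)
    then obtain y where y: "y \<in> \<Omega>" "dist y x < \<delta>" using \<delta> unfolding closure_approachable by blast
    have "y \<in> ball x r" using y(2) by (simp add: \<delta>_def dist_commute)
    then have 1: "g (p y) < y \<bullet> \<nu>" using in_iff y(1) by blast
    have "\<bar>g (p y) - g (p x)\<bar> \<le> K * norm (y - x)"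
      using glip[of y x] mult_left_mono[OF pnorm[of "y - x"] K] by linarith
    moreover have "\<bar>y \<bullet> \<nu> - x \<bullet> \<nu>\<bar> \<le> norm (y - x)"
      using Cauchy_Schwarz_ineq2[of "y - x" \<nu>] \<nu> by (simp add: inner_diff_left)
    ultimately have "g (p x) - x \<bullet> \<nu> < (K + 1) * norm (y - x)"
      using 1 by (simp add: algebra_simps)
    also have "\<dots> \<le> (K + 1) * \<delta>" using y(2) K by (intro mult_left_mono) (auto simp: dist_norm)
    also have "\<dots> \<le> (K + 1) * ((g (p x) - x \<bullet> \<nu>) / (K + 1))" using K by (intro mult_left_mono) (auto simp: \<delta>_def)
    also have "\<dots> = g (p x) - x \<bullet> \<nu>" using K by simp
    finally show False by simp
  qed
  have gx: "g (p x) = x \<bullet> \<nu>" using le ge by simp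
  (* with this radius the vertical deviation z . nu and the rise K |z| together stay below rho / 2 *)
  define \<kappa> where "\<kappa> = 1 / (2 * (K + 1))"
  have \<kappa>: "\<kappa> > 0" "\<kappa> \<le> 1/2" "\<kappa> * (K + 1) = 1/2" using K by (auto simp: \<kappa>_def field_simps)
  have main: "y \<in> ball x \<rho> \<and> (s = 1 \<longrightarrow> y \<in> \<Omega>) \<and> (s = -1 \<longrightarrow> y \<notin> \<Omega>)"
    if \<rho>: "0 < \<rho>" "\<rho> < r" and y: "y \<in> ball (x + (s * \<rho>/2) *\<^sub>R \<nu>) (\<kappa> * \<rho>)" and s: "s = 1 \<or> s = -1" for y \<rho> s
  proof -
    define z where "z = y - x - (s * \<rho>/2) *\<^sub>R \<nu>"
    have z: "norm z < \<kappa> * \<rho>" using y by (simp add: z_def dist_norm norm_minus_commute algebra_simps)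
    have yx: "y - x = (s * \<rho>/2) *\<^sub>R \<nu> + z" by (simp add: z_def)
    have "norm (y - x) \<le> norm ((s * \<rho>/2) *\<^sub>R \<nu>) + norm z" unfolding yx by (rule norm_triangle_ineq)
    also have "norm ((s * \<rho>/2) *\<^sub>R \<nu>) = \<rho> / 2" using s \<nu> \<rho> by auto
    also have "\<rho> / 2 + norm z < \<rho> / 2 + \<rho> / 2" using z mult_right_mono[OF \<kappa>(2), of \<rho>] \<rho> by linarith
    finally have yb: "y \<in> ball x \<rho>" by (simp add: dist_norm norm_minus_commute)
    have "p (y - x) = p z" unfolding yx p_def by (simp add: inner_add_left \<nu>\<nu> algebra_simps)
    then have A: "\<bar>g (p y) - g (p x)\<bar> \<le> K * norm z"
      using glip[of y x] mult_left_mono[OF pnorm[of z] K] by simp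
    have B: "y \<bullet> \<nu> - x \<bullet> \<nu> = s * \<rho>/2 + z \<bullet> \<nu>"
      using arg_cong[OF yx, of "\<lambda>w. w \<bullet> \<nu>"] by (simp add: inner_diff_left inner_add_left \<nu>\<nu>)
    have "\<bar>z \<bullet> \<nu>\<bar> \<le> norm z" using Cauchy_Schwarz_ineq2[of z \<nu>] \<nu> by simp
    moreover have "(K + 1) * norm z < \<rho> / 2"
    proof -
      have "(K + 1) * norm z < (K + 1) * (\<kappa> * \<rho>)" using z K by (intro mult_strict_left_mono) auto
      also have "\<dots> = (\<kappa> * (K + 1)) * \<rho>" by (simp add: algebra_simps)
      finally show ?thesis by (simp add: \<kappa>(3))
    qed
    ultimately have C: "K * norm z + \<bar>z \<bullet> \<nu>\<bar> < \<rho> / 2" by (simp add: algebra_simps)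
    have yr: "y \<in> ball x r" using yb \<rho> by simp
    show ?thesis using s A B C gx in_iff[OF yr] yb by auto
  qed
  show ?thesis
  proof (rule that[OF \<nu> \<kappa>(1,2) r])
    show "ball (x + (\<rho>/2) *\<^sub>R \<nu>) (\<kappa> * \<rho>) \<subseteq> \<Omega> \<inter> ball x \<rho>" if "0 < \<rho>" "\<rho> < r" for \<rho>
      using main[OF that, of _ 1] by auto
    show "ball (x - (\<rho>/2) *\<^sub>R \<nu>) (\<kappa> * \<rho>) \<subseteq> ball x \<rho> - \<Omega>" if "0 < \<rho>" "\<rho> < r" for \<rho>
      using main[OF that, of _ "-1"] by auto
  qed
qed

text \<open>
  Near \<open>x\<close> the set \<open>E\<close> agrees with \<open>\<Omega>\<close>, and the two balls in the cones keep its density between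
  \<open>\<kappa>\<^sup>n\<close> and \<open>1 - \<kappa>\<^sup>n\<close>.
\<close>

lemma frontier_subset_ess_boundary:
  assumes \<Omega>: "bounded_lipschitz_domain (\<Omega> :: 'a::euclidean_space set)" and x: "x \<in> frontier \<Omega>"
    and E: "E \<in> sets lebesgue" "E \<subseteq> \<Omega>" and r: "r > 0" "\<Omega> \<inter> ball x r \<subseteq> E"
  shows "x \<in> ess_boundary E"
proof -
  obtain \<nu> \<kappa> \<rho>0 where c: "norm \<nu> = 1" "0 < \<kappa>" "\<kappa> \<le> 1/2" "0 < \<rho>0"
    "\<And>\<rho>. 0 < \<rho> \<Longrightarrow> \<rho> < \<rho>0 \<Longrightarrow> ball (x + (\<rho>/2) *\<^sub>R \<nu>) (\<kappa> * \<rho>) \<subseteq> \<Omega> \<inter> ball x \<rho>"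
    "\<And>\<rho>. 0 < \<rho> \<Longrightarrow> \<rho> < \<rho>0 \<Longrightarrow> ball (x - (\<rho>/2) *\<^sub>R \<nu>) (\<kappa> * \<rho>) \<subseteq> ball x \<rho> - \<Omega>"
    using lipschitz_graph_cones[OF \<Omega> x] by metis
  let ?d = "\<lambda>r. measure lebesgue (E \<inter> ball x r) / measure lebesgue (ball x r)"
  let ?n = "DIM('a)"
  have bnd: "\<kappa> ^ ?n \<le> ?d \<rho> \<and> ?d \<rho> \<le> 1 - \<kappa> ^ ?n" if \<rho>: "0 < \<rho>" "\<rho> < min \<rho>0 r" for \<rho>
  proof -
    let ?V = "measure lebesgue (ball x \<rho>)"
    have V: "?V > 0" using content_ball_pos[OF \<rho>(1)] by simp
    have small: "measure lebesgue (ball y (\<kappa> * \<rho>)) = \<kappa> ^ ?n * ?V" for y :: 'a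
      using \<rho> c(2) by (simp add: content_ball power_mult_distrib)
    have meas: "E \<inter> ball x \<rho> \<in> lmeasurable"
      using E(1) by (metis inf_commute fmeasurable_Int_fmeasurable lmeasurable_ball)
    have "ball (x + (\<rho>/2) *\<^sub>R \<nu>) (\<kappa> * \<rho>) \<subseteq> E \<inter> ball x \<rho>"
      using c(5)[of \<rho>] \<rho> r(2) by (auto simp: subset_iff)
    then have "\<kappa> ^ ?n * ?V \<le> measure lebesgue (E \<inter> ball x \<rho>)"
      using measure_mono_fmeasurable[OF _ _ meas, of "ball (x + (\<rho>/2) *\<^sub>R \<nu>) (\<kappa> * \<rho>)"]
        small[of "x + (\<rho>/2) *\<^sub>R \<nu>"] by auto
    moreover have "measure lebesgue (E \<inter> ball x \<rho>) \<le> ?V - \<kappa> ^ ?n * ?V"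
    proof -
      have "measure lebesgue (E \<inter> ball x \<rho>) \<le> measure lebesgue (ball x \<rho> - ball (x - (\<rho>/2) *\<^sub>R \<nu>) (\<kappa> * \<rho>))"
        using c(6)[of \<rho>] \<rho> E(2) meas by (intro measure_mono_fmeasurable) auto
      also have "\<dots> = ?V - measure lebesgue (ball (x - (\<rho>/2) *\<^sub>R \<nu>) (\<kappa> * \<rho>))"
        using c(6)[of \<rho>] \<rho> by (intro measurable_measure_Diff) auto
      finally show ?thesis unfolding small .
    qed
    ultimately show ?thesis using V by (simp add: field_simps)
  qed
  then have ev: "\<forall>\<^sub>F \<rho> in at_right 0. \<kappa> ^ ?n \<le> ?d \<rho>" "\<forall>\<^sub>F \<rho> in at_right 0. ?d \<rho> \<le> 1 - \<kappa> ^ ?n"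
    unfolding eventually_at_right_field using c(4) r(1) by (auto intro!: exI[of _ "min \<rho>0 r"])
  have \<kappa>n: "\<kappa> ^ ?n > 0" using c(2) by simp
  show ?thesis unfolding ess_boundary_def
  proof (intro CollectI conjI notI)
    assume "(?d \<longlongrightarrow> 0) (at_right 0)"
    from tendsto_lowerbound[OF this ev(1)] show False using \<kappa>n by simp
  next
    assume "(?d \<longlongrightarrow> 1) (at_right 0)"
    from tendsto_upperbound[OF this ev(2)] show False using \<kappa>n by simp
  qed
qed

lemma lebesgue_on_subset_integral:
  fixes f :: "'a::euclidean_space \<Rightarrow> real"
  assumes "E \<in> sets lebesgue" "\<Omega> \<in> sets lebesgue" "E \<subseteq> \<Omega>"
  shows "(LINT x|lebesgue_on E. f x) = (LINT x|lebesgue_on \<Omega>. indicator E x * f x)"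
proof -
  have "(LINT x|lebesgue_on E. f x) = (LINT x|lebesgue. indicator E x *\<^sub>R f x)"
    by (rule integral_restrict_space) (use assms in auto)
  also have "\<dots> = (LINT x|lebesgue. indicator \<Omega> x *\<^sub>R (indicator E x * f x))"
    by (rule Bochner_Integration.integral_cong) (use assms(3) in \<open>auto simp: indicator_def\<close>)
  also have "\<dots> = (LINT x|lebesgue_on \<Omega>. indicator E x * f x)"
    by (rule integral_restrict_space[symmetric]) (use assms in auto)
  finally show ?thesis .
qed

definition perimeter_fields :: "'a::euclidean_space set \<Rightarrow> ('a \<Rightarrow> 'a) set" where
  "perimeter_fields \<Omega> = {\<Phi>. Ck 1 \<Phi> \<and> compactly_supported_in \<Omega> \<Phi> \<and> (\<forall>x. norm (\<Phi> x) \<le> 1)}"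

lemma perimeter_eq: "perimeter \<Omega> E = (SUP \<Phi>\<in>perimeter_fields \<Omega>. ennreal (LINT x|lebesgue_on E. divergence \<Phi> x))"
  by (simp add: perimeter_def perimeter_fields_def)

lemma ddir_inner:
  assumes "Ck 1 \<Phi>"
  shows "ddir v (\<lambda>x. \<Phi> x \<bullet> b) x = ddir v \<Phi> x \<bullet> b"
proof -
  have "(\<Phi> has_derivative frechet_derivative \<Phi> (at x)) (at x)" using assms Ck_has_derivative by (metis One_nat_def)
  from frechet_derivative_at[OF has_derivative_inner_left[OF this], symmetric] show ?thesis by simp
qed

lemma component_field:
  assumes "Ck 1 \<Phi>" "compactly_supported_in \<Omega> \<Phi>"
  shows "Ck 1 (\<lambda>x. \<Phi> x \<bullet> b)" "compactly_supported_in \<Omega> (\<lambda>x. \<Phi> x \<bullet> b)"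
proof -
  show "Ck 1 (\<lambda>x. \<Phi> x \<bullet> b)" by (rule Ck_bounded_linear[OF bounded_linear_inner_left assms(1)])
  show "compactly_supported_in \<Omega> (\<lambda>x. \<Phi> x \<bullet> b)"
    using assms(2) unfolding compactly_supported_in_def by auto
qed

lemma divergence_eq: "Ck 1 \<Phi> \<Longrightarrow> divergence \<Phi> x = (\<Sum>b\<in>Basis. ddir b (\<lambda>x. \<Phi> x \<bullet> b) x)"
  by (simp add: divergence_def ddir_inner)

lemma continuous_divergence:
  assumes "Ck 1 \<Phi>" shows "continuous_on UNIV (divergence \<Phi>)"
proof -
  have "continuous_on UNIV (\<lambda>x. ddir b \<Phi> x \<bullet> b)" for b
    using assms by (intro continuous_on_inner) auto
  then show ?thesis unfolding divergence_def[abs_def] by (intro continuous_on_sum) auto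
qed

lemma divergence_support:
  assumes "compactly_supported_in \<Omega> \<Phi>" shows "compactly_supported_in \<Omega> (divergence \<Phi>)"
proof -
  obtain K where K: "compact K" "K \<subseteq> \<Omega>" "\<And>x. x \<notin> K \<Longrightarrow> \<Phi> x = 0"
    using assms unfolding compactly_supported_in_def by blast
  have "divergence \<Phi> x = 0" if "x \<notin> K" for x
  proof -
    have "((\<lambda>x. 0) has_derivative (\<lambda>x. 0)) (at x)" by simp
    then have "(\<Phi> has_derivative (\<lambda>x. 0)) (at x)"
      by (rule has_derivative_transform_within_open[OF _ open_Compl[OF compact_imp_closed[OF K(1)]]])
         (use K that in auto)
    then have "frechet_derivative \<Phi> (at x) = (\<lambda>x. 0)" using frechet_derivative_at by metis
    then show ?thesis by (simp add: divergence_def)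
  qed
  then show ?thesis unfolding compactly_supported_in_def using K by blast
qed

lemma integral_divergence_zero:
  fixes \<Phi> :: "'a::euclidean_space \<Rightarrow> 'a"
  assumes "open \<Omega>" and \<Phi>: "Ck 1 \<Phi>" "compactly_supported_in \<Omega> \<Phi>"
  shows "(LINT x|lebesgue_on \<Omega>. divergence \<Phi> x) = 0"
proof -
  have U: "compactly_supported_in UNIV (\<lambda>x. \<Phi> x \<bullet> b)" for b
    using component_field(2)[OF \<Phi>] compactly_supported_in_mono by blast
  have i: "integrable lborel (ddir b (\<lambda>x. \<Phi> x \<bullet> b))" for b
    using component_field(1)[OF \<Phi>, of b] by (intro integrable_compact_support ddir_support U) simp
  have "(LINT x|lebesgue_on \<Omega>. divergence \<Phi> x) = (LINT x|lborel. divergence \<Phi> x)"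
    by (rule lebesgue_on_integral_borel(1)[OF assms(1) borel_measurable_continuous_onI[OF continuous_divergence[OF \<Phi>(1)]]])
       (use compactly_supported_outside[OF divergence_support[OF \<Phi>(2)]] in auto)
  also have "\<dots> = (\<Sum>b\<in>Basis. LINT x|lborel. ddir b (\<lambda>x. \<Phi> x \<bullet> b) x)"
    unfolding divergence_eq[OF \<Phi>(1)] by (rule Bochner_Integration.integral_sum) (rule i)
  also have "\<dots> = 0"
    by (rule sum.neutral) (use integral_ddir_zero[OF component_field(1)[OF \<Phi>] U] in blast)
  finally show ?thesis .
qed

text \<open>
  The divergence of a compactly supported field integrates to \<open>0\<close> over \<open>\<Omega>\<close>, so passing to the
  complement amounts to reversing the field.
\<close>

lemma perimeter_complement_le:
  fixes \<Omega> :: "'a::euclidean_space set"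
  assumes \<Omega>: "open \<Omega>" "bounded \<Omega>" and E: "E \<in> sets lebesgue" "E \<subseteq> \<Omega>"
  shows "perimeter \<Omega> (\<Omega> - E) \<le> perimeter \<Omega> E"
  unfolding perimeter_eq
proof (rule SUP_mono)
  fix \<Phi> assume "\<Phi> \<in> perimeter_fields \<Omega>"
  then have \<Phi>: "Ck 1 \<Phi>" "compactly_supported_in \<Omega> \<Phi>" "\<And>x. norm (\<Phi> x) \<le> 1"
    by (auto simp: perimeter_fields_def)
  let ?\<Psi> = "\<lambda>x. - \<Phi> x"
  have d: "divergence ?\<Psi> x = - divergence \<Phi> x" for x
  proof -
    have "(\<Phi> has_derivative frechet_derivative \<Phi> (at x)) (at x)" using \<Phi>(1) Ck_has_derivative by (metis One_nat_def)
    from frechet_derivative_at[OF has_derivative_minus[OF this], symmetric] show ?thesis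
      by (simp add: divergence_def sum_negf)
  qed
  have \<Psi>: "?\<Psi> \<in> perimeter_fields \<Omega>"
    using \<Phi> Ck_uminus[OF \<Phi>(1)] unfolding perimeter_fields_def compactly_supported_in_def by auto
  have Os: "\<Omega> \<in> sets lebesgue" using \<Omega>(1) by simp
  have i: "integrable (lebesgue_on \<Omega>) (divergence \<Phi>)"
    using lebesgue_on_integral_borel(2)[OF \<Omega>(1) borel_measurable_continuous_onI[OF continuous_divergence[OF \<Phi>(1)]]]
      compactly_supported_outside[OF divergence_support[OF \<Phi>(2)]]
      integrable_compact_support[OF continuous_divergence[OF \<Phi>(1)] 
        compactly_supported_in_mono[OF divergence_support[OF \<Phi>(2)]]] by blast
  have "E \<in> sets (lebesgue_on \<Omega>)" using E sets_lebesgue_on_open_iff[OF \<Omega>(1)] by blast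
  then have iE: "integrable (lebesgue_on \<Omega>) (\<lambda>x. indicator E x * divergence \<Phi> x)"
    using integrable_mult_indicator[OF _ i, of E] by simp
  have "(LINT x|lebesgue_on (\<Omega> - E). divergence \<Phi> x) = (LINT x|lebesgue_on \<Omega>. indicator (\<Omega> - E) x * divergence \<Phi> x)"
    by (rule lebesgue_on_subset_integral) (use E Os in auto)
  also have "\<dots> = (LINT x|lebesgue_on \<Omega>. divergence \<Phi> x - indicator E x * divergence \<Phi> x)"
    by (rule Bochner_Integration.integral_cong) (auto simp: indicator_def)
  also have "\<dots> = - (LINT x|lebesgue_on \<Omega>. indicator E x * divergence \<Phi> x)"
    using integral_divergence_zero[OF \<Omega>(1) \<Phi>(1,2)] i iE by simp
  also have "\<dots> = (LINT x|lebesgue_on E. divergence ?\<Psi> x)"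
    unfolding d using lebesgue_on_subset_integral[OF E(1) Os E(2), of "divergence \<Phi>"] by simp
  finally have "(LINT x|lebesgue_on (\<Omega> - E). divergence \<Phi> x) = (LINT x|lebesgue_on E. divergence ?\<Psi> x)" .
  with \<Psi> show "\<exists>m\<in>perimeter_fields \<Omega>. ennreal (LINT x|lebesgue_on (\<Omega> - E). divergence \<Phi> x)
     \<le> ennreal (LINT x|lebesgue_on E. divergence m x)"
    by (intro bexI[of _ ?\<Psi>]) auto
qed

text \<open>
  For a superlevel set that fills more than half of \<open>\<Omega>\<close> the relative isoperimetric inequality bounds
  only the complement. There the boundary set \<open>F\<close> takes over: it lies in the measure-theoretic
  boundary of the complement, so its area bounds the perimeter from below.
\<close>

lemma isoperimetric_superlevel:
  fixes \<Omega> F :: "'a::euclidean_space set" and \<phi> :: "'a \<Rightarrow> real" and \<epsilon> Q C :: real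
  assumes \<Omega>: "bounded_lipschitz_domain \<Omega>" and F: "F \<subseteq> frontier \<Omega>"
    and H: "hausdorff_measure k F = ennreal \<epsilon>" "\<epsilon> > 0"
    and Q: "Q > 0" "\<And>E. E \<in> sets lebesgue \<Longrightarrow> E \<subseteq> \<Omega> \<Longrightarrow>
           ennreal (min (measure lebesgue E) (measure lebesgue (\<Omega> - E)) powr \<alpha>) \<le> ennreal Q * perimeter \<Omega> E"
    and C: "C > 0" "\<And>E. E \<in> sets lebesgue \<Longrightarrow> E \<subseteq> \<Omega> \<Longrightarrow> measure lebesgue E \<le> measure lebesgue \<Omega> / 2 \<Longrightarrow>
           hausdorff_measure k (ess_boundary E \<inter> frontier \<Omega>) \<le> ennreal C * perimeter \<Omega> E"
    and \<alpha>: "\<alpha> \<ge> 0" and \<phi>: "\<phi> \<in> Lip_vanishing_near \<Omega> F" and t: "t \<ge> 0"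
  defines "E \<equiv> {x \<in> \<Omega>. \<phi> x > t}"
  shows "ennreal (measure lebesgue E powr \<alpha>) \<le> ennreal (max Q (C * measure lebesgue \<Omega> powr \<alpha> / \<epsilon>)) * perimeter \<Omega> E"
proof -
  define M where "M = measure lebesgue \<Omega>"
  define K where "K = max Q (C * M powr \<alpha> / \<epsilon>)"
  have op: "open \<Omega>" "bounded \<Omega>" using \<Omega> by (auto simp: bounded_lipschitz_domain_def)
  obtain L where L: "L-lipschitz_on \<Omega> \<phi>" using \<phi> unfolding Lip_vanishing_near_def by blast
  have "E = \<Omega> \<inter> \<phi> -` {t<..}" by (auto simp: E_def)
  then have oE: "open E"
    using continuous_open_preimage[OF lipschitz_on_continuous_on[OF L] op(1), of "{t<..}"] by simp
  have E: "E \<in> sets lebesgue" "E \<subseteq> \<Omega>" using oE by (auto simp: E_def)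
  have Om: "\<Omega> \<in> lmeasurable" using op by (simp add: lmeasurable_open)
  have EM: "measure lebesgue E \<le> M" unfolding M_def using E Om by (intro measure_mono_fmeasurable) auto
  have diff: "measure lebesgue (\<Omega> - E) = M - measure lebesgue E"
    unfolding M_def using E Om by (intro measurable_measure_Diff) auto
  show ?thesis
  proof (cases "measure lebesgue E \<le> M / 2")
    case True
    then have "min (measure lebesgue E) (measure lebesgue (\<Omega> - E)) = measure lebesgue E" using diff by simp
    with Q(2)[OF E] have "ennreal (measure lebesgue E powr \<alpha>) \<le> ennreal Q * perimeter \<Omega> E" by simp
    also have "\<dots> \<le> ennreal K * perimeter \<Omega> E" by (intro mult_right_mono ennreal_leI) (auto simp: K_def)
    finally show ?thesis unfolding K_def M_def .
  next
    case False
    have cE: "\<Omega> - E \<in> sets lebesgue" "\<Omega> - E \<subseteq> \<Omega>" "measure lebesgue (\<Omega> - E) \<le> measure lebesgue \<Omega> / 2"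
      using E Om False diff by (auto simp: M_def)
    have "F \<subseteq> ess_boundary (\<Omega> - E) \<inter> frontier \<Omega>"
    proof
      fix x assume x: "x \<in> F"
      then have "x \<notin> closure {x \<in> \<Omega>. \<phi> x \<noteq> 0}" using \<phi> unfolding Lip_vanishing_near_def by blast
      then have "x \<in> - closure {x \<in> \<Omega>. \<phi> x \<noteq> 0}" by simp
      then obtain r where r: "r > 0" "ball x r \<subseteq> - closure {x \<in> \<Omega>. \<phi> x \<noteq> 0}"
        using open_contains_ball[of "- closure {x \<in> \<Omega>. \<phi> x \<noteq> 0}"] closed_closure by blast
      then have "ball x r \<inter> {x \<in> \<Omega>. \<phi> x \<noteq> 0} = {}" using closure_subset[of "{x \<in> \<Omega>. \<phi> x \<noteq> 0}"] by blast
      then have "\<Omega> \<inter> ball x r \<subseteq> \<Omega> - E" using t unfolding E_def by force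
      with frontier_subset_ess_boundary[OF \<Omega> _ cE(1,2) r(1)] x F
      show "x \<in> ess_boundary (\<Omega> - E) \<inter> frontier \<Omega>" by blast
    qed
    then have "ennreal \<epsilon> \<le> hausdorff_measure k (ess_boundary (\<Omega> - E) \<inter> frontier \<Omega>)"
      unfolding H(1)[symmetric] by (rule hausdorff_measure_mono)
    also have "\<dots> \<le> ennreal C * perimeter \<Omega> (\<Omega> - E)" by (rule C(2)[OF cE])
    also have "\<dots> \<le> ennreal C * perimeter \<Omega> E"
      by (intro mult_left_mono perimeter_complement_le op E) auto
    finally have "ennreal \<epsilon> \<le> ennreal C * perimeter \<Omega> E" .
    then have "ennreal (M powr \<alpha> / \<epsilon>) * ennreal \<epsilon> \<le> ennreal (M powr \<alpha> / \<epsilon>) * (ennreal C * perimeter \<Omega> E)"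
      by (intro mult_left_mono) auto
    also have "\<dots> = ennreal (C * M powr \<alpha> / \<epsilon>) * perimeter \<Omega> E"
      using C(1) H(2) by (simp add: ennreal_mult[symmetric] mult.assoc[symmetric] mult.commute)
    also have "\<dots> \<le> ennreal K * perimeter \<Omega> E" by (intro mult_right_mono ennreal_leI) (auto simp: K_def)
    also have "ennreal (M powr \<alpha> / \<epsilon>) * ennreal \<epsilon> = ennreal (M powr \<alpha>)"
      using H(2) by (simp add: ennreal_mult[symmetric])
    finally have "ennreal (M powr \<alpha>) \<le> ennreal K * perimeter \<Omega> E" .
    moreover have "measure lebesgue E powr \<alpha> \<le> M powr \<alpha>" using EM \<alpha> by (intro powr_mono2) auto
    ultimately show ?thesis unfolding K_def M_def using ennreal_leI order_trans by blast
  qed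
qed

section \<open>A coarea inequality\<close>

text \<open>
  A primitive of the positive part, the building block of \<open>C\<^sup>1\<close> ramps with an explicit formula.
\<close>

definition pos_sq :: "real \<Rightarrow> real" where "pos_sq s = (max 0 s)\<^sup>2 / 2"

lemma pos_sq_taylor: "\<bar>pos_sq y - pos_sq x - max 0 x * (y - x)\<bar> \<le> (y - x)\<^sup>2"
proof -
  consider "x \<ge> 0" "y \<ge> 0" | "x \<ge> 0" "y < 0" | "x < 0" "y \<ge> 0" | "x < 0" "y < 0" by linarith
  then show ?thesis
  proof cases
    case 1
    then have e: "pos_sq y - pos_sq x - max 0 x * (y - x) = (y - x)\<^sup>2 / 2"
      by (simp add: pos_sq_def power2_eq_square field_simps)
    show ?thesis unfolding e by simp
  next
    case 2
    then have e: "pos_sq y - pos_sq x - max 0 x * (y - x) = x\<^sup>2 / 2 - x * y"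
      by (simp add: pos_sq_def power2_eq_square field_simps)
    have "x * y \<le> 0" using 2 by (simp add: mult_nonneg_nonpos)
    moreover have "(y - x)\<^sup>2 = y\<^sup>2 - 2 * (x * y) + x\<^sup>2" by (simp add: power2_eq_square field_simps)
    ultimately show ?thesis unfolding e using zero_le_power2[of x] zero_le_power2[of y] by linarith
  next
    case 3
    then have e: "pos_sq y - pos_sq x - max 0 x * (y - x) = y\<^sup>2 / 2" by (simp add: pos_sq_def)
    have "y\<^sup>2 \<le> (y - x)\<^sup>2" using 3 by (intro power_mono) auto
    moreover have "0 \<le> y\<^sup>2" by simp
    ultimately show ?thesis unfolding e by linarith
  next
    case 4
    then show ?thesis by (simp add: pos_sq_def)
  qed
qed

lemma taylor_imp_DERIV:
  fixes f :: "real \<Rightarrow> real"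
  assumes "\<And>x y. \<bar>f y - f x - f' x * (y - x)\<bar> \<le> C * (y - x)\<^sup>2"
  shows "(f has_real_derivative f' x) (at x)"
proof -
  have "((\<lambda>y. (f y - f x) / (y - x) - f' x) \<longlongrightarrow> 0) (at x)"
  proof (rule Lim_null_comparison)
    show "\<forall>\<^sub>F y in at x. norm ((f y - f x) / (y - x) - f' x) \<le> \<bar>C\<bar> * \<bar>y - x\<bar>"
      unfolding eventually_at_filter
    proof (rule always_eventually, intro allI impI)
      fix y assume "y \<noteq> x"
      then have "norm ((f y - f x) / (y - x) - f' x) = \<bar>f y - f x - f' x * (y - x)\<bar> / \<bar>y - x\<bar>"
        by (simp add: field_simps flip: abs_divide)
      also have "\<dots> \<le> (\<bar>C\<bar> * (y - x)\<^sup>2) / \<bar>y - x\<bar>"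
      proof (rule divide_right_mono)
        have "C * (y - x)\<^sup>2 \<le> \<bar>C\<bar> * (y - x)\<^sup>2" by (intro mult_right_mono) auto
        then show "\<bar>f y - f x - f' x * (y - x)\<bar> \<le> \<bar>C\<bar> * (y - x)\<^sup>2" using assms[of y x] by linarith
      qed simp
      also have "\<dots> = \<bar>C\<bar> * \<bar>y - x\<bar>"
      proof -
        have "\<bar>C\<bar> * (d * d) / d = \<bar>C\<bar> * d" if "d \<noteq> 0" for d :: real using that by simp
        from this[of "\<bar>y - x\<bar>"] \<open>y \<noteq> x\<close> show ?thesis
          unfolding power2_abs[of "y - x", symmetric] power2_eq_square by simp
      qed
      finally show "norm ((f y - f x) / (y - x) - f' x) \<le> \<bar>C\<bar> * \<bar>y - x\<bar>" .
    qed
    have "((\<lambda>y. \<bar>C\<bar> * \<bar>y - x\<bar>) \<longlongrightarrow> \<bar>C\<bar> * \<bar>x - x\<bar>) (at x)" by (intro tendsto_intros)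
    then show "((\<lambda>y. \<bar>C\<bar> * \<bar>y - x\<bar>) \<longlongrightarrow> 0) (at x)" by simp
  qed
  then show ?thesis unfolding has_field_derivative_iff using LIM_zero_iff by blast
qed

text \<open>
  A \<open>C\<^sup>1\<close> function that rises from \<open>0\<close> at \<open>t\<close> to \<open>1\<close> at \<open>t + h + k\<close>. Its derivative is a trapezoid of
  height \<open>1/h\<close> with flanks of width \<open>k\<close>, so for \<open>k\<close> much smaller than \<open>h\<close> the slope is nearly the best
  possible.
\<close>

definition ramp :: "real \<Rightarrow> real \<Rightarrow> real \<Rightarrow> real \<Rightarrow> real" where
  "ramp t h k s = (pos_sq (s - t) - pos_sq (s - t - k) - pos_sq (s - t - h) + pos_sq (s - t - h - k)) / (k * h)"

definition ramp' :: "real \<Rightarrow> real \<Rightarrow> real \<Rightarrow> real \<Rightarrow> real" where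
  "ramp' t h k s = (max 0 (s - t) - max 0 (s - t - k) - max 0 (s - t - h) + max 0 (s - t - h - k)) / (k * h)"

context
  fixes h k :: real assumes hk: "0 < k" "k \<le> h"
begin

lemma ramp_taylor: "\<bar>ramp t h k y - ramp t h k x - ramp' t h k x * (y - x)\<bar> \<le> 4 / (k * h) * (y - x)\<^sup>2"
proof -
  have p: "k * h > 0" using hk by simp
  let ?R = "\<lambda>c. pos_sq (y - c) - pos_sq (x - c) - max 0 (x - c) * (y - x)"
  have b: "\<bar>?R c\<bar> \<le> (y - x)\<^sup>2" for c using pos_sq_taylor[of "y - c" "x - c"] by simp
  have "(ramp t h k y - ramp t h k x - ramp' t h k x * (y - x)) = 
      (?R t - ?R (t + k) - ?R (t + h) + ?R (t + h + k)) / (k * h)"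
    unfolding ramp_def ramp'_def diff_diff_eq by (simp add: diff_divide_distrib add_divide_distrib algebra_simps)
  then have "\<bar>ramp t h k y - ramp t h k x - ramp' t h k x * (y - x)\<bar> =
      \<bar>?R t - ?R (t + k) - ?R (t + h) + ?R (t + h + k)\<bar> / (k * h)" using p by simp
  also have "\<dots> \<le> (4 * (y - x)\<^sup>2) / (k * h)"
  proof (rule divide_right_mono)
    have tri: "\<bar>a - b - c + d\<bar> \<le> 4 * X" if "\<bar>a\<bar> \<le> X" "\<bar>b\<bar> \<le> X" "\<bar>c\<bar> \<le> X" "\<bar>d\<bar> \<le> X" for a b c d X :: real
      using that by linarith
    show "\<bar>?R t - ?R (t + k) - ?R (t + h) + ?R (t + h + k)\<bar> \<le> 4 * (y - x)\<^sup>2" by (intro tri b)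
  qed (use p in simp)
  finally show ?thesis by simp
qed

lemma ramp'_bounds: "0 \<le> ramp' t h k s" "ramp' t h k s \<le> 1 / h"
proof -
  let ?N = "max 0 (s - t) - max 0 (s - t - k) - max 0 (s - t - h) + max 0 (s - t - h - k)"
  have N: "0 \<le> ?N" "?N \<le> k" using hk by (auto simp: max_def)
  then show "0 \<le> ramp' t h k s" unfolding ramp'_def using hk by simp
  have "ramp' t h k s \<le> k / (k * h)" unfolding ramp'_def using N hk by (intro divide_right_mono) auto
  then show "ramp' t h k s \<le> 1 / h" using hk by simp
qed

lemma ramp'_support: "\<not> (t < s \<and> s \<le> t + h + k) \<Longrightarrow> ramp' t h k s = 0"
  unfolding ramp'_def using hk by (auto simp: max_def)

lemma ramp_left: "s \<le> t \<Longrightarrow> ramp t h k s = 0"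
  unfolding ramp_def pos_sq_def using hk by simp

lemma ramp_right: "t + h + k \<le> s \<Longrightarrow> ramp t h k s = 1"
proof -
  assume "t + h + k \<le> s"
  then have "ramp t h k s = ((s - t)\<^sup>2 / 2 - (s - t - k)\<^sup>2 / 2 - (s - t - h)\<^sup>2 / 2 + (s - t - h - k)\<^sup>2 / 2) / (k * h)"
    unfolding ramp_def pos_sq_def using hk by simp
  also have "\<dots> = (k * h) / (k * h)" by (rule arg_cong[where f="\<lambda>z. z / (k * h)"]) (simp add: power2_eq_square field_simps)
  finally show ?thesis using hk by simp
qed

lemma ramp_deriv: "(ramp t h k has_real_derivative ramp' t h k s) (at s)"
  by (rule taylor_imp_DERIV[OF ramp_taylor])

lemma ramp_range: "0 \<le> ramp t h k s" "ramp t h k s \<le> 1"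
proof -
  have mono: "ramp t h k x \<le> ramp t h k y" if "x \<le> y" for x y
    using DERIV_nonneg_imp_nondecreasing[OF that] ramp_deriv ramp'_bounds(1) by blast
  show "0 \<le> ramp t h k s" using mono[of "min s t" s] ramp_left[of "min s t" t] by simp
  show "ramp t h k s \<le> 1" using mono[of s "max s (t + h + k)"] ramp_right[of t "max s (t + h + k)"] by simp
qed

lemma ramp_continuous: "continuous_on UNIV (ramp t h k)" "continuous_on UNIV (ramp' t h k)"
proof -
  show "continuous_on UNIV (ramp t h k)"
    by (meson DERIV_continuous continuous_at_imp_continuous_on ramp_deriv)
  show "continuous_on UNIV (ramp' t h k)"
    unfolding ramp'_def using hk by (intro continuous_intros) auto
qed

end

lemma thin_level_strip:
  assumes fin: "finite_measure M" and [measurable]: "(\<phi> :: 'a \<Rightarrow> real) \<in> borel_measurable M" and "e > 0"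
  obtains d where "d > 0" "\<And>H. 0 < H \<Longrightarrow> H < d \<Longrightarrow> measure M {x \<in> space M. t < \<phi> x \<and> \<phi> x \<le> t + H} < e"
proof -
  interpret finite_measure M by fact
  define A where "A H = {x \<in> space M. t < \<phi> x \<and> \<phi> x \<le> t + H}" for H
  have [measurable]: "A H \<in> sets M" for H unfolding A_def by measurable
  have dec: "decseq (\<lambda>n. A (1 / real (Suc n)))"
    unfolding decseq_def
  proof (intro allI impI)
    fix m n :: nat assume "m \<le> n"
    then have "1 / real (Suc n) \<le> 1 / real (Suc m)" by (intro frac_le) auto
    then show "A (1 / real (Suc n)) \<subseteq> A (1 / real (Suc m))" unfolding A_def by auto
  qed
  have "(\<lambda>n. measure M (A (1 / real (Suc n)))) \<longlonglongrightarrow> measure M (\<Inter>n. A (1 / real (Suc n)))"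
    by (rule finite_Lim_measure_decseq[OF _ dec]) auto
  moreover have "(\<Inter>n. A (1 / real (Suc n))) = {}"
  proof (rule ccontr)
    assume "\<not> ?thesis"
    then obtain x where x: "\<And>n. x \<in> A (1 / real (Suc n))" by blast
    then have "\<phi> x - t > 0" unfolding A_def by simp
    then obtain n where "1 / real (Suc n) < \<phi> x - t" using nat_approx_posE by blast
    then show False using x[of n] unfolding A_def by simp
  qed
  ultimately have "(\<lambda>n. measure M (A (1 / real (Suc n)))) \<longlonglongrightarrow> 0" by simp
  then have "\<forall>\<^sub>F n in sequentially. measure M (A (1 / real (Suc n))) < e" using \<open>e > 0\<close> by (rule order_tendstoD)
  then obtain n where n: "measure M (A (1 / real (Suc n))) < e" by (auto simp: eventually_sequentially)
  show ?thesis
  proof (rule that[of "1 / real (Suc n)"])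
    fix H :: real assume H: "0 < H" "H < 1 / real (Suc n)"
    have "A H \<subseteq> A (1 / real (Suc n))" using H unfolding A_def by auto
    then have "measure M (A H) \<le> measure M (A (1 / real (Suc n)))" by (rule finite_measure_mono) auto
    then show "measure M {x \<in> space M. t < \<phi> x \<and> \<phi> x \<le> t + H} < e" using n unfolding A_def by simp
  qed simp
qed

text \<open>
  The chain rule turns the left side into minus the integral of \<open>(ramp' \<circ> \<phi>) (D\<phi> \<bullet> \<Phi>)\<close>, and \<open>ramp'\<close> lives on
  the strip.
\<close>

lemma ramp_divergence_bound:
  fixes \<phi> :: "'a::euclidean_space \<Rightarrow> real"
  assumes lip: "L-lipschitz_on \<Omega> \<phi>" and grad: "has_L2_gradient \<Omega> \<phi> G"
    and \<Omega>: "open \<Omega>" "bounded \<Omega>" and hk: "0 < k" "k \<le> h" and \<Phi>: "\<Phi> \<in> perimeter_fields \<Omega>"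
  shows "(LINT x|lebesgue_on \<Omega>. ramp t h k (\<phi> x) * divergence \<Phi> x)
     \<le> (1 / h) * (LINT x|lebesgue_on \<Omega>. indicator {x. t < \<phi> x \<and> \<phi> x \<le> t + h + k} x * norm (G x))"
proof -
  note fin = finite_measure_lebesgue_on_open[OF \<Omega>]
  have \<Phi>': "Ck 1 \<Phi>" "compactly_supported_in \<Omega> \<Phi>" "\<And>x. norm (\<Phi> x) \<le> 1"
    using \<Phi> by (auto simp: perimeter_fields_def)
  define \<psi> where "\<psi> b x = \<Phi> x \<bullet> b" for b x
  have \<psi>: "Ck 1 (\<psi> b)" "compactly_supported_in \<Omega> (\<psi> b)" for b
    unfolding \<psi>_def[abs_def] by (rule component_field[OF \<Phi>'(1,2)])+
  have \<psi>U: "compactly_supported_in UNIV (\<psi> b)" for b using \<psi>(2) compactly_supported_in_mono by blast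
  have [measurable]: "\<phi> \<in> borel_measurable (lebesgue_on \<Omega>)" "G \<in> borel_measurable (lebesgue_on \<Omega>)"
    using grad by (auto simp: has_L2_gradient_def L2_on_def)
  have [measurable]: "ramp t h k \<in> borel_measurable borel" "ramp' t h k \<in> borel_measurable borel"
    using ramp_continuous[OF hk] borel_measurable_continuous_onI by auto
  have [measurable]: "\<psi> b \<in> borel_measurable (lebesgue_on \<Omega>)" for b by (rule Ck_borel_lebesgue_on[OF \<psi>(1)])
  have iG: "integrable (lebesgue_on \<Omega>) (\<lambda>x. norm (G x))"
    using grad by (auto simp: has_L2_gradient_def intro!: L2_integrable[OF fin] L2_norm)
  have i1: "integrable (lebesgue_on \<Omega>) (\<lambda>x. ramp t h k (\<phi> x) * ddir b (\<psi> b) x)" for b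
  proof -
    have c: "continuous_on UNIV (ddir b (\<psi> b))" using \<psi>(1)[of b] by simp
    have "integrable (lebesgue_on \<Omega>) (ddir b (\<psi> b))"
      using lebesgue_on_integral_borel(2)[OF \<Omega>(1) borel_measurable_continuous_onI[OF c]]
        compactly_supported_outside[OF ddir_support[OF \<psi>(2)]] integrable_compact_support[OF c ddir_support[OF \<psi>U]] by blast
    then have "integrable (lebesgue_on \<Omega>) (\<lambda>x. ddir b (\<psi> b) x * ramp t h k (\<phi> x))"
      by (rule integrable_mult_bounded[of _ _ _ 1]) (use ramp_range[OF hk] in auto)
    then show ?thesis by (simp add: mult.commute)
  qed
  have i2: "integrable (lebesgue_on \<Omega>) (\<lambda>x. ramp' t h k (\<phi> x) * (G x \<bullet> b) * \<psi> b x)" if "b \<in> Basis" for b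
  proof -
    have "integrable (lebesgue_on \<Omega>) (\<lambda>x. G x \<bullet> b)"
      using grad that by (auto simp: has_L2_gradient_def intro!: L2_integrable[OF fin] L2_inner)
    then have "integrable (lebesgue_on \<Omega>) (\<lambda>x. (G x \<bullet> b) * (ramp' t h k (\<phi> x) * \<psi> b x))"
    proof (rule integrable_mult_bounded[of _ _ _ "1 / h"])
      fix x
      have "\<bar>\<psi> b x\<bar> \<le> 1" using Basis_le_norm[OF that, of "\<Phi> x"] \<Phi>'(3)[of x] unfolding \<psi>_def by linarith
      then have "\<bar>ramp' t h k (\<phi> x)\<bar> * \<bar>\<psi> b x\<bar> \<le> (1 / h) * 1"
        using ramp'_bounds[OF hk, of t "\<phi> x"] hk by (intro mult_mono) auto
      then show "\<bar>ramp' t h k (\<phi> x) * \<psi> b x\<bar> \<le> 1 / h" by (simp add: abs_mult)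
    qed simp
    then show ?thesis by (simp add: ac_simps)
  qed
  have inner: "(\<Sum>b\<in>Basis. ramp' t h k (\<phi> x) * (G x \<bullet> b) * \<psi> b x) = ramp' t h k (\<phi> x) * (G x \<bullet> \<Phi> x)" for x
    unfolding \<psi>_def euclidean_inner[of "G x" "\<Phi> x"] by (simp add: sum_distrib_left mult.assoc)
  have "(LINT x|lebesgue_on \<Omega>. ramp t h k (\<phi> x) * divergence \<Phi> x)
     = (LINT x|lebesgue_on \<Omega>. (\<Sum>b\<in>Basis. ramp t h k (\<phi> x) * ddir b (\<psi> b) x))"
    unfolding divergence_eq[OF \<Phi>'(1)] \<psi>_def by (simp add: sum_distrib_left)
  also have "\<dots> = (\<Sum>b\<in>Basis. LINT x|lebesgue_on \<Omega>. ramp t h k (\<phi> x) * ddir b (\<psi> b) x)"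
    by (rule Bochner_Integration.integral_sum) (rule i1)
  also have "\<dots> = (\<Sum>b\<in>Basis. - (LINT x|lebesgue_on \<Omega>. ramp' t h k (\<phi> x) * (G x \<bullet> b) * \<psi> b x))"
    by (rule sum.cong[OF refl])
       (rule lipschitz_chain_rule[OF lip grad \<Omega> \<psi> _ ramp_continuous[OF hk] ramp_taylor[OF hk]])
  also have "\<dots> = - (LINT x|lebesgue_on \<Omega>. (\<Sum>b\<in>Basis. ramp' t h k (\<phi> x) * (G x \<bullet> b) * \<psi> b x))"
    by (simp add: sum_negf Bochner_Integration.integral_sum[OF i2])
  also have "\<dots> = (LINT x|lebesgue_on \<Omega>. - (ramp' t h k (\<phi> x) * (G x \<bullet> \<Phi> x)))"
    unfolding inner by simp
  also have "\<dots> \<le> (LINT x|lebesgue_on \<Omega>. (1 / h) * (indicator {x. t < \<phi> x \<and> \<phi> x \<le> t + h + k} x * norm (G x)))"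
  proof (rule integral_mono)
    have "integrable (lebesgue_on \<Omega>) (\<lambda>x. (\<Sum>b\<in>Basis. ramp' t h k (\<phi> x) * (G x \<bullet> b) * \<psi> b x))"
      by (rule Bochner_Integration.integrable_sum) (rule i2)
    then show "integrable (lebesgue_on \<Omega>) (\<lambda>x. - (ramp' t h k (\<phi> x) * (G x \<bullet> \<Phi> x)))" unfolding inner by simp
    have "integrable (lebesgue_on \<Omega>) (\<lambda>x. norm (G x) * indicator {x. t < \<phi> x \<and> \<phi> x \<le> t + h + k} x)"
      by (rule integrable_mult_bounded[OF iG, of _ 1]) (auto simp: indicator_def)
    then show "integrable (lebesgue_on \<Omega>) (\<lambda>x. (1 / h) * (indicator {x. t < \<phi> x \<and> \<phi> x \<le> t + h + k} x * norm (G x)))"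
      by (simp add: mult.commute)
    fix x
    have g: "\<bar>G x \<bullet> \<Phi> x\<bar> \<le> norm (G x)"
      using Cauchy_Schwarz_ineq2[of "G x" "\<Phi> x"] mult_left_mono[OF \<Phi>'(3)[of x], of "norm (G x)"] by simp
    show "- (ramp' t h k (\<phi> x) * (G x \<bullet> \<Phi> x)) \<le> (1 / h) * (indicator {x. t < \<phi> x \<and> \<phi> x \<le> t + h + k} x * norm (G x))"
    proof (cases "t < \<phi> x \<and> \<phi> x \<le> t + h + k")
      case True
      have "- (ramp' t h k (\<phi> x) * (G x \<bullet> \<Phi> x)) \<le> \<bar>ramp' t h k (\<phi> x)\<bar> * \<bar>G x \<bullet> \<Phi> x\<bar>"
        unfolding abs_mult[symmetric] by linarith
      also have "\<dots> \<le> (1 / h) * norm (G x)"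
        using ramp'_bounds[OF hk, of t "\<phi> x"] hk g by (intro mult_mono) auto
      finally show ?thesis using True by simp
    next
      case False
      then show ?thesis using ramp'_support[OF hk, of t "\<phi> x"] by auto
    qed
  qed
  finally show ?thesis by simp
qed

text \<open>
  Lower semicontinuity of the perimeter, applied to ramps that tend to the indicator of a superlevel
  set. The strict inequality provides a vector field that nearly attains the perimeter, and the ramp
  differs from the indicator only on a strip of small measure. The estimate holds at every level \<open>t\<close>,
  with no exceptional null set.
\<close>

lemma perimeter_less_imp_gradient_mass:
  fixes \<phi> :: "'a::euclidean_space \<Rightarrow> real"
  assumes lip: "L-lipschitz_on \<Omega> \<phi>" and grad: "has_L2_gradient \<Omega> \<phi> G"
    and \<Omega>: "open \<Omega>" "bounded \<Omega>" and \<sigma>: "0 \<le> \<sigma>" "ennreal \<sigma> < perimeter \<Omega> {x \<in> \<Omega>. \<phi> x > t}"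
  shows "\<forall>\<^sub>F H in at_right 0. \<sigma> * H \<le> (LINT x|lebesgue_on \<Omega>. indicator {x. t < \<phi> x \<and> \<phi> x \<le> t + H} x * norm (G x))"
proof -
  let ?M = "lebesgue_on \<Omega>"
  note fin = finite_measure_lebesgue_on_open[OF \<Omega>]
  interpret finite_measure ?M by (rule fin)
  have m[measurable]: "\<phi> \<in> borel_measurable ?M" using grad by (auto simp: has_L2_gradient_def L2_on_def)
  define E where "E = {x \<in> \<Omega>. \<phi> x > t}"
  have "E = \<Omega> \<inter> \<phi> -` {t<..}" by (auto simp: E_def)
  then have oE: "open E"
    using continuous_open_preimage[OF lipschitz_on_continuous_on[OF lip] \<Omega>(1), of "{t<..}"] by simp
  obtain \<Phi> where \<Phi>: "\<Phi> \<in> perimeter_fields \<Omega>" "ennreal \<sigma> < ennreal (LINT x|lebesgue_on E. divergence \<Phi> x)"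
    using \<sigma>(2) unfolding perimeter_eq E_def[symmetric] less_SUP_iff by blast
  have \<Phi>': "Ck 1 \<Phi>" "compactly_supported_in \<Omega> \<Phi>" using \<Phi>(1) by (auto simp: perimeter_fields_def)
  define S where "S = (LINT x|?M. indicator E x * divergence \<Phi> x)"
  have "(LINT x|lebesgue_on E. divergence \<Phi> x) = S" unfolding S_def
    by (rule lebesgue_on_subset_integral) (use oE \<Omega>(1) in \<open>auto simp: E_def\<close>)
  with \<Phi>(2) \<sigma>(1) have S: "\<sigma> < S" by (simp add: ennreal_less_iff)
  (* the ramp of total width H has slope (1 + kappa) / H; the gap between sigma and S pays for kappa *)
  define \<kappa> where "\<kappa> = min 1 ((S - \<sigma>) / (2 * (\<sigma> + 1)))"
  have \<kappa>: "0 < \<kappa>" "\<kappa> \<le> 1" using S \<sigma>(1) by (auto simp: \<kappa>_def)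
  have "\<kappa> * \<sigma> \<le> (S - \<sigma>) / (2 * (\<sigma> + 1)) * \<sigma>" using \<sigma>(1) by (intro mult_right_mono) (auto simp: \<kappa>_def)
  also have "\<dots> = (S - \<sigma>) / 2 * (\<sigma> / (\<sigma> + 1))" using \<sigma>(1) by simp
  also have "\<dots> \<le> (S - \<sigma>) / 2 * 1" using S \<sigma>(1) by (intro mult_left_mono) auto
  finally have \<kappa>S: "(1 + \<kappa>) * \<sigma> < S" using S by (simp add: algebra_simps)
  have cd: "continuous_on UNIV (divergence \<Phi>)" by (rule continuous_divergence[OF \<Phi>'(1)])
  have csd: "compactly_supported_in UNIV (divergence \<Phi>)"
    using divergence_support[OF \<Phi>'(2)] compactly_supported_in_mono by blast
  obtain B where B: "B > 0" "\<And>x. norm (divergence \<Phi> x) \<le> B"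
    using bounded_compact_support[OF cd csd] by metis
  have [measurable]: "divergence \<Phi> \<in> borel_measurable ?M" 
    by (rule borel_lebesgue_on[OF borel_measurable_continuous_onI[OF cd]])
  have [measurable]: "E \<in> sets ?M" using oE by (simp add: sets_lebesgue_on_open_iff[OF \<Omega>(1)] E_def)
  have id: "integrable ?M (divergence \<Phi>)"
    by (rule integrable_const_bound[of _ B]) (use B in auto)
  have e0: "(S - (1 + \<kappa>) * \<sigma>) / B > 0" using B(1) \<kappa>S by simp
  obtain d where d: "d > 0" "\<And>H. 0 < H \<Longrightarrow> H < d \<Longrightarrow> measure ?M {x \<in> space ?M. t < \<phi> x \<and> \<phi> x \<le> t + H} < (S - (1 + \<kappa>) * \<sigma>) / B"
    using thin_level_strip[OF fin m e0] by blast
  show ?thesis unfolding eventually_at_right_field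
  proof (intro exI[of _ d] conjI allI impI d(1))
    fix H :: real assume H: "0 < H" "H < d"
    define h where "h = H / (1 + \<kappa>)"
    define k where "k = \<kappa> * h"
    have h: "h > 0" using H \<kappa> by (simp add: h_def)
    have hk: "0 < k" "k \<le> h" using h \<kappa> by (auto simp: k_def)
    have "t + h + k = t + (1 + \<kappa>) * h" by (simp add: k_def algebra_simps)
    then have hkH: "t + h + k = t + H" using \<kappa> by (simp add: h_def)
    have [measurable]: "ramp t h k \<in> borel_measurable borel"
      using ramp_continuous(1)[OF hk] borel_measurable_continuous_onI by auto
    define A where "A = {x \<in> space ?M. t < \<phi> x \<and> \<phi> x \<le> t + H}"
    have [measurable]: "A \<in> sets ?M" unfolding A_def by measurable
    have A\<Omega>: "A \<inter> \<Omega> = A" by (auto simp: A_def space_restrict_space)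
    have ir: "integrable ?M (\<lambda>x. ramp t h k (\<phi> x) * divergence \<Phi> x)"
      using integrable_mult_bounded[OF id, of "\<lambda>x. ramp t h k (\<phi> x)" 1] ramp_range[OF hk] by (simp add: mult.commute)
    have iE: "integrable ?M (\<lambda>x. indicator E x * divergence \<Phi> x)"
      using integrable_mult_indicator[OF _ id, of E] by simp
    have "S - (LINT x|?M. ramp t h k (\<phi> x) * divergence \<Phi> x) = (LINT x|?M. indicator E x * divergence \<Phi> x - ramp t h k (\<phi> x) * divergence \<Phi> x)"
      unfolding S_def using iE ir by simp
    also have "\<dots> \<le> (LINT x|?M. indicator A x * B)"
    proof (rule integral_mono)
      show "integrable ?M (\<lambda>x. indicator E x * divergence \<Phi> x - ramp t h k (\<phi> x) * divergence \<Phi> x)" using iE ir by simp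
      show "integrable ?M (\<lambda>x. indicator A x * B)" by (simp add: emeasure_eq_measure)
      fix x assume x: "x \<in> space ?M"
      show "indicator E x * divergence \<Phi> x - ramp t h k (\<phi> x) * divergence \<Phi> x \<le> indicator A x * B"
      proof (cases "x \<in> A")
        case True
        then have "x \<in> E" using x by (auto simp: A_def E_def space_restrict_space)
        have "(1 - ramp t h k (\<phi> x)) * divergence \<Phi> x \<le> 1 * B"
        proof -
          have "(1 - ramp t h k (\<phi> x)) * divergence \<Phi> x \<le> \<bar>1 - ramp t h k (\<phi> x)\<bar> * \<bar>divergence \<Phi> x\<bar>"
            unfolding abs_mult[symmetric] by simp
          also have "\<dots> \<le> 1 * B" using ramp_range[OF hk, of t "\<phi> x"] B(2)[of x] by (intro mult_mono) auto
          finally show ?thesis .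
        qed
        then show ?thesis using True \<open>x \<in> E\<close> by (simp add: algebra_simps)
      next
        case False
        then consider "\<phi> x \<le> t" | "\<phi> x > t + H" using x unfolding A_def by fastforce
        then show ?thesis
        proof cases
          case 1
          then show ?thesis using ramp_left[OF hk 1] False by (simp add: E_def)
        next
          case 2
          then have "x \<in> E" using x H by (auto simp: E_def space_restrict_space)
          then show ?thesis using ramp_right[OF hk, of t "\<phi> x"] 2 hkH False by simp
        qed
      qed
    qed
    also have "\<dots> = measure ?M A * B" by (simp add: A\<Omega>)
    also have "\<dots> < (S - (1 + \<kappa>) * \<sigma>) / B * B"
      using d(2)[OF H] B(1) unfolding A_def[symmetric] by (rule mult_strict_right_mono)
    also have "\<dots> = S - (1 + \<kappa>) * \<sigma>" using B(1) by simp
    finally have "(1 + \<kappa>) * \<sigma> \<le> (LINT x|?M. ramp t h k (\<phi> x) * divergence \<Phi> x)" by simp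
    also have "\<dots> \<le> (1 / h) * (LINT x|?M. indicator {x. t < \<phi> x \<and> \<phi> x \<le> t + H} x * norm (G x))"
      using ramp_divergence_bound[OF lip grad \<Omega> hk \<Phi>(1), of t] unfolding hkH .
    finally have "(1 + \<kappa>) * \<sigma> * h \<le> (LINT x|?M. indicator {x. t < \<phi> x \<and> \<phi> x \<le> t + H} x * norm (G x))"
      using h by (simp add: field_simps)
    moreover have "(1 + \<kappa>) * \<sigma> * h = \<sigma> * H" using \<kappa> by (simp add: h_def)
    ultimately show "\<sigma> * H \<le> (LINT x|?M. indicator {x. t < \<phi> x \<and> \<phi> x \<le> t + H} x * norm (G x))" by simp
  qed
qed

text \<open>
  Take the largest \<open>t\<close> up to which the claim holds; monotonicity makes the supremum a maximum, and the
  lower bound on the right derivative lets one go further unless \<open>t = b\<close>.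
\<close>

lemma dini_growth:
  fixes g :: "real \<Rightarrow> real"
  assumes "a \<le> b" "c \<ge> 0" and mono: "\<And>s t. a \<le> s \<Longrightarrow> s \<le> t \<Longrightarrow> g s \<le> g t"
    and D: "\<And>t. a \<le> t \<Longrightarrow> t < b \<Longrightarrow> \<forall>\<^sub>F h in at_right 0. c * h \<le> g (t + h) - g t"
  shows "c * (b - a) \<le> g b - g a"
proof -
  define S where "S = {t \<in> {a..b}. c * (t - a) \<le> g t - g a}"
  have aS: "a \<in> S" using assms(1) by (simp add: S_def)
  have bdd: "bdd_above S" by (rule bdd_aboveI[of _ b]) (auto simp: S_def)
  define T where "T = Sup S"
  have T: "a \<le> T" "T \<le> b"
  proof -
    show "a \<le> T" unfolding T_def by (rule cSup_upper[OF aS bdd])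
    have "S \<noteq> {}" using aS by blast
    then show "T \<le> b" unfolding T_def by (rule cSup_least) (simp add: S_def)
  qed
  have TS: "c * (T - a) \<le> g T - g a"
  proof (rule field_le_epsilon)
    fix e :: real assume "e > 0"
    have "T - e / (c + 1) < T" using \<open>e > 0\<close> assms(2) by simp
    then obtain t where t: "t \<in> S" "T - e / (c + 1) < t"
      unfolding T_def using less_cSup_iff[of S] aS bdd by blast
    have "t \<le> T" unfolding T_def using cSup_upper[OF t(1) bdd] .
    have "c * (T - t) \<le> c * (e / (c + 1))" using t(2) assms(2) by (intro mult_left_mono) auto
    also have "\<dots> \<le> e" using assms(2) \<open>e > 0\<close> by (simp add: field_simps)
    finally have "c * (T - a) \<le> c * (t - a) + e" by (simp add: algebra_simps)
    also have "\<dots> \<le> g t - g a + e" using t(1) by (simp add: S_def)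
    also have "\<dots> \<le> g T - g a + e" using mono[of t T] \<open>t \<le> T\<close> t(1) by (simp add: S_def)
    finally show "c * (T - a) \<le> g T - g a + e" .
  qed
  have "T = b"
  proof (rule ccontr)
    assume "T \<noteq> b"
    then have "T < b" using T by simp
    have "\<forall>\<^sub>F h in at_right 0. h < b - T \<and> (0::real) < h"
      unfolding eventually_at_right_field using \<open>T < b\<close> by (intro exI[of _ "b - T"]) auto
    with D[OF T(1) \<open>T < b\<close>] have "\<forall>\<^sub>F h in at_right 0. c * h \<le> g (T + h) - g T \<and> h < b - T \<and> 0 < h"
      by eventually_elim auto
    then obtain h where h: "c * h \<le> g (T + h) - g T" "h < b - T" "0 < h"
      using eventually_happens[of _ "at_right (0::real)"] by auto
    have "T + h \<in> S" using h T TS by (auto simp: S_def algebra_simps)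
    then have "T + h \<le> T" unfolding T_def using cSup_upper[OF _ bdd] by blast
    then show False using h by simp
  qed
  then show ?thesis using TS by simp
qed

lemma lipschitz_gradient_mass_strip:
  fixes \<phi> :: "'a::euclidean_space \<Rightarrow> real"
  assumes lip: "L-lipschitz_on \<Omega> \<phi>" and grad: "has_L2_gradient \<Omega> \<phi> G"
    and \<Omega>: "open \<Omega>" "bounded \<Omega>" and \<sigma>: "0 \<le> \<sigma>" and ab: "a \<le> b"
    and P: "\<And>t. a \<le> t \<Longrightarrow> t < b \<Longrightarrow> ennreal \<sigma> \<le> perimeter \<Omega> {x \<in> \<Omega>. \<phi> x > t}"
  shows "\<sigma> * (b - a) \<le> (LINT x|lebesgue_on \<Omega>. indicator {x. a < \<phi> x \<and> \<phi> x \<le> b} x * norm (G x))"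
proof -
  let ?M = "lebesgue_on \<Omega>"
  have m[measurable]: "\<phi> \<in> borel_measurable ?M" "G \<in> borel_measurable ?M"
    using grad by (auto simp: has_L2_gradient_def L2_on_def)
  have iG: "integrable ?M (\<lambda>x. norm (G x))"
    using grad by (auto simp: has_L2_gradient_def intro!: L2_integrable[OF finite_measure_lebesgue_on_open[OF \<Omega>]] L2_norm)
  define I where "I s t = (LINT x|?M. indicator {x. s < \<phi> x \<and> \<phi> x \<le> t} x * norm (G x))" for s t
  have iI: "integrable ?M (\<lambda>x. indicator {x. s < \<phi> x \<and> \<phi> x \<le> t} x * norm (G x))" for s t
  proof -
    have "integrable ?M (\<lambda>x. norm (G x) * indicator {x. s < \<phi> x \<and> \<phi> x \<le> t} x)"
      by (rule integrable_mult_bounded[OF iG, of _ 1]) (auto simp: indicator_def)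
    then show ?thesis by (simp add: mult.commute)
  qed
  have I0: "0 \<le> I s t" for s t unfolding I_def by (rule Bochner_Integration.integral_nonneg) simp
  have Iadd: "I a t - I a s = I s t" if "a \<le> s" "s \<le> t" for s t
  proof -
    have "I a t - I a s = (LINT x|?M. indicator {x. a < \<phi> x \<and> \<phi> x \<le> t} x * norm (G x) - indicator {x. a < \<phi> x \<and> \<phi> x \<le> s} x * norm (G x))"
      unfolding I_def using iI by simp
    also have "\<dots> = I s t" unfolding I_def
      by (rule Bochner_Integration.integral_cong) (use that in \<open>auto simp: indicator_def\<close>)
    finally show ?thesis .
  qed
  have "{x. a < \<phi> x \<and> \<phi> x \<le> a} = {}" by auto
  then have Iaa: "I a a = 0" unfolding I_def by simp
  have "\<sigma> * (b - a) \<le> I a b"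
  proof (rule field_le_mult_one_interval)
    fix z :: real assume z: "0 < z" "z < 1"
    have "(z * \<sigma>) * (b - a) \<le> I a b - I a a"
    proof (rule dini_growth[OF ab])
      show "0 \<le> z * \<sigma>" using z \<sigma> by simp
      show "I a s \<le> I a t" if "a \<le> s" "s \<le> t" for s t using Iadd[OF that] I0[of s t] by simp
      show "\<forall>\<^sub>F h in at_right 0. z * \<sigma> * h \<le> I a (t + h) - I a t" if t: "a \<le> t" "t < b" for t
      proof (cases "\<sigma> = 0")
        case True
        have "0 \<le> I a (t + h) - I a t" if "0 < h" for h using Iadd[of t "t + h"] I0 t that by simp
        then show ?thesis unfolding eventually_at_right_field using True by (intro exI[of _ 1]) auto
      next
        case False
        then have "z * \<sigma> < \<sigma>" using \<sigma> z by simp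
        then have "ennreal (z * \<sigma>) < ennreal \<sigma>" using z \<sigma> by (simp add: ennreal_less_iff)
        also note P[OF t]
        finally have "\<forall>\<^sub>F H in at_right 0. z * \<sigma> * H \<le> I t (t + H)"
          unfolding I_def using perimeter_less_imp_gradient_mass[OF lip grad \<Omega>] z \<sigma> by simp
        moreover have "\<forall>\<^sub>F H in at_right (0::real). 0 < H" by (simp add: eventually_at_right_less)
        ultimately show ?thesis
          by eventually_elim (use Iadd t in auto)
      qed
    qed
    then show "z * (\<sigma> * (b - a)) \<le> I a b" using Iaa by (simp add: mult.assoc)
  qed
  then show ?thesis unfolding I_def .
qed

section \<open>Gradient mass of strips for functions in the closure\<close>

lemma Cauchy_Schwarz_integral:
  fixes f g :: "'a \<Rightarrow> real"
  assumes [measurable]: "f \<in> borel_measurable M" "g \<in> borel_measurable M"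
    and i: "integrable M (\<lambda>x. (f x)\<^sup>2)" "integrable M (\<lambda>x. (g x)\<^sup>2)"
  shows "integrable M (\<lambda>x. f x * g x)"
    and "(LINT x|M. \<bar>f x * g x\<bar>)\<^sup>2 \<le> (LINT x|M. (f x)\<^sup>2) * (LINT x|M. (g x)\<^sup>2)"
proof -
  show int: "integrable M (\<lambda>x. f x * g x)"
  proof (rule Bochner_Integration.integrable_bound)
    show "integrable M (\<lambda>x. (f x)\<^sup>2 + (g x)\<^sup>2)" using i by simp
    show "AE x in M. norm (f x * g x) \<le> norm ((f x)\<^sup>2 + (g x)\<^sup>2)"
    proof (rule AE_I2)
      fix x
      have "0 \<le> (\<bar>f x\<bar> - \<bar>g x\<bar>)\<^sup>2" by simp
      then have "2 * (\<bar>f x\<bar> * \<bar>g x\<bar>) \<le> (f x)\<^sup>2 + (g x)\<^sup>2" by (simp add: power2_diff algebra_simps)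
      moreover have "0 \<le> \<bar>f x\<bar> * \<bar>g x\<bar>" by simp
      ultimately have "\<bar>f x\<bar> * \<bar>g x\<bar> \<le> (f x)\<^sup>2 + (g x)\<^sup>2" by linarith
      then show "norm (f x * g x) \<le> norm ((f x)\<^sup>2 + (g x)\<^sup>2)" by (simp add: abs_mult)
    qed
  qed simp
  have n: "(\<integral>\<^sup>+x. ennreal \<bar>f x\<bar> * ennreal \<bar>g x\<bar> \<partial>M) = ennreal (LINT x|M. \<bar>f x * g x\<bar>)"
    using nn_integral_eq_integral[OF integrable_abs[OF int]] by (simp add: abs_mult ennreal_mult)
  have sq: "(\<integral>\<^sup>+x. (ennreal \<bar>h x\<bar>)\<^sup>2 \<partial>M) = ennreal (LINT x|M. (h x)\<^sup>2)" if "integrable M (\<lambda>x. (h x)\<^sup>2)" for h :: "'a \<Rightarrow> real"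
    using nn_integral_eq_integral[OF that] by (simp add: ennreal_power)
  have nn: "0 \<le> (LINT x|M. (h x)\<^sup>2)" for h :: "'a \<Rightarrow> real" by simp
  have "(\<integral>\<^sup>+x. ennreal \<bar>f x\<bar> * ennreal \<bar>g x\<bar> \<partial>M)\<^sup>2 \<le>
      (\<integral>\<^sup>+x. (ennreal \<bar>f x\<bar>)\<^sup>2 \<partial>M) * (\<integral>\<^sup>+x. (ennreal \<bar>g x\<bar>)\<^sup>2 \<partial>M)"
    by (rule Cauchy_Schwarz_nn_integral) auto
  then have "ennreal ((LINT x|M. \<bar>f x * g x\<bar>)\<^sup>2) \<le> ennreal ((LINT x|M. (f x)\<^sup>2) * (LINT x|M. (g x)\<^sup>2))"
    unfolding n sq[OF i(1)] sq[OF i(2)] using nn by (simp add: ennreal_power ennreal_mult)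
  then show "(LINT x|M. \<bar>f x * g x\<bar>)\<^sup>2 \<le> (LINT x|M. (f x)\<^sup>2) * (LINT x|M. (g x)\<^sup>2)"
    using nn[of f] nn[of g] by (subst (asm) ennreal_le_iff) auto
qed

lemma L2_diff:
  fixes f g :: "'a::euclidean_space \<Rightarrow> 'b::euclidean_space"
  assumes "L2_on \<Omega> f" "L2_on \<Omega> g" shows "L2_on \<Omega> (\<lambda>x. f x - g x)"
  unfolding L2_on_def
proof
  show m: "(\<lambda>x. f x - g x) \<in> borel_measurable (lebesgue_on \<Omega>)" using assms by (auto simp: L2_on_def)
  show "integrable (lebesgue_on \<Omega>) (\<lambda>x. (norm (f x - g x))\<^sup>2)"
  proof (rule Bochner_Integration.integrable_bound)
    show "integrable (lebesgue_on \<Omega>) (\<lambda>x. 2 * (norm (f x))\<^sup>2 + 2 * (norm (g x))\<^sup>2)" using assms by (auto simp: L2_on_def)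
    show "AE x in lebesgue_on \<Omega>. norm ((norm (f x - g x))\<^sup>2) \<le> norm (2 * (norm (f x))\<^sup>2 + 2 * (norm (g x))\<^sup>2)"
    proof (rule AE_I2)
      fix x
      have "(norm (f x - g x))\<^sup>2 \<le> (norm (f x) + norm (g x))\<^sup>2" by (intro power_mono norm_triangle_ineq4) auto
      also have "\<dots> \<le> 2 * (norm (f x))\<^sup>2 + 2 * (norm (g x))\<^sup>2"
        using zero_le_power2[of "norm (f x) - norm (g x)"] by (simp add: power2_sum power2_diff)
      finally show "norm ((norm (f x - g x))\<^sup>2) \<le> norm (2 * (norm (f x))\<^sup>2 + 2 * (norm (g x))\<^sup>2)" by simp
    qed
  qed (use m in simp)
qed

lemma has_L2_gradient_diff:
  fixes u v :: "'a::euclidean_space \<Rightarrow> real"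
  assumes u: "has_L2_gradient \<Omega> u G" and v: "has_L2_gradient \<Omega> v H" and \<Omega>: "open \<Omega>" "bounded \<Omega>"
  shows "has_L2_gradient \<Omega> (\<lambda>x. u x - v x) (\<lambda>x. G x - H x)"
proof -
  note fin = finite_measure_lebesgue_on_open[OF \<Omega>]
  have main: "(LINT x|lebesgue_on \<Omega>. (u x - v x) * ddir b \<phi> x) = - (LINT x|lebesgue_on \<Omega>. ((G x - H x) \<bullet> b) * \<phi> x)"
    if \<phi>: "\<phi> \<in> Cc_infinity \<Omega>" and b: "b \<in> Basis" for \<phi> b
  proof -
    have iu: "integrable (lebesgue_on \<Omega>) u" "integrable (lebesgue_on \<Omega>) v"
      "integrable (lebesgue_on \<Omega>) (\<lambda>x. G x \<bullet> b)" "integrable (lebesgue_on \<Omega>) (\<lambda>x. H x \<bullet> b)"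
      using u v b by (auto simp: has_L2_gradient_def intro!: L2_integrable[OF fin] L2_inner)
    have c: "continuous_on UNIV (ddir b \<phi>)" "continuous_on UNIV \<phi>"
      using Cc_infinityD(1)[OF \<phi>, of 1] Cc_infinity_continuous[OF \<phi>] by auto
    note s = Cc_infinityD(2)[OF \<phi>] ddir_support[OF Cc_infinityD(2)[OF \<phi>], of b]
    have i: "integrable (lebesgue_on \<Omega>) (\<lambda>x. u x * ddir b \<phi> x)" "integrable (lebesgue_on \<Omega>) (\<lambda>x. v x * ddir b \<phi> x)"
      "integrable (lebesgue_on \<Omega>) (\<lambda>x. (G x \<bullet> b) * \<phi> x)" "integrable (lebesgue_on \<Omega>) (\<lambda>x. (H x \<bullet> b) * \<phi> x)"
      by (intro integrable_mult_continuous_cs iu c s)+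
    show ?thesis
      using has_L2_gradientD[OF u \<phi> b] has_L2_gradientD[OF v \<phi> b] i
      by (simp add: left_diff_distrib inner_diff_left)
  qed
  have L: "L2_on \<Omega> u" "L2_on \<Omega> v" "L2_on \<Omega> G" "L2_on \<Omega> H" using u v unfolding has_L2_gradient_def by auto
  show ?thesis unfolding has_L2_gradient_def by (intro conjI ballI L2_diff L main)
qed

lemma weak_grad: "u \<in> H12 \<Omega> \<Longrightarrow> has_L2_gradient \<Omega> u (weak_grad \<Omega> u)"
  unfolding H12_def weak_grad_def using someI_ex[of "has_L2_gradient \<Omega> u"] by blast

lemma measure_lebesgue_on_open:
  assumes "open \<Omega>" "A \<subseteq> \<Omega>" shows "measure (lebesgue_on \<Omega>) A = measure lebesgue A"
  by (rule measure_restrict_space) (use assms in auto)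

lemma L1_le_L2:
  fixes h :: "'a::euclidean_space \<Rightarrow> real"
  assumes \<Omega>: "open \<Omega>" "bounded \<Omega>" and h: "L2_on \<Omega> h" and A: "A \<in> sets (lebesgue_on \<Omega>)"
  shows "(LINT x|lebesgue_on \<Omega>. indicator A x * \<bar>h x\<bar>)\<^sup>2 \<le> measure lebesgue A * (LINT x|lebesgue_on \<Omega>. indicator A x * (h x)\<^sup>2)"
    and "(LINT x|lebesgue_on \<Omega>. indicator A x * (h x)\<^sup>2) \<le> (LINT x|lebesgue_on \<Omega>. (h x)\<^sup>2)"
proof -
  let ?M = "lebesgue_on \<Omega>"
  interpret finite_measure ?M by (rule finite_measure_lebesgue_on_open[OF \<Omega>])
  note A[measurable]
  have A\<Omega>: "A \<subseteq> \<Omega>" "A \<inter> \<Omega> = A" using A sets_lebesgue_on_open_iff[OF \<Omega>(1)] by auto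
  have [measurable]: "h \<in> borel_measurable ?M" and i: "integrable ?M (\<lambda>x. (h x)\<^sup>2)" using h by (auto simp: L2_on_def)
  have iA: "integrable ?M (\<lambda>x. (indicator A x * h x)\<^sup>2)"
  proof -
    have "integrable ?M (\<lambda>x. (h x)\<^sup>2 * indicator A x)"
      by (rule integrable_mult_bounded[OF i, of _ 1]) (auto simp: indicator_def)
    moreover have "(\<lambda>x. (h x)\<^sup>2 * indicator A x) = (\<lambda>x. (indicator A x * h x)\<^sup>2)"
      by (auto simp: indicator_def)
    ultimately show ?thesis by simp
  qed
  have i1: "integrable ?M (\<lambda>x. (indicator A x :: real)\<^sup>2)"
  proof -
    have "(\<lambda>x. (indicator A x :: real)\<^sup>2) = indicator A" by (auto simp: indicator_def)
    then show ?thesis by (simp add: emeasure_eq_measure)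
  qed
  have e1: "(LINT x|?M. (indicator A x :: real)\<^sup>2) = measure lebesgue A"
  proof -
    have "(\<lambda>x. (indicator A x :: real)\<^sup>2) = indicator A" by (auto simp: indicator_def)
    then show ?thesis using measure_lebesgue_on_open[OF \<Omega>(1) A\<Omega>(1)] by (simp add: A\<Omega>)
  qed
  have e2: "\<bar>indicator A x * (indicator A x * h x)\<bar> = indicator A x * \<bar>h x\<bar>" 
    "(indicator A x * h x)\<^sup>2 = indicator A x * (h x)\<^sup>2" for x by (auto simp: indicator_def)
  show "(LINT x|?M. indicator A x * \<bar>h x\<bar>)\<^sup>2 \<le> measure lebesgue A * (LINT x|?M. indicator A x * (h x)\<^sup>2)"
    using Cauchy_Schwarz_integral(2)[OF _ _ i1 iA] unfolding e1 e2 by simp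
  show "(LINT x|?M. indicator A x * (h x)\<^sup>2) \<le> (LINT x|?M. (h x)\<^sup>2)"
    using iA i unfolding e2 by (intro integral_mono) (auto simp: indicator_def)
qed

lemma ennreal_divide_le:
  assumes "ennreal x \<le> ennreal K * P" "K > 0" "x \<ge> 0" shows "ennreal (x / K) \<le> P"
proof (cases P)
  case (real p)
  then have "x \<le> K * p" using assms by (simp add: ennreal_mult[symmetric])
  then have "x / K \<le> p" using assms(2) by (simp add: field_simps)
  then show ?thesis using real by (simp add: ennreal_leI)
qed simp

text \<open>
  Approximate \<open>u\<close> by a Lipschitz function \<open>\<phi>\<close> that vanishes near \<open>F\<close>. Off the set \<open>A\<close> where \<open>|u - \<phi>| \<ge> \<tau>\<close>
  the strip \<open>{a + \<tau> < \<phi> \<le> b - 2 \<tau>}\<close> lies in \<open>{a < u < b}\<close>; by Chebyshev's inequality \<open>A\<close> is small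
  compared with the excess of \<open>|{u > b - \<tau>}|\<close> over \<open>s\<close>, so the superlevel sets of \<open>\<phi>\<close> still have measure
  at least \<open>s\<close>. The gradients enter only through integrals of their norms, which converge.
\<close>

lemma closure_gradient_mass_strip:
  fixes \<Omega> :: "'a::euclidean_space set" and u :: "'a \<Rightarrow> real"
  assumes \<Omega>: "open \<Omega>" "bounded \<Omega>" and u: "u \<in> H12_closure \<Omega> (Lip_vanishing_near \<Omega> F)"
    and K: "K > 0" and \<alpha>: "\<alpha> \<ge> 0"
    and iso: "\<And>\<phi> t. \<phi> \<in> Lip_vanishing_near \<Omega> F \<Longrightarrow> 0 \<le> t \<Longrightarrow>
          ennreal (measure lebesgue {x \<in> \<Omega>. \<phi> x > t} powr \<alpha>) \<le> ennreal K * perimeter \<Omega> {x \<in> \<Omega>. \<phi> x > t}"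
    and ab: "0 \<le> a" "a < b" and s: "0 \<le> s" "\<And>t. a < t \<Longrightarrow> t < b \<Longrightarrow> s < measure lebesgue {x \<in> \<Omega>. u x > t}"
  shows "(b - a) * s powr \<alpha> \<le> K * (LINT x|lebesgue_on \<Omega>. indicator {x. a < u x \<and> u x < b} x * norm (weak_grad \<Omega> u x))"
proof -
  let ?M = "lebesgue_on \<Omega>"
  interpret finite_measure ?M by (rule finite_measure_lebesgue_on_open[OF \<Omega>])
  define G where "G = weak_grad \<Omega> u"
  have uH: "u \<in> H12 \<Omega>" using u by (simp add: H12_closure_def)
  have G: "has_L2_gradient \<Omega> u G" unfolding G_def by (rule weak_grad[OF uH])
  have [measurable]: "u \<in> borel_measurable ?M" "G \<in> borel_measurable ?M" and LG: "L2_on \<Omega> (\<lambda>x. norm (G x))"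
    using G by (auto simp: has_L2_gradient_def L2_on_def)
  have iG: "integrable ?M (\<lambda>x. norm (G x))" by (rule L2_integrable[OF finite_measure_axioms LG])
  define I where "I = (LINT x|?M. indicator {x. a < u x \<and> u x < b} x * norm (G x))"
  have int_ind: "integrable ?M (\<lambda>x. indicator A x * norm (V x))" 
    if "integrable ?M (\<lambda>x. norm (V x))" "(indicator A :: 'a \<Rightarrow> real) \<in> borel_measurable ?M" for A and V :: "'a \<Rightarrow> 'a"
    using integrable_mult_bounded[OF that(1), of "indicator A" 1] that(2) by (simp add: mult.commute indicator_def)
  have I: "I \<ge> 0" unfolding I_def by (rule Bochner_Integration.integral_nonneg) simp
  define N where "N = sqrt (LINT x|?M. (norm (G x))\<^sup>2)"
  define m where "m = measure lebesgue \<Omega>"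
  define \<sigma> where "\<sigma> = s powr \<alpha> / K"
  have \<sigma>: "\<sigma> \<ge> 0" using K by (simp add: \<sigma>_def)
  have main: "\<sigma> * (b - a - 3 * \<tau>) \<le> I" if \<tau>: "0 < \<tau>" "3 * \<tau> < b - a" for \<tau>
  proof -
    define \<gamma> where "\<gamma> = measure lebesgue {x \<in> \<Omega>. u x > b - \<tau>} - s"
    have \<gamma>: "\<gamma> > 0" using s(2)[of "b - \<tau>"] \<tau> by (simp add: \<gamma>_def)
    have step: "\<sigma> * (b - a - 3 * \<tau>) \<le> I + e * (N / \<tau> + sqrt m)" if e: "e > 0" "e\<^sup>2 / \<tau>\<^sup>2 \<le> \<gamma>" for e
    proof -
      obtain \<phi> where \<phi>: "\<phi> \<in> Lip_vanishing_near \<Omega> F" "\<phi> \<in> H12 \<Omega>" "H12_norm \<Omega> (\<lambda>x. u x - \<phi> x) < e"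
        using u e(1) unfolding H12_closure_def by blast
      obtain L where lip: "L-lipschitz_on \<Omega> \<phi>" using \<phi>(1) unfolding Lip_vanishing_near_def by blast
      define w where "w x = u x - \<phi> x" for x
      have "w \<in> H12 \<Omega>" 
        using has_L2_gradient_diff[OF G weak_grad[OF \<phi>(2)] \<Omega>] unfolding H12_def w_def by blast
      (* G - D serves as weak gradient of phi, so its distance from G is exactly the quantity that the norm makes small *)
      define D where "D = weak_grad \<Omega> w"
      have D: "has_L2_gradient \<Omega> w D" unfolding D_def by (rule weak_grad[OF \<open>w \<in> H12 \<Omega>\<close>])
      have GD: "has_L2_gradient \<Omega> \<phi> (\<lambda>x. G x - D x)"
        using has_L2_gradient_diff[OF G D \<Omega>] by (simp add: w_def)
      have [measurable]: "\<phi> \<in> borel_measurable ?M" "w \<in> borel_measurable ?M" "D \<in> borel_measurable ?M"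
        and LD: "L2_on \<Omega> (\<lambda>x. norm (D x))" and Lw: "L2_on \<Omega> w"
        using D GD by (auto simp: has_L2_gradient_def L2_on_def)
      have iD: "integrable ?M (\<lambda>x. norm (D x))" by (rule L2_integrable[OF finite_measure_axioms LD])
      have iw: "integrable ?M (\<lambda>x. (w x)\<^sup>2)" using Lw by (simp add: L2_on_def)
      have nn: "0 \<le> (LINT x|?M. (w x)\<^sup>2)" "0 \<le> (LINT x|?M. (norm (D x))\<^sup>2)" by simp_all
      have "sqrt ((LINT x|?M. (w x)\<^sup>2) + (LINT x|?M. (norm (D x))\<^sup>2)) < e"
        using \<phi>(3) unfolding H12_norm_def D_def w_def[abs_def] .
      then have "(LINT x|?M. (w x)\<^sup>2) + (LINT x|?M. (norm (D x))\<^sup>2) < e\<^sup>2"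
        using e(1) real_sqrt_less_iff[of _ "e\<^sup>2"] by simp
      then have we: "(LINT x|?M. (w x)\<^sup>2) \<le> e\<^sup>2" and De: "(LINT x|?M. (norm (D x))\<^sup>2) \<le> e\<^sup>2" using nn by linarith+
      define A where "A = {x \<in> \<Omega>. \<tau> \<le> \<bar>w x\<bar>}"
      have As[measurable]: "A \<in> sets ?M"
      proof -
        have "{x \<in> space ?M. \<tau> \<le> \<bar>w x\<bar>} \<in> sets ?M" by measurable
        then show ?thesis by (simp add: A_def space_restrict_space)
      qed
      have A\<Omega>: "A \<subseteq> \<Omega>" "A \<inter> \<Omega> = A" by (auto simp: A_def)
      have Ae: "measure lebesgue A \<le> e\<^sup>2 / \<tau>\<^sup>2"
      proof -
        have "measure lebesgue A * \<tau>\<^sup>2 = (LINT x|?M. indicator A x * \<tau>\<^sup>2)"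
          using measure_lebesgue_on_open[OF \<Omega>(1) A\<Omega>(1)] by (simp add: A\<Omega>)
        also have "\<dots> \<le> (LINT x|?M. (w x)\<^sup>2)"
        proof (rule integral_mono[OF _ iw])
          show "integrable ?M (\<lambda>x. indicator A x * \<tau>\<^sup>2)" by (simp add: emeasure_eq_measure)
          show "indicator A x * \<tau>\<^sup>2 \<le> (w x)\<^sup>2" for x
            using abs_le_square_iff[of \<tau> "w x"] \<tau>(1) by (auto simp: indicator_def A_def)
        qed
        finally have "measure lebesgue A * \<tau>\<^sup>2 \<le> e\<^sup>2" using we by linarith
        then show ?thesis using \<tau>(1) by (simp add: field_simps)
      qed
      have P: "ennreal \<sigma> \<le> perimeter \<Omega> {x \<in> \<Omega>. \<phi> x > t}" if t: "a + \<tau> \<le> t" "t < b - 2 * \<tau>" for t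
      proof -
        have ms: "{x \<in> \<Omega>. u x > b - \<tau>} \<in> sets ?M" "{x \<in> \<Omega>. \<phi> x > t} \<in> sets ?M"
        proof -
          have "{x \<in> space ?M. u x > b - \<tau>} \<in> sets ?M" "{x \<in> space ?M. \<phi> x > t} \<in> sets ?M" by measurable
          then show "{x \<in> \<Omega>. u x > b - \<tau>} \<in> sets ?M" "{x \<in> \<Omega>. \<phi> x > t} \<in> sets ?M"
            by (simp_all add: space_restrict_space)
        qed
        have "{x \<in> \<Omega>. u x > b - \<tau>} \<subseteq> {x \<in> \<Omega>. \<phi> x > t} \<union> A"
          using t by (auto simp: A_def w_def)
        then have "measure ?M {x \<in> \<Omega>. u x > b - \<tau>} \<le> measure ?M ({x \<in> \<Omega>. \<phi> x > t} \<union> A)"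
          by (rule finite_measure_mono) (use ms in auto)
        also have "\<dots> \<le> measure ?M {x \<in> \<Omega>. \<phi> x > t} + measure ?M A"
          by (rule measure_Un_le) (use ms in auto)
        finally have "measure lebesgue {x \<in> \<Omega>. u x > b - \<tau>} \<le> measure lebesgue {x \<in> \<Omega>. \<phi> x > t} + measure lebesgue A"
          using measure_lebesgue_on_open[OF \<Omega>(1)] A\<Omega>(1) by simp
        then have "s \<le> measure lebesgue {x \<in> \<Omega>. \<phi> x > t}" using Ae e(2) unfolding \<gamma>_def by linarith
        then have "s powr \<alpha> \<le> measure lebesgue {x \<in> \<Omega>. \<phi> x > t} powr \<alpha>" using s(1) \<alpha> by (intro powr_mono2)
        then have "ennreal (s powr \<alpha>) \<le> ennreal K * perimeter \<Omega> {x \<in> \<Omega>. \<phi> x > t}"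
          by (rule order_trans[OF ennreal_leI iso[OF \<phi>(1)]]) (use ab \<tau> t in auto)
        then show ?thesis unfolding \<sigma>_def by (rule ennreal_divide_le[OF _ K]) simp
      qed
      have iGD: "integrable ?M (\<lambda>x. norm (G x - D x))"
        using L2_integrable[OF finite_measure_axioms L2_norm] GD by (auto simp: has_L2_gradient_def)
      have "\<sigma> * ((b - 2 * \<tau>) - (a + \<tau>)) \<le>
          (LINT x|?M. indicator {x. a + \<tau> < \<phi> x \<and> \<phi> x \<le> b - 2 * \<tau>} x * norm (G x - D x))"
        by (rule lipschitz_gradient_mass_strip[OF lip GD \<Omega> \<sigma> _ P]) (use \<tau> in auto)
      also have "\<dots> \<le> (LINT x|?M. indicator {x. a < u x \<and> u x < b} x * norm (G x) + indicator A x * norm (G x) + norm (D x))"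
      proof (rule integral_mono)
        show "integrable ?M (\<lambda>x. indicator {x. a + \<tau> < \<phi> x \<and> \<phi> x \<le> b - 2 * \<tau>} x * norm (G x - D x))"
          by (rule int_ind[OF iGD]) measurable
        show "integrable ?M (\<lambda>x. indicator {x. a < u x \<and> u x < b} x * norm (G x) + indicator A x * norm (G x) + norm (D x))"
          by (intro Bochner_Integration.integrable_add int_ind iG iD) measurable
        fix x assume "x \<in> space ?M"
        then have x: "x \<in> \<Omega>" by (simp add: space_restrict_space)
        show "indicator {x. a + \<tau> < \<phi> x \<and> \<phi> x \<le> b - 2 * \<tau>} x * norm (G x - D x)
           \<le> indicator {x. a < u x \<and> u x < b} x * norm (G x) + indicator A x * norm (G x) + norm (D x)"
        proof (cases "a + \<tau> < \<phi> x \<and> \<phi> x \<le> b - 2 * \<tau>")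
          case True
          have "norm (G x - D x) \<le> norm (G x) + norm (D x)" by (rule norm_triangle_ineq4)
          moreover have "(a < u x \<and> u x < b) \<or> x \<in> A"
            using True x \<tau>(1) unfolding A_def w_def by auto
          ultimately show ?thesis using True norm_ge_zero[of "G x"] by (auto simp: indicator_def simp del: norm_ge_zero)
        next
          case False
          then show ?thesis by simp
        qed
      qed
      also have "\<dots> = I + (LINT x|?M. indicator A x * norm (G x)) + (LINT x|?M. norm (D x))"
      proof -
        have "integrable ?M (\<lambda>x. indicator {x. a < u x \<and> u x < b} x * norm (G x))" "integrable ?M (\<lambda>x. indicator A x * norm (G x))"
          by (intro int_ind iG; measurable)+
        then show ?thesis using iD by (simp add: I_def)
      qed
      also have "(LINT x|?M. indicator A x * norm (G x)) \<le> e * (N / \<tau>)"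
      proof (rule power2_le_imp_le)
        have "(LINT x|?M. indicator A x * norm (G x))\<^sup>2 \<le> measure lebesgue A * (LINT x|?M. indicator A x * (norm (G x))\<^sup>2)"
          using L1_le_L2(1)[OF \<Omega> LG As] by simp
        also have "\<dots> \<le> e\<^sup>2 / \<tau>\<^sup>2 * N\<^sup>2"
          using L1_le_L2(2)[OF \<Omega> LG As] Ae unfolding N_def
          by (intro mult_mono) (auto intro!: Bochner_Integration.integral_nonneg)
        also have "\<dots> = (e * (N / \<tau>))\<^sup>2" by (simp add: power_mult_distrib power_divide)
        finally show "(LINT x|?M. indicator A x * norm (G x))\<^sup>2 \<le> (e * (N / \<tau>))\<^sup>2" .
        show "0 \<le> e * (N / \<tau>)" using e(1) \<tau>(1) by (simp add: N_def)
      qed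
      also have "(LINT x|?M. norm (D x)) \<le> e * sqrt m"
      proof (rule power2_le_imp_le)
        have \<Omega>s: "\<Omega> \<in> sets ?M" using \<Omega>(1) by (simp add: sets_lebesgue_on_open_iff)
        have eq: "(LINT x|?M. indicator \<Omega> x * h x) = (LINT x|?M. h x)" for h :: "'a \<Rightarrow> real"
          by (rule Bochner_Integration.integral_cong) (auto simp: space_restrict_space)
        have "(LINT x|?M. norm (D x))\<^sup>2 \<le> m * (LINT x|?M. (norm (D x))\<^sup>2)"
          using L1_le_L2(1)[OF \<Omega> LD \<Omega>s] unfolding eq m_def by simp
        also have "\<dots> \<le> m * e\<^sup>2" using De by (intro mult_left_mono) (auto simp: m_def)
        also have "\<dots> = (e * sqrt m)\<^sup>2" by (simp add: power_mult_distrib m_def)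
        finally show "(LINT x|?M. norm (D x))\<^sup>2 \<le> (e * sqrt m)\<^sup>2" .
        show "0 \<le> e * sqrt m" using e(1) by (simp add: m_def)
      qed
      finally show ?thesis by (simp add: algebra_simps)
    qed
    define c where "c = N / \<tau> + sqrt m"
    have c: "c \<ge> 0" using \<tau>(1) by (simp add: c_def N_def m_def)
    show ?thesis
    proof (rule field_le_epsilon)
      fix \<eta> :: real assume "\<eta> > 0"
      define e where "e = min (\<tau> * sqrt \<gamma>) (\<eta> / (c + 1))"
      have e: "e > 0" using \<tau> \<gamma> \<open>\<eta> > 0\<close> c by (simp add: e_def)
      have "e\<^sup>2 \<le> (\<tau> * sqrt \<gamma>)\<^sup>2" using e by (intro power_mono) (auto simp: e_def)
      then have "e\<^sup>2 / \<tau>\<^sup>2 \<le> \<gamma>" using \<gamma> \<tau>(1) by (simp add: power_mult_distrib field_simps)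
      then have "\<sigma> * (b - a - 3 * \<tau>) \<le> I + e * c" using step[OF e] by (simp add: c_def)
      also have "e * c \<le> \<eta> / (c + 1) * c" using c by (intro mult_right_mono) (auto simp: e_def)
      also have "\<dots> \<le> \<eta>" using c \<open>\<eta> > 0\<close> by (simp add: field_simps)
      finally show "\<sigma> * (b - a - 3 * \<tau>) \<le> I + \<eta>" by simp
    qed
  qed
  have "\<sigma> * (b - a) \<le> I"
  proof (rule field_le_epsilon)
    fix \<eta> :: real assume "\<eta> > 0"
    define \<tau> where "\<tau> = min ((b - a) / 4) (\<eta> / (3 * (\<sigma> + 1)))"
    have "\<tau> \<le> (b - a) / 4" unfolding \<tau>_def by (rule min.cobounded1)
    then have "3 * \<tau> \<le> (b - a) * (3 / 4)" by simp
    also have "\<dots> < (b - a) * 1" using ab by (intro mult_strict_left_mono) auto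
    finally have \<tau>2: "3 * \<tau> < b - a" by simp
    have \<tau>1: "0 < \<tau>" using ab \<open>\<eta> > 0\<close> \<sigma> by (simp add: \<tau>_def)
    have "\<tau> \<le> \<eta> / (3 * (\<sigma> + 1))" unfolding \<tau>_def by (rule min.cobounded2)
    then have "\<sigma> * (3 * \<tau>) \<le> \<sigma> * (3 * (\<eta> / (3 * (\<sigma> + 1))))" using \<sigma> by (intro mult_left_mono) auto
    also have "\<dots> \<le> \<eta>" using \<sigma> \<open>\<eta> > 0\<close> by (simp add: field_simps)
    finally show "\<sigma> * (b - a) \<le> I + \<eta>" using main[OF \<tau>1 \<tau>2] by (simp add: right_diff_distrib)
  qed
  then have "K * (\<sigma> * (b - a)) \<le> K * I" using K by (intro mult_left_mono) auto
  then show ?thesis using K unfolding \<sigma>_def I_def G_def by (simp add: mult.commute)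
qed

section \<open>The truncated rearrangement as a function of one variable\<close>

lemma superlevel_measure_right_continuous:
  assumes "finite_measure M" and [measurable]: "(u :: 'a \<Rightarrow> real) \<in> borel_measurable M"
    and lt: "s < measure M {x \<in> space M. u x > t}"
  obtains t' where "t < t'" "s < measure M {x \<in> space M. u x > t'}"
proof -
  interpret finite_measure M by fact
  define A where "A n = {x \<in> space M. u x > t + 1 / real (Suc n)}" for n
  have inc: "incseq A" unfolding incseq_def
  proof (intro allI impI)
    fix m n :: nat assume "m \<le> n"
    then have "1 / real (Suc n) \<le> 1 / real (Suc m)" by (intro frac_le) auto
    then show "A m \<subseteq> A n" unfolding A_def by auto
  qed
  have "(\<Union>n. A n) = {x \<in> space M. u x > t}"
  proof (intro equalityI subsetI)
    fix x assume x: "x \<in> {x \<in> space M. u x > t}"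
    then obtain n where "1 / real (Suc n) < u x - t" using nat_approx_posE[of "u x - t"] by auto
    then show "x \<in> (\<Union>n. A n)" using x unfolding A_def by (auto intro!: exI[of _ n])
  next
    fix x assume "x \<in> (\<Union>n. A n)"
    then obtain n where n: "x \<in> A n" by blast
    have "0 < 1 / real (Suc n)" by simp
    moreover have "t + 1 / real (Suc n) < u x" "x \<in> space M" using n unfolding A_def by blast+
    ultimately show "x \<in> {x \<in> space M. u x > t}" by (intro CollectI conjI) linarith+
  qed
  moreover have "(\<lambda>n. measure M (A n)) \<longlonglongrightarrow> measure M (\<Union>n. A n)"
    by (rule finite_Lim_measure_incseq[OF _ inc]) (auto simp: A_def)
  ultimately have "\<forall>\<^sub>F n in sequentially. s < measure M (A n)" using lt order_tendstoD(1) by fastforce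
  then obtain n where "s < measure M (A n)" by (auto simp: eventually_sequentially)
  then show ?thesis using that[of "t + 1 / real (Suc n)"] by (simp add: A_def)
qed

lemma superlevel_measure_small:
  assumes "finite_measure M" and [measurable]: "(u :: 'a \<Rightarrow> real) \<in> borel_measurable M" and "0 < s"
  obtains t where "measure M {x \<in> space M. u x > t} < s"
proof -
  interpret finite_measure M by fact
  define A where "A n = {x \<in> space M. u x > real n}" for n
  have "(\<lambda>n. measure M (A n)) \<longlonglongrightarrow> measure M (\<Inter>n. A n)"
    by (rule finite_Lim_measure_decseq) (auto simp: A_def decseq_def)
  moreover have "(\<Inter>n. A n) = {}"
  proof (rule ccontr)
    assume "\<not> ?thesis"
    then obtain x where x: "\<And>n. x \<in> A n" by blast
    obtain n where "u x < real n" using reals_Archimedean2 by blast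
    then show False using x[of n] by (simp add: A_def)
  qed
  ultimately have "(\<lambda>n. measure M (A n)) \<longlonglongrightarrow> 0" by simp
  then have "\<forall>\<^sub>F n in sequentially. measure M (A n) < s" using assms(3) by (rule order_tendstoD)
  then obtain n where "measure M (A n) < s" by (auto simp: eventually_sequentially)
  then show ?thesis using that[of "real n"] by (simp add: A_def)
qed

text \<open>
  All that the one-dimensional argument needs to know about \<open>u\<close>. The function \<open>g\<close> stands for \<open>|Du|\<^sup>2\<close>.
\<close>

locale strip_energy = finite_measure M for M :: "'a measure" +
  fixes u g :: "'a \<Rightarrow> real" and K \<alpha> :: real
  assumes u_meas[measurable]: "u \<in> borel_measurable M"
    and g_int: "integrable M g" and g_nonneg: "\<And>x. 0 \<le> g x"
    and K_pos: "0 < K" and \<alpha>_nonneg: "0 \<le> \<alpha>"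
    and energy: "\<And>a b s. 0 \<le> a \<Longrightarrow> a < b \<Longrightarrow> 0 \<le> s \<Longrightarrow>
       (\<And>t. a < t \<Longrightarrow> t < b \<Longrightarrow> s < measure M {x \<in> space M. u x > t}) \<Longrightarrow>
       ((b - a) * s powr \<alpha>)\<^sup>2 \<le> K\<^sup>2 * measure M {x \<in> space M. a < u x \<and> u x < b} *
          (LINT x|M. indicator {x. a < u x \<and> u x < b} x * g x)"
begin

definition \<mu> :: "real \<Rightarrow> real" where "\<mu> t = measure M {x \<in> space M. u x > t}"

definition total :: real where "total = measure M (space M)"

definition E :: real where "E = (LINT x|M. g x)"

text \<open>
  The rearrangement truncated below at \<open>d\<close> and above at \<open>N\<close>. Adjoining \<open>N\<close> to the set makes the
  infimum meaningful for every \<open>s\<close>, also where the untruncated rearrangement is infinite.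
\<close>

definition trunc_level :: "real \<Rightarrow> real \<Rightarrow> real \<Rightarrow> real" where
  "trunc_level d N s = Inf ({t. d \<le> t \<and> t < N \<and> \<mu> t \<le> s} \<union> {N})"

lemma g_meas[measurable]: "g \<in> borel_measurable M"
  using g_int by auto

lemma E_nonneg: "0 \<le> E"
  unfolding E_def using g_nonneg by simp

lemma \<mu>_antimono: "s \<le> t \<Longrightarrow> \<mu> t \<le> \<mu> s"
  unfolding \<mu>_def by (rule finite_measure_mono) auto

lemma \<mu>_right_continuous:
  assumes "s < \<mu> t" obtains t' where "t < t'" "s < \<mu> t'"
  using superlevel_measure_right_continuous[OF finite_measure_axioms u_meas] assms unfolding \<mu>_def by blast

context
  fixes d N :: real assumes dN: "0 < d" "d < N"
begin

lemma trunc_level_bdd: "bdd_below ({t. d \<le> t \<and> t < N \<and> \<mu> t \<le> s} \<union> {N})"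
  by (rule bdd_belowI[of _ d]) (use dN in auto)

lemma trunc_level_range: "d \<le> trunc_level d N s" "trunc_level d N s \<le> N"
proof -
  show "d \<le> trunc_level d N s" unfolding trunc_level_def by (rule cInf_greatest) (use dN in auto)
  show "trunc_level d N s \<le> N" unfolding trunc_level_def by (rule cInf_lower[OF _ trunc_level_bdd]) simp
qed

lemma less_trunc_level_iff:
  assumes t: "d \<le> t" "t < N" shows "t < trunc_level d N s \<longleftrightarrow> s < \<mu> t"
proof
  assume lt: "t < trunc_level d N s"
  show "s < \<mu> t"
  proof (rule ccontr)
    assume "\<not> s < \<mu> t"
    then have "trunc_level d N s \<le> t" unfolding trunc_level_def
      by (intro cInf_lower[OF _ trunc_level_bdd]) (use t in auto)
    then show False using lt by simp
  qed
next
  assume "s < \<mu> t"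
  then obtain t' where t': "t < t'" "s < \<mu> t'" by (rule \<mu>_right_continuous)
  have "min t' N \<le> trunc_level d N s" unfolding trunc_level_def
  proof (rule cInf_greatest)
    fix r assume r: "r \<in> {t. d \<le> t \<and> t < N \<and> \<mu> t \<le> s} \<union> {N}"
    show "min t' N \<le> r"
    proof (cases "r = N")
      case False
      then have "\<mu> r \<le> s" using r by simp
      then have "t' \<le> r" using t'(2) \<mu>_antimono[of r t'] by (cases "r \<le> t'") auto
      then show ?thesis by simp
    qed simp
  qed simp
  then show "t < trunc_level d N s" using t t' by simp
qed

lemma trunc_level_antimono: "s \<le> s' \<Longrightarrow> trunc_level d N s' \<le> trunc_level d N s"
  unfolding trunc_level_def by (rule cInf_superset_mono[OF _ trunc_level_bdd]) auto

lemma trunc_level_meas[measurable]: "trunc_level d N \<in> borel_measurable borel"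
proof -
  have "mono (\<lambda>s. - trunc_level d N s)" by (rule monoI) (simp add: trunc_level_antimono)
  then have "(\<lambda>s. - trunc_level d N s) \<in> borel_measurable borel" by (rule borel_measurable_mono)
  then have "(\<lambda>s. - (- trunc_level d N s)) \<in> borel_measurable borel" by (rule borel_measurable_uminus)
  then show ?thesis by simp
qed

text \<open>
  The upper level \<open>b\<close> is exceeded or attained on a set of measure at least \<open>s\<close>, the lower level is
  exceeded on a set of measure at most \<open>s + h\<close>.
\<close>

lemma trunc_level_strip_measure:
  assumes "0 \<le> s" "0 < h" and lt: "trunc_level d N (s + h) < trunc_level d N s"
  shows "measure M {x \<in> space M. trunc_level d N (s + h) < u x \<and> u x < trunc_level d N s} \<le> h"
proof -
  let ?a = "trunc_level d N (s + h)" and ?b = "trunc_level d N s"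
  have a: "d \<le> ?a" "?a < N" using trunc_level_range[of "s + h"] trunc_level_range[of s] lt by auto
  have \<mu>a: "\<mu> ?a \<le> s + h" using less_trunc_level_iff[OF a, of "s + h"] by simp
  define B where "B n = {x \<in> space M. u x > ?b - (?b - ?a) / real (Suc n)}" for n
  have p: "0 < ?b - ?a" using lt by simp
  have dec: "decseq B" unfolding decseq_def
  proof (intro allI impI)
    fix m n :: nat assume "m \<le> n"
    then have "(?b - ?a) / real (Suc n) \<le> (?b - ?a) / real (Suc m)" using p by (intro frac_le) auto
    then show "B n \<subseteq> B m" unfolding B_def by auto
  qed
  have "s \<le> measure M (B n)" for n
  proof -
    let ?t = "?b - (?b - ?a) / real (Suc n)"
    have "(?b - ?a) / real (Suc n) \<le> (?b - ?a) / 1" using p by (intro frac_le) auto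
    then have "d \<le> ?t" using a by simp
    moreover have "?t < ?b" using p by simp
    moreover have "?t < N" using \<open>?t < ?b\<close> trunc_level_range(2)[of s] by linarith
    ultimately have "s < \<mu> ?t" using less_trunc_level_iff[of ?t s] by blast
    then show ?thesis by (simp add: B_def \<mu>_def)
  qed
  moreover have "(\<lambda>n. measure M (B n)) \<longlonglongrightarrow> measure M (\<Inter>n. B n)"
    by (rule finite_Lim_measure_decseq[OF _ dec]) (auto simp: B_def)
  ultimately have sI: "s \<le> measure M (\<Inter>n. B n)" by (intro LIMSEQ_le_const) auto
  have Ib: "(\<Inter>n. B n) \<subseteq> {x \<in> space M. ?b \<le> u x}"
  proof
    fix x assume x: "x \<in> (\<Inter>n. B n)"
    have "?b \<le> u x"
    proof (rule ccontr)
      assume "\<not> ?thesis"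
      then have "0 < (?b - u x) / (?b - ?a)" using p by simp
      then obtain n where "1 / real (Suc n) < (?b - u x) / (?b - ?a)" by (rule nat_approx_posE)
      then have "(?b - ?a) / real (Suc n) < ?b - u x" using p by (simp add: field_simps)
      moreover have "?b - (?b - ?a) / real (Suc n) < u x" using x unfolding B_def by blast
      ultimately show False by linarith
    qed
    moreover have "x \<in> space M" using x unfolding B_def by blast
    ultimately show "x \<in> {x \<in> space M. ?b \<le> u x}" by simp
  qed
  have "s \<le> measure M {x \<in> space M. ?b \<le> u x}"
    using sI finite_measure_mono[OF Ib] by simp
  moreover have "measure M ({x \<in> space M. ?a < u x \<and> u x < ?b} \<union> {x \<in> space M. ?b \<le> u x})
      = measure M {x \<in> space M. ?a < u x \<and> u x < ?b} + measure M {x \<in> space M. ?b \<le> u x}"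
    by (rule finite_measure_Union) auto
  moreover have "{x \<in> space M. ?a < u x \<and> u x < ?b} \<union> {x \<in> space M. ?b \<le> u x} = {x \<in> space M. u x > ?a}"
    using lt by auto
  ultimately show ?thesis using \<mu>a unfolding \<mu>_def by simp
qed

lemma trunc_level_energy:
  assumes "0 \<le> s" "0 < h"
  shows "((trunc_level d N s - trunc_level d N (s + h)) * s powr \<alpha>)\<^sup>2 \<le> K\<^sup>2 * h *
     (LINT x|M. indicator {x. trunc_level d N (s + h) < u x \<and> u x < trunc_level d N s} x * g x)"
proof -
  let ?a = "trunc_level d N (s + h)" and ?b = "trunc_level d N s"
  let ?I = "LINT x|M. indicator {x. ?a < u x \<and> u x < ?b} x * g x"
  have I: "0 \<le> ?I" using g_nonneg by (intro Bochner_Integration.integral_nonneg) auto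
  have "?a \<le> ?b" using assms by (intro trunc_level_antimono) auto
  show ?thesis
  proof (cases "?a = ?b")
    case True
    then show ?thesis using I assms by simp
  next
    case False
    then have lt: "?a < ?b" using \<open>?a \<le> ?b\<close> by simp
    have "((?b - ?a) * s powr \<alpha>)\<^sup>2 \<le> K\<^sup>2 * measure M {x \<in> space M. ?a < u x \<and> u x < ?b} * ?I"
    proof (rule energy[OF _ lt assms(1)])
      show "0 \<le> ?a" using trunc_level_range(1)[of "s + h"] dN by simp
      fix t assume t: "?a < t" "t < ?b"
      then have "d \<le> t" "t < N" using trunc_level_range(1)[of "s + h"] trunc_level_range(2)[of s] by auto
      then show "s < measure M {x \<in> space M. u x > t}"
        using less_trunc_level_iff t(2) unfolding \<mu>_def by blast
    qed
    also have "\<dots> \<le> K\<^sup>2 * h * ?I"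
      using trunc_level_strip_measure[OF assms lt] I by (intro mult_right_mono mult_left_mono) auto
    finally show ?thesis .
  qed
qed

lemma strip_integral_le_E: "(LINT x|M. indicator {x. a < u x \<and> u x < b} x * g x) \<le> E"
proof -
  have "integrable M (\<lambda>x. g x * indicator {x. a < u x \<and> u x < b} x)"
    by (rule integrable_mult_bounded[OF g_int, of _ 1]) (auto simp: indicator_def)
  then show ?thesis unfolding E_def using g_nonneg
    by (intro integral_mono g_int) (auto simp: indicator_def mult.commute)
qed

text \<open>
  If \<open>s < \<mu>(d)\<close>, then the strip from \<open>0\<close> to \<open>d\<close> has measure at most \<open>total - s\<close>, yet the energy inequality
  bounds its measure from below. So this cannot happen for \<open>s\<close> close to \<open>total\<close>.
\<close>

lemma trunc_level_vanishes:
  assumes V: "0 < total"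
  obtains \<eta> where "0 < \<eta>" "\<eta> < total" "\<And>s. total - \<eta> \<le> s \<Longrightarrow> trunc_level d N s = d"
proof -
  (* for s at least total / 2 the energy inequality forces total - s to be at least q; the summand 1 avoids division by 0 *)
  define q where "q = (d * (total / 2) powr \<alpha>)\<^sup>2 / (K\<^sup>2 * E + 1)"
  have KE: "0 \<le> K\<^sup>2 * E" using E_nonneg by simp
  have q: "0 < q" unfolding q_def using dN V KE by simp
  define \<eta> where "\<eta> = min (total / 2) (q / 2)"
  have \<eta>: "0 < \<eta>" "\<eta> \<le> total / 2" "\<eta> < q" using q V by (auto simp: \<eta>_def)
  show ?thesis
  proof (rule that[of \<eta>])
    show "0 < \<eta>" "\<eta> < total" using \<eta> V by auto
    fix s assume s: "total - \<eta> \<le> s"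
    show "trunc_level d N s = d"
    proof (rule ccontr)
      assume "\<not> ?thesis"
      then have "d < trunc_level d N s" using trunc_level_range(1)[of s] by simp
      then have sd: "s < \<mu> d" using less_trunc_level_iff[of d s] dN by simp
      have s2: "total / 2 \<le> s" using s \<eta> by simp
      have "(total / 2) powr \<alpha> \<le> s powr \<alpha>" using V s2 \<alpha>_nonneg by (intro powr_mono2) auto
      then have "(d * (total / 2) powr \<alpha>)\<^sup>2 \<le> ((d - 0) * s powr \<alpha>)\<^sup>2"
        using dN by (intro power_mono) (auto intro: mult_left_mono)
      also have "\<dots> \<le> K\<^sup>2 * measure M {x \<in> space M. 0 < u x \<and> u x < d} * (LINT x|M. indicator {x. 0 < u x \<and> u x < d} x * g x)"
      proof (rule energy)
        show "s < measure M {x \<in> space M. u x > t}" if "0 < t" "t < d" for t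
          using sd \<mu>_antimono[of t d] that unfolding \<mu>_def by linarith
      qed (use dN V s2 in auto)
      also have "\<dots> \<le> K\<^sup>2 * (total - s) * E"
      proof (intro mult_mono strip_integral_le_E mult_left_mono)
        have "measure M ({x \<in> space M. 0 < u x \<and> u x < d} \<union> {x \<in> space M. u x > d})
            = measure M {x \<in> space M. 0 < u x \<and> u x < d} + measure M {x \<in> space M. u x > d}"
          by (rule finite_measure_Union) auto
        moreover have "measure M ({x \<in> space M. 0 < u x \<and> u x < d} \<union> {x \<in> space M. u x > d}) \<le> total"
          unfolding total_def by (rule finite_measure_mono) auto
        ultimately show m: "measure M {x \<in> space M. 0 < u x \<and> u x < d} \<le> total - s"
          using sd unfolding \<mu>_def by linarith
        have "0 \<le> total - s" using order_trans[OF measure_nonneg m] .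
        then show "0 \<le> K\<^sup>2 * (total - s)" by simp
        show "0 \<le> (LINT x|M. indicator {x. 0 < u x \<and> u x < d} x * g x)"
          using g_nonneg by (intro Bochner_Integration.integral_nonneg) auto
      qed simp_all
      also have "\<dots> = (K\<^sup>2 * E) * (total - s)" by simp
      also have "\<dots> \<le> (K\<^sup>2 * E) * \<eta>" using s KE by (intro mult_left_mono) auto
      also have "\<dots> \<le> (K\<^sup>2 * E + 1) * \<eta>" using \<eta> by simp
      also have "\<dots> < (K\<^sup>2 * E + 1) * q" using \<eta> KE by (intro mult_strict_left_mono) auto
      also have "\<dots> = (d * (total / 2) powr \<alpha>)\<^sup>2" unfolding q_def using KE by simp
      finally show False by simp
    qed
  qed
qed

text \<open>
  Shifted down to vanish near the right end and continued by a constant to the left of \<open>0\<close>: then it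
  is continuous on the whole line, so its moving averages are \<open>C\<^sup>1\<close> up to the centre of the ball.
\<close>

definition profile :: "real \<Rightarrow> real" where
  "profile s = trunc_level d N (max 0 s) - d"

lemma profile_antimono: "s \<le> s' \<Longrightarrow> profile s' \<le> profile s"
  by (simp add: profile_def trunc_level_antimono)

text \<open>
  To the right of \<open>0\<close> the energy inequality gives a Hoelder modulus with exponent \<open>1/2\<close>. At \<open>0\<close> the
  weight \<open>s\<^sup>\<alpha>\<close> degenerates, and right continuity comes from that of the rearrangement instead.
\<close>

lemma continuous_profile: "isCont profile s0"
proof -
  have "\<exists>\<delta>>0. \<forall>s. \<bar>s - s0\<bar> < \<delta> \<longrightarrow> \<bar>profile s - profile s0\<bar> < e" if e: "e > 0" for e
  proof -
    consider "s0 < 0" | "s0 = 0" | "s0 > 0" by linarith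
    then show ?thesis
    proof cases
      case 1
      show ?thesis
        by (rule exI[of _ "- s0"]) (use 1 e in \<open>auto simp: profile_def max_def\<close>)
    next
      case 2
      show ?thesis
      proof (cases "trunc_level d N 0 = d")
        case True
        have eq: "profile s = profile s0" for s
        proof -
          have "trunc_level d N (max 0 s) \<le> d" using trunc_level_antimono[of 0 "max 0 s"] True by simp
          then show ?thesis using trunc_level_range(1)[of "max 0 s"] True 2 by (simp add: profile_def)
        qed
        have "\<bar>profile s - profile s0\<bar> < e" for s unfolding eq[of s] using e by simp
        then show ?thesis by (intro exI[of _ 1]) auto
      next
        case False
        then have lt: "d < trunc_level d N 0" using trunc_level_range(1)[of 0] by simp
        define t where "t = max d (trunc_level d N 0 - e / 2)"
        have t: "d \<le> t" "t < trunc_level d N 0" "trunc_level d N 0 - e < t" using lt e by (auto simp: t_def)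
        have tN: "t < N" using t(2) trunc_level_range(2)[of 0] by linarith
        have \<mu>t: "0 < \<mu> t" using less_trunc_level_iff[OF t(1) tN] t(2) by blast
        have "\<bar>profile s - profile s0\<bar> < e" if "\<bar>s - s0\<bar> < \<mu> t" for s
        proof -
          have "max 0 s < \<mu> t" using that 2 \<mu>t by auto
          then have "t < trunc_level d N (max 0 s)" using less_trunc_level_iff[OF t(1) tN] by blast
          moreover have "trunc_level d N (max 0 s) \<le> trunc_level d N 0" by (rule trunc_level_antimono) simp
          ultimately show ?thesis using t(3) 2 by (auto simp: profile_def)
        qed
        then show ?thesis using \<mu>t by blast
      qed
    next
      case 3
      define c where "c = (s0 / 2) powr \<alpha>"
      have c: "c > 0" using 3 by (simp add: c_def)
      have est: "((profile s - profile s') * c)\<^sup>2 \<le> K\<^sup>2 * E * (s' - s)" if "s0 / 2 \<le> s" "s < s'" for s s'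
      proof -
        have ss: "0 \<le> s" "0 < s' - s" using that 3 by auto
        have "profile s - profile s' = trunc_level d N s - trunc_level d N (s + (s' - s))"
          using ss that by (simp add: profile_def max_def)
        then have "((profile s - profile s') * c)\<^sup>2 \<le> ((trunc_level d N s - trunc_level d N (s + (s' - s))) * s powr \<alpha>)\<^sup>2"
          unfolding c_def using that 3 \<alpha>_nonneg profile_antimono[of s s']
          by (intro power_mono mult_mono powr_mono2) auto
        also have "\<dots> \<le> K\<^sup>2 * (s' - s) * (LINT x|M. indicator {x. trunc_level d N (s + (s' - s)) < u x \<and> u x < trunc_level d N s} x * g x)"
          by (rule trunc_level_energy[OF ss])
        also have "\<dots> \<le> K\<^sup>2 * (s' - s) * E" using ss by (intro mult_left_mono strip_integral_le_E) auto
        finally show ?thesis by (simp add: algebra_simps)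
      qed
      define \<delta> where "\<delta> = min (s0 / 2) ((e * c)\<^sup>2 / (K\<^sup>2 * E + 1))"
      have KE: "0 < K\<^sup>2 * E + 1" using E_nonneg by (simp add: add_nonneg_pos)
      have \<delta>: "\<delta> > 0" unfolding \<delta>_def using 3 e c KE by simp
      have "\<bar>profile s - profile s0\<bar> < e" if s: "\<bar>s - s0\<bar> < \<delta>" for s
      proof -
        have s2: "s0 / 2 \<le> s" using s unfolding \<delta>_def by linarith
        have "((profile s - profile s0) * c)\<^sup>2 \<le> K\<^sup>2 * E * \<bar>s - s0\<bar>"
        proof -
          consider "s < s0" | "s = s0" | "s0 < s" by linarith
          then show ?thesis
          proof cases
            case 1
            then show ?thesis using est[OF s2 1] by simp
          next
            case 2 then show ?thesis by simp
          next
            case 3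
            then show ?thesis using est[of s0 s] \<open>s0 > 0\<close> by (simp add: power_mult_distrib power2_commute)
          qed
        qed
        also have "\<dots> \<le> (K\<^sup>2 * E + 1) * \<bar>s - s0\<bar>" by (simp add: distrib_right)
        also have "\<dots> < (K\<^sup>2 * E + 1) * \<delta>" using s KE by (intro mult_strict_left_mono) auto
        also have "\<dots> \<le> (K\<^sup>2 * E + 1) * ((e * c)\<^sup>2 / (K\<^sup>2 * E + 1))" using KE by (intro mult_left_mono) (auto simp: \<delta>_def)
        also have "\<dots> = (e * c)\<^sup>2" using KE by simp
        finally have "\<bar>(profile s - profile s0) * c\<bar> < \<bar>e * c\<bar>"
          using abs_le_square_iff[of "e * c" "(profile s - profile s0) * c"] by linarith
        then show ?thesis using c e by (simp add: abs_mult)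
      qed
      then show ?thesis using \<delta> by blast
    qed
  qed
  then show ?thesis unfolding isCont_def LIM_eq by (metis real_norm_def)
qed

text \<open>
  Two parameters \<open>s\<close> whose strips both contain \<open>y\<close> differ by less than \<open>h\<close>, because the upper level at
  the larger one is at most the lower level at the smaller one as soon as they differ by \<open>h\<close>.
\<close>

lemma emeasure_crossing_le:
  assumes "0 < h"
  shows "emeasure lborel {s. trunc_level d N (s + h) < y \<and> y < trunc_level d N s} \<le> ennreal h"
proof -
  let ?S = "{s. trunc_level d N (s + h) < y \<and> y < trunc_level d N s}"
  show ?thesis
  proof (cases "?S = {}")
    case False
    have close: "s < s' + h" if "s \<in> ?S" "s' \<in> ?S" for s s'
    proof (rule ccontr)
      assume "\<not> s < s' + h"
      then have "trunc_level d N s \<le> trunc_level d N (s' + h)" by (intro trunc_level_antimono) simp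
      then show False using that by simp
    qed
    obtain z where z: "z \<in> ?S" using False by blast
    have bdd: "bdd_below ?S" by (rule bdd_belowI[of _ "z - h"]) (use close[OF z] in force)
    have "?S \<subseteq> {Inf ?S .. Inf ?S + h}"
    proof
      fix s assume s: "s \<in> ?S"
      have "s - h \<le> Inf ?S" using False by (intro cInf_greatest) (use close[OF s] in force)+
      moreover have "Inf ?S \<le> s" by (rule cInf_lower[OF s bdd])
      ultimately show "s \<in> {Inf ?S .. Inf ?S + h}" by simp
    qed
    then have "emeasure lborel ?S \<le> emeasure lborel {Inf ?S .. Inf ?S + h}" by (rule emeasure_mono) simp
    then show ?thesis using assms by simp
  next
    case True
    show ?thesis unfolding True by simp
  qed
qed

lemma difference_quotient_energy:
  assumes h: "0 < h"
  shows "(\<integral>\<^sup>+s. indicator {0<..} s * ennreal (((profile (s + h) - profile s) / h * s powr \<alpha>)\<^sup>2) \<partial>lborel) \<le> ennreal (K\<^sup>2 * E)"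
proof -
  interpret P: pair_sigma_finite lborel M ..
  let ?X = "\<lambda>s x. indicator {x. trunc_level d N (s + h) < u x \<and> u x < trunc_level d N s} x * ennreal (g x)"
  have pt: "indicator {0<..} s * ennreal (((profile (s + h) - profile s) / h * s powr \<alpha>)\<^sup>2)
      \<le> ennreal (K\<^sup>2 / h) * (\<integral>\<^sup>+x. ?X s x \<partial>M)" for s
  proof (cases "0 < s")
    case True
    let ?I = "LINT x|M. indicator {x. trunc_level d N (s + h) < u x \<and> u x < trunc_level d N s} x * g x"
    have "integrable M (\<lambda>x. g x * indicator {x. trunc_level d N (s + h) < u x \<and> u x < trunc_level d N s} x)"
      by (rule integrable_mult_bounded[OF g_int, of _ 1]) (auto simp: indicator_def)
    then have i: "integrable M (\<lambda>x. indicator {x. trunc_level d N (s + h) < u x \<and> u x < trunc_level d N s} x * g x)"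
      by (simp add: mult.commute)
    have X: "(\<integral>\<^sup>+x. ?X s x \<partial>M) = ennreal ?I"
    proof -
      have "(\<integral>\<^sup>+x. ?X s x \<partial>M) = (\<integral>\<^sup>+x. ennreal (indicator {x. trunc_level d N (s + h) < u x \<and> u x < trunc_level d N s} x * g x) \<partial>M)"
        by (rule nn_integral_cong) (auto simp: indicator_def)
      also have "\<dots> = ennreal ?I" by (rule nn_integral_eq_integral[OF i]) (use g_nonneg in auto)
      finally show ?thesis .
    qed
    have "((profile (s + h) - profile s) / h * s powr \<alpha>)\<^sup>2 = ((trunc_level d N s - trunc_level d N (s + h)) * s powr \<alpha>)\<^sup>2 / h\<^sup>2"
      using True h by (simp add: profile_def max_def power_mult_distrib power_divide power2_commute)
    also have "\<dots> \<le> (K\<^sup>2 * h * ?I) / h\<^sup>2"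
      using trunc_level_energy[of s h] True h by (intro divide_right_mono) auto
    also have "\<dots> = K\<^sup>2 / h * ?I" using h by (simp add: power2_eq_square)
    finally have "ennreal (((profile (s + h) - profile s) / h * s powr \<alpha>)\<^sup>2) \<le> ennreal (K\<^sup>2 / h * ?I)" by (rule ennreal_leI)
    also have "\<dots> = ennreal (K\<^sup>2 / h) * ennreal ?I" using h g_nonneg
      by (intro ennreal_mult Bochner_Integration.integral_nonneg) auto
    finally show ?thesis using True unfolding X by simp
  qed simp
  have m: "(\<lambda>(s, x). ?X s x) \<in> borel_measurable (lborel \<Otimes>\<^sub>M M)"
  proof -
    have "(\<lambda>(s, x). ?X s x) = (\<lambda>p. (if trunc_level d N (fst p + h) < u (snd p) \<and> u (snd p) < trunc_level d N (fst p) then ennreal (g (snd p)) else 0))"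
      by (auto simp: indicator_def fun_eq_iff)
    also have "\<dots> \<in> borel_measurable (lborel \<Otimes>\<^sub>M M)" by measurable
    finally show ?thesis .
  qed
  have "(\<integral>\<^sup>+s. indicator {0<..} s * ennreal (((profile (s + h) - profile s) / h * s powr \<alpha>)\<^sup>2) \<partial>lborel)
      \<le> (\<integral>\<^sup>+s. ennreal (K\<^sup>2 / h) * (\<integral>\<^sup>+x. ?X s x \<partial>M) \<partial>lborel)"
    by (rule nn_integral_mono) (rule pt)
  also have "\<dots> = ennreal (K\<^sup>2 / h) * (\<integral>\<^sup>+s. (\<integral>\<^sup>+x. ?X s x \<partial>M) \<partial>lborel)"
    by (rule nn_integral_cmult) (rule borel_measurable_nn_integral[OF m])
  also have "(\<integral>\<^sup>+s. (\<integral>\<^sup>+x. ?X s x \<partial>M) \<partial>lborel) = (\<integral>\<^sup>+x. (\<integral>\<^sup>+s. ?X s x \<partial>lborel) \<partial>M)"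
    by (rule P.Fubini'[OF m, symmetric])
  also have "\<dots> \<le> (\<integral>\<^sup>+x. ennreal h * ennreal (g x) \<partial>M)"
  proof (rule nn_integral_mono)
    fix x
    have "(\<integral>\<^sup>+s. ?X s x \<partial>lborel) = (\<integral>\<^sup>+s. indicator {s. trunc_level d N (s + h) < u x \<and> u x < trunc_level d N s} s * ennreal (g x) \<partial>lborel)"
      by (rule nn_integral_cong) (auto simp: indicator_def)
    also have "\<dots> = emeasure lborel {s. trunc_level d N (s + h) < u x \<and> u x < trunc_level d N s} * ennreal (g x)"
    proof -
      have "{s \<in> space lborel. trunc_level d N (s + h) < u x \<and> u x < trunc_level d N s} \<in> sets lborel" by measurable
      then show ?thesis by (subst nn_integral_multc) auto
    qed
    also have "\<dots> \<le> ennreal h * ennreal (g x)" by (intro mult_right_mono emeasure_crossing_le h) simp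
    finally show "(\<integral>\<^sup>+s. ?X s x \<partial>lborel) \<le> ennreal h * ennreal (g x)" .
  qed
  also have "\<dots> = ennreal h * ennreal E"
    using nn_integral_eq_integral[OF g_int] g_nonneg by (simp add: nn_integral_cmult E_def)
  also have "ennreal (K\<^sup>2 / h) * (ennreal h * ennreal E) = ennreal (K\<^sup>2 * E)"
    using h E_nonneg by (simp add: ennreal_mult[symmetric])
  finally show ?thesis by (simp add: mult_left_mono)
qed

text \<open>
  The function \<open>v\<close> is the mean of the profile over \<open>[s, s + h]\<close>; its derivative is the difference quotient,
  whose energy is controlled independently of \<open>h\<close>.
\<close>

lemma smooth_profile:
  assumes V: "0 < total" and e: "0 < e"
  obtains v p where "\<And>s. (v has_real_derivative p s) (at s)" "continuous_on UNIV p"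
    "\<exists>\<eta>>0. \<eta> < total \<and> (\<forall>s\<ge>total - \<eta>. v s = 0)" "\<And>s. \<bar>v s - profile s\<bar> \<le> e"
    "(\<integral>\<^sup>+s. indicator {0<..} s * ennreal ((p s * s powr \<alpha>)\<^sup>2) \<partial>lborel) \<le> ennreal (K\<^sup>2 * E)"
proof -
  have c: "continuous_on UNIV profile" using continuous_profile by (simp add: continuous_at_imp_continuous_on)
  have "\<exists>F. \<forall>x. - \<infinity> < ereal x \<longrightarrow> ereal x < \<infinity> \<longrightarrow> (F has_vector_derivative profile x) (at x)"
    by (rule einterval_antiderivative) (use continuous_profile in auto)
  then obtain F where F: "(F has_real_derivative profile s) (at s)" for s
    by (auto simp: has_real_derivative_iff_has_vector_derivative)
  obtain \<eta> where \<eta>: "0 < \<eta>" "\<eta> < total" "\<And>s. total - \<eta> \<le> s \<Longrightarrow> trunc_level d N s = d"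
    using trunc_level_vanishes[OF V] by blast
  have m0: "profile s = 0" if "total - \<eta> \<le> s" for s
    using \<eta> that by (simp add: profile_def max_def)
  have "uniformly_continuous_on {-1..total + 2} profile"
    by (intro compact_uniformly_continuous continuous_on_subset[OF c]) auto
  then obtain \<delta> where \<delta>: "\<delta> > 0" "\<And>s s'. s \<in> {-1..total + 2} \<Longrightarrow> s' \<in> {-1..total + 2} \<Longrightarrow> dist s' s < \<delta> \<Longrightarrow> dist (profile s') (profile s) < e"
    using e unfolding uniformly_continuous_on_def by metis
  define h where "h = min 1 (\<delta> / 2)"
  have h: "0 < h" "h \<le> 1" "h < \<delta>" using \<delta>(1) by (auto simp: h_def)
  define v where "v s = (F (s + h) - F s) / h" for s
  define p where "p s = (profile (s + h) - profile s) / h" for s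
  have mvt: "\<exists>z. s < z \<and> z < s + h \<and> v s = profile z" for s
  proof -
    obtain z where "s < z" "z < s + h" "F (s + h) - F s = (s + h - s) * profile z"
      using MVT2[of s "s + h" F profile] F h by auto
    then show ?thesis using h by (auto simp: v_def)
  qed
  show ?thesis
  proof (rule that[of v p])
    show "(v has_real_derivative p s) (at s)" for s
    proof -
      have "((\<lambda>s. F (s + h)) has_real_derivative profile (s + h)) (at s)"
        by (rule DERIV_shift[THEN iffD1, OF F])
      then show ?thesis unfolding v_def p_def using F h by (auto intro!: derivative_eq_intros)
    qed
    show "continuous_on UNIV p" unfolding p_def using h
      by (intro continuous_intros continuous_on_compose2[OF c] c) auto
    have "v s = 0" if "s \<ge> total - \<eta>" for s
    proof -
      obtain z where "s < z" "v s = profile z" using mvt by blast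
      then show ?thesis using m0[of z] that by simp
    qed
    then show "\<exists>\<eta>>0. \<eta> < total \<and> (\<forall>s\<ge>total - \<eta>. v s = 0)" using \<eta> by blast
    show "\<bar>v s - profile s\<bar> \<le> e" for s
    proof -
      obtain z where z: "s < z" "z < s + h" "v s = profile z" using mvt by blast
      consider "s < -1" | "s > total + 1" | "s \<in> {-1..total + 1}" by force
      then show ?thesis
      proof cases
        case 1
        then have "profile z = profile s" using z h by (simp add: profile_def max_def)
        then show ?thesis using z e by simp
      next
        case 2
        then have "profile z = 0" "profile s = 0" using z \<eta> by (auto intro!: m0)
        then show ?thesis using z e by simp
      next
        case 3
        then have "dist (profile z) (profile s) < e"
          using z h V by (intro \<delta>) (auto simp: dist_real_def)
        then show ?thesis using z by (simp add: dist_real_def)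
      qed
    qed
    show "(\<integral>\<^sup>+s. indicator {0<..} s * ennreal ((p s * s powr \<alpha>)\<^sup>2) \<partial>lborel) \<le> ennreal (K\<^sup>2 * E)"
      unfolding p_def by (rule difference_quotient_energy[OF h(1)])
  qed
qed

end

end

section \<open>Radial functions\<close>

text \<open>
  The volume of the ball around \<open>0\<close> whose boundary passes through \<open>x\<close>. The Schwarz symmetrization is the
  rearrangement evaluated at this volume.
\<close>

definition ball_vol :: "'a::euclidean_space \<Rightarrow> real" where
  "ball_vol x = unit_ball_vol (real DIM('a)) * norm x ^ DIM('a)"

lemma ball_vol_nonneg: "0 \<le> ball_vol x"
  by (simp add: ball_vol_def)

lemma ball_vol_less_iff:
  assumes "0 < V"
  shows "ball_vol (x::'a::euclidean_space) < V \<longleftrightarrow> norm x < root DIM('a) (V / unit_ball_vol (real DIM('a)))"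
    and "unit_ball_vol (real DIM('a)) * root DIM('a) (V / unit_ball_vol (real DIM('a))) ^ DIM('a) = V"
    and "0 < root DIM('a) (V / unit_ball_vol (real DIM('a)))"
proof -
  let ?c = "unit_ball_vol (real DIM('a))" and ?r = "root DIM('a) (V / unit_ball_vol (real DIM('a)))"
  have c: "?c > 0" by simp
  then have c0: "?c \<noteq> 0" by linarith
  have r: "?r ^ DIM('a) = V / ?c" using assms c by (intro real_root_pow_pos2) auto
  show r0: "?r > 0" using assms c by simp
  show "?c * ?r ^ DIM('a) = V" unfolding r using c0 by simp
  have "ball_vol x < V \<longleftrightarrow> norm x ^ DIM('a) < ?r ^ DIM('a)"
    unfolding r ball_vol_def using c by (simp add: field_simps)
  also have "\<dots> \<longleftrightarrow> norm x < ?r"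
    using r0 by (meson DIM_positive less_le_not_le norm_ge_zero not_le power_less_imp_less_base power_strict_mono)
  finally show "ball_vol x < V \<longleftrightarrow> norm x < ?r" .
qed

lemma ball_vol_continuous: "continuous_on UNIV (ball_vol :: 'a::euclidean_space \<Rightarrow> real)"
  unfolding ball_vol_def by (intro continuous_intros)

lemma ball_vol_meas[measurable]: "(ball_vol :: 'a::euclidean_space \<Rightarrow> real) \<in> borel_measurable borel"
  by (rule borel_measurable_continuous_onI[OF ball_vol_continuous])

lemma emeasure_ball_vol_less:
  "emeasure lborel {x::'a::euclidean_space. ball_vol x < V} = ennreal V"
proof (cases "0 < V")
  case True
  define r where "r = root DIM('a) (V / unit_ball_vol (real DIM('a)))"
  have r: "ball_vol x < V \<longleftrightarrow> norm x < r" "unit_ball_vol (real DIM('a)) * r ^ DIM('a) = V" "0 < r" for x :: 'a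
    unfolding r_def by (rule ball_vol_less_iff[OF True])+
  have "{x::'a. ball_vol x < V} = ball 0 r" by (rule set_eqI) (simp only: mem_Collect_eq mem_ball_0 r(1))
  then have "emeasure lborel {x::'a. ball_vol x < V} = ennreal (unit_ball_vol (real DIM('a)) * r ^ DIM('a))"
    using emeasure_ball[of r "0::'a"] r(3) by simp
  then show ?thesis unfolding r(2) .
next
  case False
  have "\<not> ball_vol (x::'a) < V" for x using False ball_vol_nonneg[of x] by linarith
  then have "{x::'a. ball_vol x < V} = {}" by auto
  then show ?thesis using False by (simp add: ennreal_neg)
qed

text \<open>
  The sign is reversed because the comparison of two measures on the line by their values on upper
  half-lines requires these to be finite.
\<close>

lemma distr_ball_vol:
  "distr lborel borel (\<lambda>x::'a::euclidean_space. - ball_vol x) = density lborel (\<lambda>s. indicator {..<0} s)"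
proof (rule measure_eqI_lessThan)
  fix t :: real
  have "emeasure (distr lborel borel (\<lambda>x::'a. - ball_vol x)) {t<..} = emeasure lborel {x::'a. ball_vol x < - t}"
    by (subst emeasure_distr) (auto simp: vimage_def intro!: arg_cong[where f="emeasure lborel"])
  then have 1: "emeasure (distr lborel borel (\<lambda>x::'a. - ball_vol x)) {t<..} = ennreal (- t)"
    by (simp add: emeasure_ball_vol_less)
  then show "emeasure (distr lborel borel (\<lambda>x::'a. - ball_vol x)) {t<..} < \<infinity>" by simp
  have "emeasure (density lborel (\<lambda>s. indicator {..<0} s)) {t<..} = (\<integral>\<^sup>+s. indicator {..<0::real} s * indicator {t<..} s \<partial>lborel)"
    by (subst emeasure_density) auto
  also have "\<dots> = (\<integral>\<^sup>+s. indicator {t<..<0} s \<partial>lborel)"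
    by (rule nn_integral_cong) (auto simp: indicator_def)
  also have "\<dots> = ennreal (- t)" by (cases "t \<le> 0") (auto simp: ennreal_neg)
  finally show "emeasure (distr lborel borel (\<lambda>x::'a. - ball_vol x)) {t<..} = emeasure (density lborel (\<lambda>s. indicator {..<0} s)) {t<..}"
    using 1 by simp
qed simp_all

text \<open>
  Polar coordinates for a radial integrand: the image of Lebesgue measure under \<open>ball_vol\<close> is Lebesgue measure on the half-line.
\<close>

lemma nn_integral_radial:
  assumes [measurable]: "f \<in> borel_measurable borel"
  shows "(\<integral>\<^sup>+x. f (ball_vol (x::'a::euclidean_space)) \<partial>lborel) = (\<integral>\<^sup>+s. indicator {0<..} s * f s \<partial>lborel)"
proof -
  have "(\<integral>\<^sup>+x. f (ball_vol (x::'a)) \<partial>lborel) = (\<integral>\<^sup>+y. f (- y) \<partial>distr lborel borel (\<lambda>x::'a. - ball_vol x))"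
    by (subst nn_integral_distr) auto
  also have "\<dots> = (\<integral>\<^sup>+y. indicator {..<0} y * f (- y) \<partial>lborel)"
    unfolding distr_ball_vol by (subst nn_integral_density) auto
  also have "\<dots> = (\<integral>\<^sup>+y. indicator {..<0} (- y) * f (- (- y)) \<partial>lborel)"
    using nn_integral_real_affine[of "\<lambda>y. indicator {..<0} y * f (- y)" "-1" 0] by simp
  also have "\<dots> = (\<integral>\<^sup>+s. indicator {0<..} s * f s \<partial>lborel)"
    by (rule nn_integral_cong) (auto simp: indicator_def)
  finally show ?thesis .
qed

lemma ball_vol_has_derivative:
  fixes x :: "'a::euclidean_space"
  assumes "DIM('a) \<ge> 2"
  shows "(ball_vol has_derivative (\<lambda>h. unit_ball_vol (real DIM('a)) * real DIM('a) * norm x ^ (DIM('a) - 2) * (x \<bullet> h))) (at x)"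
proof -
  obtain k where k: "DIM('a) = Suc (Suc k)" using assms by (metis add_2_eq_Suc le_Suc_ex)
  have "((\<lambda>x::'a. norm x ^ Suc (Suc k)) has_derivative (\<lambda>h. real (Suc (Suc k)) * norm x ^ k * (x \<bullet> h))) (at x)"
  proof (cases "x = 0")
    case True
    have "((\<lambda>x::'a. norm x ^ Suc (Suc k)) has_derivative (\<lambda>h. 0)) (at 0)"
      unfolding has_derivative_at
    proof
      show "bounded_linear (\<lambda>h::'a. 0::real)" by simp
      have "((\<lambda>h::'a. norm h ^ Suc k) \<longlongrightarrow> norm (0::'a) ^ Suc k) (at 0)" by (intro tendsto_intros)
      then have "((\<lambda>h::'a. norm h ^ Suc k) \<longlongrightarrow> 0) (at 0)" by simp
      then show "((\<lambda>h::'a. norm (norm (0 + h) ^ Suc (Suc k) - norm (0::'a) ^ Suc (Suc k) - 0) / norm h) \<longlongrightarrow> 0) (at 0)"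
        by (rule Lim_transform_eventually) (auto simp: eventually_at_filter)
    qed
    then show ?thesis using True by simp
  next
    case False
    have "((\<lambda>x::'a. norm x ^ Suc (Suc k)) has_derivative (\<lambda>h. real (Suc (Suc k)) * (h \<bullet> sgn x) * norm x ^ Suc k)) (at x)"
      using has_derivative_power[OF has_derivative_norm[OF False], of "Suc (Suc k)"] by simp
    moreover have "real (Suc (Suc k)) * (h \<bullet> sgn x) * norm x ^ Suc k = real (Suc (Suc k)) * norm x ^ k * (x \<bullet> h)" for h
      using False by (simp add: sgn_div_norm inner_commute)
    ultimately show ?thesis by (simp only:)
  qed
  from has_derivative_mult_right[OF this, of "unit_ball_vol (real DIM('a))"]
  show ?thesis unfolding ball_vol_def[abs_def] k by (simp add: mult.assoc)
qed

definition grad :: "('a::euclidean_space \<Rightarrow> real) \<Rightarrow> 'a \<Rightarrow> 'a" where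
  "grad f x = (\<Sum>b\<in>Basis. ddir b f x *\<^sub>R b)"

lemma grad_inner: "b \<in> Basis \<Longrightarrow> grad f x \<bullet> b = ddir b f x"
  unfolding grad_def by (rule inner_sum_left_Basis)

text \<open>
  In terms of the volume \<open>s = c |x|\<^sup>n\<close> the factor \<open>c n |x|\<^sup>n\<^sup>-\<^sup>1\<close> of the chain rule is \<open>n c\<^sup>1\<^sup>/\<^sup>n s\<^sup>1\<^sup>-\<^sup>1\<^sup>/\<^sup>n\<close>,
  the weight of the one-dimensional energy. Dimension at least \<open>2\<close> makes \<open>|x|\<^sup>n\<close> differentiable at the
  origin with continuous derivative.
\<close>

lemma radial_C1:
  fixes v p :: "real \<Rightarrow> real"
  assumes n: "DIM('a::euclidean_space) \<ge> 2"
    and v: "\<And>s. (v has_real_derivative p s) (at s)" and p: "continuous_on UNIV p"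
  shows "Ck 1 (\<lambda>x::'a. v (ball_vol x))"
    and "norm (grad (\<lambda>x::'a. v (ball_vol x)) x) =
      \<bar>real DIM('a) * unit_ball_vol (real DIM('a)) powr (1 / real DIM('a)) * (p (ball_vol x) * ball_vol x powr (1 - 1 / real DIM('a)))\<bar>"
proof -
  let ?c = "unit_ball_vol (real DIM('a))" and ?n = "DIM('a)"
  have d: "((\<lambda>x::'a. v (ball_vol x)) has_derivative (\<lambda>h. p (ball_vol x) * (?c * real ?n * norm x ^ (?n - 2) * (x \<bullet> h)))) (at x)" for x
    using has_derivative_compose[OF ball_vol_has_derivative[OF n] v[THEN has_field_derivative_imp_has_derivative]] by simp
  have "Ck (Suc 0) (\<lambda>x::'a. v (ball_vol x))"
  proof (rule Ck_SucI[OF d])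
    show "Ck 0 (\<lambda>x::'a. p (ball_vol x) * (?c * real ?n * norm x ^ (?n - 2) * (x \<bullet> h)))" for h
      by (auto intro!: continuous_intros continuous_on_compose2[OF p ball_vol_continuous])
  qed
  then show "Ck 1 (\<lambda>x::'a. v (ball_vol x))" by simp
  have "ddir h (\<lambda>x::'a. v (ball_vol x)) x = p (ball_vol x) * (?c * real ?n * norm x ^ (?n - 2)) * (x \<bullet> h)" for h
    using fun_cong[OF frechet_derivative_at[OF d[of x]], of h] by simp
  then have "grad (\<lambda>x::'a. v (ball_vol x)) x = (p (ball_vol x) * (?c * real ?n * norm x ^ (?n - 2))) *\<^sub>R (\<Sum>b\<in>Basis. (x \<bullet> b) *\<^sub>R b)"
    unfolding grad_def scaleR_sum_right by (simp add: mult.assoc)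
  then have g: "grad (\<lambda>x::'a. v (ball_vol x)) x = (p (ball_vol x) * (?c * real ?n * norm x ^ (?n - 2))) *\<^sub>R x"
    unfolding euclidean_representation .
  have c: "?c > 0" by simp
  have key: "?c * norm x ^ (?n - 2) * norm x = ?c powr (1 / real ?n) * ball_vol x powr (1 - 1 / real ?n)"
  proof (cases "x = 0")
    case True
    then show ?thesis using n by (simp add: ball_vol_def)
  next
    case False
    then have nx: "norm x > 0" by simp
    have e: "?n - 2 + 1 = ?n - 1" using n by simp
    have "ball_vol x powr (1 - 1 / real ?n) = ?c powr (1 - 1 / real ?n) * (norm x powr real ?n) powr (1 - 1 / real ?n)"
      unfolding ball_vol_def using c nx by (simp add: powr_mult powr_realpow)
    also have "(norm x powr real ?n) powr (1 - 1 / real ?n) = norm x powr (real ?n - 1)"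
      unfolding powr_powr using n by (simp add: right_diff_distrib)
    also have "\<dots> = norm x ^ (?n - 1)" using n nx by (simp add: powr_realpow[symmetric] of_nat_diff)
    finally have "?c powr (1 / real ?n) * ball_vol x powr (1 - 1 / real ?n) = (?c powr (1 / real ?n) * ?c powr (1 - 1 / real ?n)) * norm x ^ (?n - 1)"
      by simp
    also have "?c powr (1 / real ?n) * ?c powr (1 - 1 / real ?n) = ?c" using c by (simp add: powr_add[symmetric])
    also have "norm x ^ (?n - 1) = norm x ^ (?n - 2) * norm x" unfolding e[symmetric] by simp
    finally show ?thesis by simp
  qed
  have "norm (grad (\<lambda>x::'a. v (ball_vol x)) x) = \<bar>p (ball_vol x)\<bar> * real ?n * (?c * norm x ^ (?n - 2) * norm x)"
    unfolding g using c by (simp add: abs_mult)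
  also have "\<dots> = \<bar>real ?n * ?c powr (1 / real ?n) * (p (ball_vol x) * ball_vol x powr (1 - 1 / real ?n))\<bar>"
    unfolding key by (simp add: abs_mult)
  finally show "norm (grad (\<lambda>x::'a. v (ball_vol x)) x) = \<bar>real ?n * ?c powr (1 / real ?n) * (p (ball_vol x) * ball_vol x powr (1 - 1 / real ?n))\<bar>" .
qed

lemma radial_compact_support:
  assumes "0 < \<eta>" "\<eta> < V" "\<And>s. V - \<eta> \<le> s \<Longrightarrow> v s = (0::real)"
  shows "compactly_supported_in {x::'a::euclidean_space. ball_vol x < V} (\<lambda>x::'a. v (ball_vol x))"
  unfolding compactly_supported_in_def
proof (intro exI conjI allI impI)
  let ?r = "root DIM('a) ((V - \<eta>) / unit_ball_vol (real DIM('a)))"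
  have V\<eta>: "0 < V - \<eta>" using assms by simp
  show "compact (cball (0::'a) ?r)" by simp
  show "cball (0::'a) ?r \<subseteq> {x. ball_vol x < V}"
  proof
    fix x :: 'a assume "x \<in> cball 0 ?r"
    then have "norm x \<le> ?r" by simp
    then have "ball_vol x \<le> unit_ball_vol (real DIM('a)) * ?r ^ DIM('a)"
      unfolding ball_vol_def by (intro mult_left_mono power_mono) auto
    then show "x \<in> {x. ball_vol x < V}" unfolding ball_vol_less_iff(2)[OF V\<eta>] using assms(1) by simp
  qed
  fix x :: 'a assume "x \<notin> cball 0 ?r"
  then have "\<not> norm x < ?r" by simp
  then have "V - \<eta> \<le> ball_vol x" using ball_vol_less_iff(1)[OF V\<eta>, of x] by simp
  then show "v (ball_vol x) = 0" by (rule assms(3))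
qed

section \<open>Limits in \<open>L\<^sup>2\<close> with bounded energy\<close>

lemma continuous_grad: "Ck 1 f \<Longrightarrow> continuous_on UNIV (grad f)"
  unfolding grad_def[abs_def] by (intro continuous_on_sum continuous_on_scaleR continuous_on_const) auto

lemma grad_support: "compactly_supported_in \<Omega> f \<Longrightarrow> compactly_supported_in \<Omega> (grad f)"
proof -
  assume f: "compactly_supported_in \<Omega> f"
  then obtain K where K: "compact K" "K \<subseteq> \<Omega>" "\<And>x. x \<notin> K \<Longrightarrow> f x = 0"
    unfolding compactly_supported_in_def by blast
  have "compactly_supported_in K f" using K unfolding compactly_supported_in_def by blast
  then have d0: "ddir b f x = 0" if "x \<notin> K" for x b
    by (rule compactly_supported_outside[OF ddir_support that])
  then have "grad f x = 0" if "x \<notin> K" for x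
    unfolding grad_def d0[OF that] by simp
  then show ?thesis using K unfolding compactly_supported_in_def by blast
qed

lemma L2_on_continuous:
  fixes f :: "'a::euclidean_space \<Rightarrow> 'b::euclidean_space"
  assumes \<Omega>: "open \<Omega>" "bounded \<Omega>" and f: "continuous_on UNIV f" "compactly_supported_in \<Omega> f"
  shows "L2_on \<Omega> f"
  unfolding L2_on_def
proof
  interpret finite_measure "lebesgue_on \<Omega>" by (rule finite_measure_lebesgue_on_open[OF \<Omega>])
  show m[measurable]: "f \<in> borel_measurable (lebesgue_on \<Omega>)"
    by (rule borel_lebesgue_on[OF borel_measurable_continuous_onI[OF f(1)]])
  have "compactly_supported_in UNIV f" using f(2) compactly_supported_in_mono by blast
  then obtain B where B: "\<And>x. norm (f x) \<le> B" using bounded_compact_support[OF f(1)] by metis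
  show "integrable (lebesgue_on \<Omega>) (\<lambda>x. (norm (f x))\<^sup>2)"
  proof (rule integrable_const_bound)
    show "AE x in lebesgue_on \<Omega>. norm ((norm (f x))\<^sup>2) \<le> B\<^sup>2"
      using B by (intro AE_I2) (auto intro!: power_mono)
  qed measurable
qed

lemma C1_has_L2_gradient:
  fixes f :: "'a::euclidean_space \<Rightarrow> real"
  assumes \<Omega>: "open \<Omega>" "bounded \<Omega>" and f: "Ck 1 f" "compactly_supported_in \<Omega> f"
  shows "has_L2_gradient \<Omega> f (grad f)"
proof -
  have "(LINT x|lebesgue_on \<Omega>. f x * ddir b \<phi> x) = - (LINT x|lebesgue_on \<Omega>. (grad f x \<bullet> b) * \<phi> x)"
    if \<phi>: "\<phi> \<in> Cc_infinity \<Omega>" and b: "b \<in> Basis" for \<phi> b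
  proof -
    have \<phi>1: "Ck 1 \<phi>" by (rule Cc_infinityD(1)[OF \<phi>])
    have U: "compactly_supported_in UNIV f" "compactly_supported_in UNIV \<phi>"
      using f(2) Cc_infinityD(2)[OF \<phi>] compactly_supported_in_mono by blast+
    have c: "continuous_on UNIV f" "continuous_on UNIV \<phi>" "continuous_on UNIV (ddir b f)" "continuous_on UNIV (ddir b \<phi>)"
      using Ck_1_continuous f(1) \<phi>1 by auto
    have "(LINT x|lebesgue_on \<Omega>. f x * ddir b \<phi> x) = (LINT x|lborel. f x * ddir b \<phi> x)"
      by (rule lebesgue_on_integral_borel(1)[OF \<Omega>(1)])
         (use compactly_supported_outside[OF f(2)] in \<open>auto intro!: borel_measurable_continuous_onI continuous_on_mult c\<close>)
    also have "\<dots> = - (LINT x|lborel. ddir b f x * \<phi> x)" by (rule integration_by_parts[OF f(1) U(1) \<phi>1 U(2)])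
    also have "(LINT x|lborel. ddir b f x * \<phi> x) = (LINT x|lebesgue_on \<Omega>. ddir b f x * \<phi> x)"
      by (rule lebesgue_on_integral_borel(1)[OF \<Omega>(1), symmetric])
         (use compactly_supported_outside[OF Cc_infinityD(2)[OF \<phi>]] in \<open>auto intro!: borel_measurable_continuous_onI continuous_on_mult c\<close>)
    finally show ?thesis unfolding grad_inner[OF b] .
  qed
  moreover have "L2_on \<Omega> f" by (rule L2_on_continuous[OF \<Omega> Ck_1_continuous[OF f(1)] f(2)])
  moreover have "L2_on \<Omega> (grad f)" by (rule L2_on_continuous[OF \<Omega> continuous_grad[OF f(1)] grad_support[OF f(2)]])
  ultimately show ?thesis unfolding has_L2_gradient_def by (intro conjI ballI)
qed

definition sqnorm :: "'a::euclidean_space set \<Rightarrow> ('a \<Rightarrow> 'b::euclidean_space) \<Rightarrow> real" where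
  "sqnorm \<Omega> f = (LINT x|lebesgue_on \<Omega>. (norm (f x))\<^sup>2)"

lemma sqnorm_nonneg: "0 \<le> sqnorm \<Omega> f"
  unfolding sqnorm_def by simp

lemma L2_sq_integrable: "L2_on \<Omega> f \<Longrightarrow> integrable (lebesgue_on \<Omega>) (\<lambda>x. (norm (f x))\<^sup>2)"
  by (simp add: L2_on_def)

lemma L2_meas: "L2_on \<Omega> f \<Longrightarrow> f \<in> borel_measurable (lebesgue_on \<Omega>)"
  by (simp add: L2_on_def)

text \<open>
  A subsequence whose consecutive distances decay geometrically has an absolutely convergent
  telescoping series almost everywhere; Fatou's lemma turns the pointwise limit into a limit in
  \<open>L\<^sup>2\<close> of the whole sequence.
\<close>

lemma L2_complete:
  fixes G :: "nat \<Rightarrow> 'a::euclidean_space \<Rightarrow> 'b::euclidean_space"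
  assumes \<Omega>: "open \<Omega>" "bounded \<Omega>" and L2: "\<And>k. L2_on \<Omega> (G k)"
    and cauchy: "\<And>e. e > 0 \<Longrightarrow> \<exists>N. \<forall>m\<ge>N. \<forall>k\<ge>m. sqnorm \<Omega> (\<lambda>x. G k x - G m x) \<le> e"
  obtains H where "L2_on \<Omega> H" "(\<lambda>k. sqnorm \<Omega> (\<lambda>x. G k x - H x)) \<longlonglongrightarrow> 0"
proof -
  let ?M = "lebesgue_on \<Omega>"
  interpret finite_measure ?M by (rule finite_measure_lebesgue_on_open[OF \<Omega>])
  have m[measurable]: "G k \<in> borel_measurable ?M" for k by (rule L2_meas[OF L2])
  have "\<forall>j. \<exists>N. \<forall>m\<ge>N. \<forall>k\<ge>m. sqnorm \<Omega> (\<lambda>x. G k x - G m x) \<le> (1/4) ^ j" using cauchy by simp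
  then obtain N where N: "\<And>j m k. N j \<le> m \<Longrightarrow> m \<le> k \<Longrightarrow> sqnorm \<Omega> (\<lambda>x. G k x - G m x) \<le> (1/4) ^ j" by metis
  define r where "r j = (\<Sum>i\<le>j. N i) + j" for j
  have rN: "N j \<le> r j" for j unfolding r_def using member_le_sum[of j "{..j}" N] by simp
  have rS: "r j \<le> r (Suc j)" for j by (simp add: r_def)
  have rge: "j \<le> r j" for j by (simp add: r_def)
  define h where "h j x = norm (G (r (Suc j)) x - G (r j) x)" for j x
  have [measurable]: "h j \<in> borel_measurable ?M" for j unfolding h_def by measurable
  define V where "V = measure lebesgue \<Omega>"
  have hL: "L2_on \<Omega> (h j)" for j unfolding h_def[abs_def] by (intro L2_norm L2_diff L2)
  have h1: "(\<integral>\<^sup>+x. ennreal (h j x) \<partial>?M) \<le> ennreal (sqrt V * (1/2) ^ j)" for j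
  proof -
    have hi: "integrable ?M (h j)" by (rule L2_integrable[OF finite_measure_axioms hL])
    have \<Omega>s: "\<Omega> \<in> sets ?M" using \<Omega>(1) by (simp add: sets_lebesgue_on_open_iff)
    have eq: "(LINT x|?M. indicator \<Omega> x * f x) = (LINT x|?M. f x)" for f :: "'a \<Rightarrow> real"
      by (rule Bochner_Integration.integral_cong) (auto simp: space_restrict_space)
    have "(LINT x|?M. \<bar>h j x\<bar>)\<^sup>2 \<le> V * (LINT x|?M. (h j x)\<^sup>2)"
      using L1_le_L2(1)[OF \<Omega> hL \<Omega>s] unfolding eq V_def .
    also have "(LINT x|?M. (h j x)\<^sup>2) \<le> (1/4) ^ j"
      using N[OF rN rS, of j] by (simp add: h_def sqnorm_def)
    also have "V * (1/4) ^ j = (sqrt V * (1/2) ^ j)\<^sup>2"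
    proof -
      have q: "((1/2) ^ j)\<^sup>2 = (1/4 :: real) ^ j"
        by (simp add: power2_eq_square flip: power_mult_distrib)
      show ?thesis unfolding power_mult_distrib[of "sqrt V"] q by (simp add: V_def)
    qed
    finally have "(LINT x|?M. \<bar>h j x\<bar>)\<^sup>2 \<le> (sqrt V * (1/2) ^ j)\<^sup>2" by (simp add: mult_left_mono V_def)
    then have "(LINT x|?M. \<bar>h j x\<bar>) \<le> sqrt V * (1/2) ^ j"
      by (rule power2_le_imp_le) (simp add: V_def)
    then have "(LINT x|?M. h j x) \<le> sqrt V * (1/2) ^ j" by (simp add: h_def)
    then have "ennreal (LINT x|?M. h j x) \<le> ennreal (sqrt V * (1/2) ^ j)" by (rule ennreal_leI)
    moreover have "(\<integral>\<^sup>+x. ennreal (h j x) \<partial>?M) = ennreal (LINT x|?M. h j x)"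
      by (rule nn_integral_eq_integral[OF hi]) (simp add: h_def)
    ultimately show ?thesis by (simp only:)
  qed
  have "(\<integral>\<^sup>+x. (\<Sum>j. ennreal (h j x)) \<partial>?M) = (\<Sum>j. \<integral>\<^sup>+x. ennreal (h j x) \<partial>?M)"
    by (rule nn_integral_suminf) measurable
  also have "\<dots> \<le> (\<Sum>j. ennreal (sqrt V * (1/2) ^ j))" by (rule suminf_le[OF h1]) auto
  also have "\<dots> = ennreal (\<Sum>j. sqrt V * (1/2) ^ j)"
    by (rule suminf_ennreal2) (auto simp: V_def intro!: summable_mult)
  finally have "(\<integral>\<^sup>+x. (\<Sum>j. ennreal (h j x)) \<partial>?M) \<noteq> \<infinity>" by (auto simp: top_unique)
  then have "AE x in ?M. (\<Sum>j. ennreal (h j x)) \<noteq> \<infinity>" by (intro nn_integral_PInf_AE) measurable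
  then have conv: "AE x in ?M. convergent (\<lambda>j. G (r j) x)"
  proof eventually_elim
    case (elim x)
    have "summable (\<lambda>j. h j x)"
      using elim by (intro summable_suminf_not_top) (auto simp: h_def)
    then have "summable (\<lambda>j. G (r (Suc j)) x - G (r j) x)"
      unfolding h_def by (rule summable_norm_cancel)
    then have "convergent (\<lambda>n. \<Sum>j<n. G (r (Suc j)) x - G (r j) x)" by (simp add: summable_iff_convergent)
    then have "convergent (\<lambda>n. G (r n) x - G (r 0) x)" 
      using sum_lessThan_telescope[of "\<lambda>j. G (r j) x"] by simp
    then have "convergent (\<lambda>n. (G (r n) x - G (r 0) x) + G (r 0) x)" by (intro convergent_add convergent_const)
    then show ?case by simp
  qed
  define H where "H x = lim (\<lambda>j. G (r j) x)" for x
  have [measurable]: "H \<in> borel_measurable ?M" unfolding H_def[abs_def] by measurable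
  have lim: "AE x in ?M. (\<lambda>j. G (r j) x) \<longlonglongrightarrow> H x"
    using conv by eventually_elim (simp add: H_def convergent_LIMSEQ_iff)
  have key: "(\<integral>\<^sup>+x. ennreal ((norm (G k x - H x))\<^sup>2) \<partial>?M) \<le> ennreal e"
    if "\<forall>m\<ge>N0. \<forall>k\<ge>m. sqnorm \<Omega> (\<lambda>x. G k x - G m x) \<le> e" "N0 \<le> k" for N0 k e
  proof -
    have "(\<integral>\<^sup>+x. ennreal ((norm (G k x - H x))\<^sup>2) \<partial>?M) = (\<integral>\<^sup>+x. liminf (\<lambda>j. ennreal ((norm (G k x - G (r j) x))\<^sup>2)) \<partial>?M)"
    proof (rule nn_integral_cong_AE, use lim in eventually_elim)
      case (elim x)
      have "(\<lambda>j. ennreal ((norm (G k x - G (r j) x))\<^sup>2)) \<longlonglongrightarrow> ennreal ((norm (G k x - H x))\<^sup>2)"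
        by (intro tendsto_ennrealI tendsto_intros elim)
      then show ?case using lim_imp_Liminf[OF sequentially_bot] by metis
    qed
    also have "\<dots> \<le> liminf (\<lambda>j. \<integral>\<^sup>+x. ennreal ((norm (G k x - G (r j) x))\<^sup>2) \<partial>?M)"
      by (rule nn_integral_liminf) measurable
    also have "\<dots> \<le> ennreal e"
    proof (rule Liminf_le)
      show "\<forall>\<^sub>F j in sequentially. (\<integral>\<^sup>+x. ennreal ((norm (G k x - G (r j) x))\<^sup>2) \<partial>?M) \<le> ennreal e"
        unfolding eventually_sequentially
      proof (intro exI[of _ k] allI impI)
        fix j assume "k \<le> j"
        then have "k \<le> r j" using rge[of j] by simp
        then have "sqnorm \<Omega> (\<lambda>x. G (r j) x - G k x) \<le> e" using that by blast
        then have "(LINT x|?M. (norm (G k x - G (r j) x))\<^sup>2) \<le> e" unfolding sqnorm_def by (simp add: norm_minus_commute)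
        then show "(\<integral>\<^sup>+x. ennreal ((norm (G k x - G (r j) x))\<^sup>2) \<partial>?M) \<le> ennreal e"
          using nn_integral_eq_integral[OF L2_sq_integrable[OF L2_diff[OF L2 L2]], of k "r j"] by (simp add: ennreal_leI)
      qed
    qed simp
    finally show ?thesis .
  qed
  have GH: "L2_on \<Omega> (\<lambda>x. G k x - H x) \<and> sqnorm \<Omega> (\<lambda>x. G k x - H x) \<le> e"
    if "\<forall>m\<ge>N0. \<forall>k\<ge>m. sqnorm \<Omega> (\<lambda>x. G k x - G m x) \<le> e" "N0 \<le> k" "0 \<le> e" for N0 k e
  proof -
    have i: "integrable ?M (\<lambda>x. (norm (G k x - H x))\<^sup>2)"
      using key[OF that(1,2)] by (intro integrableI_bounded) (auto simp: top_unique less_top[symmetric] intro: order_le_less_trans)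
    then have "ennreal (sqnorm \<Omega> (\<lambda>x. G k x - H x)) \<le> ennreal e"
      using key[OF that(1,2)] nn_integral_eq_integral[OF i] by (simp add: sqnorm_def)
    then show ?thesis using i that(3) by (simp add: L2_on_def)
  qed
  obtain N1 where N1: "\<forall>m\<ge>N1. \<forall>k\<ge>m. sqnorm \<Omega> (\<lambda>x. G k x - G m x) \<le> 1" using cauchy[of 1] by auto
  have HL: "L2_on \<Omega> H" using L2_diff[OF L2[of N1] conjunct1[OF GH[OF N1, of N1]]] by simp
  have "(\<lambda>k. sqnorm \<Omega> (\<lambda>x. G k x - H x)) \<longlonglongrightarrow> 0"
  proof (rule LIMSEQ_I)
    fix e :: real assume "e > 0"
    then obtain N0 where N0: "\<forall>m\<ge>N0. \<forall>k\<ge>m. sqnorm \<Omega> (\<lambda>x. G k x - G m x) \<le> e / 2" using cauchy[of "e/2"] by auto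
    show "\<exists>no. \<forall>n\<ge>no. norm (sqnorm \<Omega> (\<lambda>x. G n x - H x) - 0) < e"
    proof (intro exI[of _ N0] allI impI)
      fix k assume "N0 \<le> k"
      then have "sqnorm \<Omega> (\<lambda>x. G k x - H x) \<le> e / 2" using GH[OF N0] \<open>e > 0\<close> by simp
      then show "norm (sqnorm \<Omega> (\<lambda>x. G k x - H x) - 0) < e"
        using sqnorm_nonneg[of \<Omega> "\<lambda>x. G k x - H x"] \<open>e > 0\<close> by simp
    qed
  qed
  with HL show ?thesis by (rule that)
qed

lemma L2_tendsto_integral:
  fixes f :: "nat \<Rightarrow> 'a::euclidean_space \<Rightarrow> real"
  assumes \<Omega>: "open \<Omega>" "bounded \<Omega>" and L2: "\<And>k. L2_on \<Omega> (f k)" "L2_on \<Omega> F"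
    and lim: "(\<lambda>k. sqnorm \<Omega> (\<lambda>x. f k x - F x)) \<longlonglongrightarrow> 0"
    and \<phi>: "continuous_on UNIV \<phi>" "compactly_supported_in \<Omega> \<phi>"
  shows "(\<lambda>k. LINT x|lebesgue_on \<Omega>. f k x * \<phi> x) \<longlonglongrightarrow> (LINT x|lebesgue_on \<Omega>. F x * \<phi> x)"
proof -
  let ?M = "lebesgue_on \<Omega>"
  have L\<phi>: "L2_on \<Omega> \<phi>" by (rule L2_on_continuous[OF \<Omega> \<phi>])
  have fin: "finite_measure ?M" by (rule finite_measure_lebesgue_on_open[OF \<Omega>])
  have i: "integrable ?M (\<lambda>x. f k x * \<phi> x)" "integrable ?M (\<lambda>x. F x * \<phi> x)" for k
    by (intro integrable_mult_continuous_cs L2_integrable[OF fin] L2 \<phi>)+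
  have bd: "norm ((LINT x|?M. f k x * \<phi> x) - (LINT x|?M. F x * \<phi> x)) \<le> sqrt (sqnorm \<Omega> (\<lambda>x. f k x - F x) * sqnorm \<Omega> \<phi>)" for k
  proof -
    have Ld: "L2_on \<Omega> (\<lambda>x. f k x - F x)" by (intro L2_diff L2)
    have D: "(LINT x|?M. f k x * \<phi> x) - (LINT x|?M. F x * \<phi> x) = (LINT x|?M. (f k x - F x) * \<phi> x)"
      using i by (simp add: left_diff_distrib)
    have "(LINT x|?M. \<bar>(f k x - F x) * \<phi> x\<bar>)\<^sup>2 \<le> (LINT x|?M. (f k x - F x)\<^sup>2) * (LINT x|?M. (\<phi> x)\<^sup>2)"
      using L2_sq_integrable[OF Ld] L2_sq_integrable[OF L\<phi>]
      by (intro Cauchy_Schwarz_integral(2) L2_meas[OF Ld] L2_meas[OF L\<phi>]) auto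
    then have "(LINT x|?M. \<bar>(f k x - F x) * \<phi> x\<bar>) \<le> sqrt (sqnorm \<Omega> (\<lambda>x. f k x - F x) * sqnorm \<Omega> \<phi>)"
      by (intro real_le_rsqrt) (simp add: sqnorm_def)
    moreover have "\<bar>LINT x|?M. (f k x - F x) * \<phi> x\<bar> \<le> (LINT x|?M. \<bar>(f k x - F x) * \<phi> x\<bar>)" by (rule integral_abs_bound)
    ultimately show ?thesis unfolding D real_norm_def by linarith
  qed
  have "(\<lambda>k. sqrt (sqnorm \<Omega> (\<lambda>x. f k x - F x) * sqnorm \<Omega> \<phi>)) \<longlonglongrightarrow> sqrt (0 * sqnorm \<Omega> \<phi>)"
    by (intro tendsto_intros lim)
  then have "(\<lambda>k. sqrt (sqnorm \<Omega> (\<lambda>x. f k x - F x) * sqnorm \<Omega> \<phi>)) \<longlonglongrightarrow> 0" by simp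
  then have "(\<lambda>k. (LINT x|?M. f k x * \<phi> x) - (LINT x|?M. F x * \<phi> x)) \<longlonglongrightarrow> 0"
    by (rule Lim_null_comparison[OF always_eventually[OF allI[OF bd]]])
  then show ?thesis by (rule LIM_zero_cancel)
qed

lemma Ck_sum_half:
  assumes "Ck k f" "Ck k (g :: 'a::euclidean_space \<Rightarrow> real)" shows "Ck k (\<lambda>x. (1/2) * (f x + g x))"
  by (intro Ck_mult Ck_const Ck_add assms)

lemma Cc_infinity_midpoint:
  assumes "f \<in> Cc_infinity \<Omega>" "g \<in> Cc_infinity \<Omega>" shows "(\<lambda>x. (1/2) * (f x + g x)) \<in> Cc_infinity \<Omega>"
proof -
  obtain K where K: "compact K" "K \<subseteq> \<Omega>" "\<And>x. x \<notin> K \<Longrightarrow> f x = 0"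
    using Cc_infinityD(2)[OF assms(1)] unfolding compactly_supported_in_def by blast
  obtain K' where K': "compact K'" "K' \<subseteq> \<Omega>" "\<And>x. x \<notin> K' \<Longrightarrow> g x = 0"
    using Cc_infinityD(2)[OF assms(2)] unfolding compactly_supported_in_def by blast
  have "compactly_supported_in \<Omega> (\<lambda>x. (1/2) * (f x + g x))"
    unfolding compactly_supported_in_def
    by (rule exI[of _ "K \<union> K'"]) (use K K' compact_Un[OF K(1) K'(1)] in auto)
  then show ?thesis
    unfolding Cc_infinity_def using Ck_sum_half[OF Cc_infinityD(1)[OF assms(1)] Cc_infinityD(1)[OF assms(2)]] by blast
qed

lemma grad_midpoint:
  assumes "Ck 1 f" "Ck 1 (g :: 'a::euclidean_space \<Rightarrow> real)"
  shows "grad (\<lambda>x. (1/2) * (f x + g x)) x = (1/2) *\<^sub>R (grad f x + grad g x)"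
proof -
  have "(f has_derivative frechet_derivative f (at x)) (at x)" "(g has_derivative frechet_derivative g (at x)) (at x)"
    using assms Ck_has_derivative by (metis One_nat_def)+
  then have d: "((\<lambda>x. (1/2) * (f x + g x)) has_derivative (\<lambda>v. (1/2) * (ddir v f x + ddir v g x))) (at x)"
    by (intro has_derivative_mult_right has_derivative_add)
  have e: "ddir v (\<lambda>x. (1/2) * (f x + g x)) x = (1/2) * (ddir v f x + ddir v g x)" for v
    by (rule fun_cong[OF frechet_derivative_at[OF d], symmetric])
  show ?thesis unfolding grad_def e by (simp add: add_divide_distrib scaleR_sum_right scaleR_add_left scaleR_add_right sum.distrib)
qed

lemma sqnorm_parallelogram:
  fixes a b :: "'a::euclidean_space \<Rightarrow> 'b::euclidean_space"
  assumes a: "L2_on \<Omega> a" and b: "L2_on \<Omega> b"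
  shows "4 * sqnorm \<Omega> (\<lambda>x. (1/2) *\<^sub>R (a x + b x)) + sqnorm \<Omega> (\<lambda>x. a x - b x) = 2 * sqnorm \<Omega> a + 2 * sqnorm \<Omega> b"
proof -
  note ia = L2_sq_integrable[OF a] and ib = L2_sq_integrable[OF b] and id = L2_sq_integrable[OF L2_diff[OF a b]]
  have eq: "4 * (norm ((1/2) *\<^sub>R (a x + b x)))\<^sup>2 = 2 * (norm (a x))\<^sup>2 + 2 * (norm (b x))\<^sup>2 - (norm (a x - b x))\<^sup>2" for x
    unfolding power2_norm_eq_inner by (simp add: inner_add_left inner_add_right inner_diff_left inner_diff_right inner_commute)
  have "4 * sqnorm \<Omega> (\<lambda>x. (1/2) *\<^sub>R (a x + b x)) = (LINT x|lebesgue_on \<Omega>. 4 * (norm ((1/2) *\<^sub>R (a x + b x)))\<^sup>2)"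
    unfolding sqnorm_def by simp
  also have "\<dots> = 2 * sqnorm \<Omega> a + 2 * sqnorm \<Omega> b - sqnorm \<Omega> (\<lambda>x. a x - b x)"
    unfolding eq sqnorm_def using ia ib id by simp
  finally show ?thesis by simp
qed

lemma sqnorm_add_le:
  fixes a b :: "'a::euclidean_space \<Rightarrow> 'b::euclidean_space"
  assumes a: "L2_on \<Omega> a" and b: "L2_on \<Omega> b" and ab: "L2_on \<Omega> (\<lambda>x. a x + b x)" and t: "0 < t"
  shows "sqnorm \<Omega> (\<lambda>x. a x + b x) \<le> (1 + t) * sqnorm \<Omega> a + (1 + 1 / t) * sqnorm \<Omega> b"
proof -
  have "sqnorm \<Omega> (\<lambda>x. a x + b x) \<le> (LINT x|lebesgue_on \<Omega>. (1 + t) * (norm (a x))\<^sup>2 + (1 + 1 / t) * (norm (b x))\<^sup>2)"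
    unfolding sqnorm_def
  proof (rule integral_mono[OF L2_sq_integrable[OF ab]])
    show "integrable (lebesgue_on \<Omega>) (\<lambda>x. (1 + t) * (norm (a x))\<^sup>2 + (1 + 1 / t) * (norm (b x))\<^sup>2)"
      using L2_sq_integrable[OF a] L2_sq_integrable[OF b] by simp
    fix x
    let ?A = "norm (a x)" and ?B = "norm (b x)"
    have "0 \<le> (t * ?A - ?B)\<^sup>2 / t" using t by simp
    also have "\<dots> = t * ?A\<^sup>2 - 2 * ?A * ?B + ?B\<^sup>2 / t" using t by (simp add: power2_eq_square field_simps)
    finally have "2 * ?A * ?B \<le> t * ?A\<^sup>2 + ?B\<^sup>2 / t" by simp
    moreover have "(norm (a x + b x))\<^sup>2 \<le> (?A + ?B)\<^sup>2" by (intro power_mono norm_triangle_ineq) simp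
    ultimately show "(norm (a x + b x))\<^sup>2 \<le> (1 + t) * ?A\<^sup>2 + (1 + 1 / t) * ?B\<^sup>2"
      by (simp add: power2_sum distrib_right)
  qed
  also have "\<dots> = (1 + t) * sqnorm \<Omega> a + (1 + 1 / t) * sqnorm \<Omega> b"
    unfolding sqnorm_def using L2_sq_integrable[OF a] L2_sq_integrable[OF b] by simp
  finally show ?thesis .
qed

lemma sqnorm_cong_AE:
  assumes "AE x in lebesgue_on \<Omega>. f x = g x" "L2_on \<Omega> f" "L2_on \<Omega> g"
  shows "sqnorm \<Omega> f = sqnorm \<Omega> g"
proof -
  have [measurable]: "f \<in> borel_measurable (lebesgue_on \<Omega>)" "g \<in> borel_measurable (lebesgue_on \<Omega>)"
    using assms(2,3) by (auto simp: L2_on_def)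
  show ?thesis unfolding sqnorm_def by (rule integral_cong_AE) (use assms(1) in auto)
qed

text \<open>
  Weak compactness by hand. Let \<open>A m\<close> be the convex set of test functions whose squared distance from \<open>w\<close> is at most
  \<open>1/(m + 1)\<close>, and
  \<open>\<delta> m\<close> the infimum of the energy on it. These infima increase and are bounded by \<open>R\<close>, and midpoints
  stay in \<open>A m\<close>, so the parallelogram law makes the gradients of near-minimizers a Cauchy sequence. Their
  limit is the weak gradient of \<open>w\<close>.
\<close>

lemma H12_0_closed:
  fixes w :: "'a::euclidean_space \<Rightarrow> real"
  assumes \<Omega>: "open \<Omega>" "bounded \<Omega>" and w: "L2_on \<Omega> w"
    and approx: "\<And>e. 0 < e \<Longrightarrow> \<exists>y\<in>Cc_infinity \<Omega>. sqnorm \<Omega> (\<lambda>x. y x - w x) \<le> e \<and> sqnorm \<Omega> (grad y) \<le> R + e"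
  shows "w \<in> H12_0 \<Omega>" and "sqnorm \<Omega> (weak_grad \<Omega> w) \<le> R"
proof -
  note C1 = Cc_infinityD(1)[where k=1] and cs = Cc_infinityD(2)
  have Lf: "L2_on \<Omega> y" and Lg: "L2_on \<Omega> (grad y)" if "y \<in> Cc_infinity \<Omega>" for y
    using C1_has_L2_gradient[OF \<Omega> C1[OF that] cs[OF that]] by (auto simp: has_L2_gradient_def)
  define A where "A m = {y \<in> Cc_infinity \<Omega>. sqnorm \<Omega> (\<lambda>x. y x - w x) \<le> 1 / real (Suc m)}" for m
  define D where "D y = sqnorm \<Omega> (grad y)" for y
  define \<delta> where "\<delta> m = Inf (D ` A m)" for m
  have bdd: "bdd_below (D ` A m)" for m by (rule bdd_belowI[of _ 0]) (auto simp: D_def sqnorm_nonneg)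
  have ex: "\<exists>y\<in>A m. D y \<le> R + e" if "0 < e" for m e
  proof -
    have "0 < min e (1 / real (Suc m))" using that by simp
    from approx[OF this] obtain y where y: "y \<in> Cc_infinity \<Omega>" "sqnorm \<Omega> (\<lambda>x. y x - w x) \<le> min e (1 / real (Suc m))" "sqnorm \<Omega> (grad y) \<le> R + min e (1 / real (Suc m))"
      by blast
    then have "y \<in> A m" "D y \<le> R + e" by (auto simp: A_def D_def)
    then show ?thesis by blast
  qed
  have ne: "D ` A m \<noteq> {}" for m using ex[of 1 m] by auto
  have \<delta>R: "\<delta> m \<le> R" for m
  proof (rule field_le_epsilon)
    fix e :: real assume "0 < e"
    then obtain y where "y \<in> A m" "D y \<le> R + e" using ex by blast
    then show "\<delta> m \<le> R + e" unfolding \<delta>_def using cInf_lower[OF imageI bdd] by (meson order_trans)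
  qed
  have dec: "A k \<subseteq> A m" if "m \<le> k" for m k
  proof -
    have "1 / real (Suc k) \<le> 1 / real (Suc m)" using that by (intro frac_le) auto
    then show ?thesis by (auto simp: A_def)
  qed
  have inc: "\<delta> m \<le> \<delta> k" if "m \<le> k" for m k
    unfolding \<delta>_def by (rule cInf_superset_mono[OF ne bdd image_mono[OF dec[OF that]]])
  have "incseq \<delta>" using inc by (simp add: incseq_def)
  then obtain \<delta>' where \<delta>': "\<delta> \<longlonglongrightarrow> \<delta>'" "\<And>m. \<delta> m \<le> \<delta>'" using incseq_convergent[of \<delta> R] \<delta>R by blast
  have "\<exists>y\<in>A m. D y < \<delta> m + 1 / real (Suc m)" for m
    using cInf_lessD[OF ne[of m], of "\<delta> m + 1 / real (Suc m)"] by (auto simp: \<delta>_def)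
  then obtain y where y: "\<And>m. y m \<in> A m" "\<And>m. D (y m) < \<delta> m + 1 / real (Suc m)" by metis
  have yC: "y m \<in> Cc_infinity \<Omega>" for m using y(1) by (simp add: A_def)
  have par: "sqnorm \<Omega> (\<lambda>x. grad (y k) x - grad (y m) x) \<le> 2 * (\<delta>' - \<delta> m) + 4 / real (Suc m)" if mk: "m \<le> k" for m k
  proof -
    let ?z = "\<lambda>x. (1/2) * (y k x + y m x)"
    have yk: "y k \<in> A m" using y(1) dec[OF mk] by blast
    have "?z \<in> A m" unfolding A_def
    proof (intro CollectI conjI)
      show "?z \<in> Cc_infinity \<Omega>" by (rule Cc_infinity_midpoint[OF yC yC])
      have "4 * sqnorm \<Omega> (\<lambda>x. (1/2) *\<^sub>R ((y k x - w x) + (y m x - w x))) \<le> 2 * sqnorm \<Omega> (\<lambda>x. y k x - w x) + 2 * sqnorm \<Omega> (\<lambda>x. y m x - w x)"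
        using sqnorm_parallelogram[OF L2_diff[OF Lf[OF yC[of k]] w] L2_diff[OF Lf[OF yC[of m]] w]]
          sqnorm_nonneg[of \<Omega> "\<lambda>x. (y k x - w x) - (y m x - w x)"] by linarith
      also have "\<dots> \<le> 4 * (1 / real (Suc m))" using yk y(1)[of m] by (simp add: A_def)
      finally have "sqnorm \<Omega> (\<lambda>x. (1/2) *\<^sub>R ((y k x - w x) + (y m x - w x))) \<le> 1 / real (Suc m)" by simp
      moreover have "(\<lambda>x. (1/2) *\<^sub>R ((y k x - w x) + (y m x - w x))) = (\<lambda>x. (1/2) * (y k x + y m x) - w x)"
        by (auto simp: field_simps)
      ultimately show "sqnorm \<Omega> (\<lambda>x. (1/2) * (y k x + y m x) - w x) \<le> 1 / real (Suc m)" by simp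
    qed
    then have "\<delta> m \<le> D ?z" unfolding \<delta>_def by (intro cInf_lower[OF _ bdd]) auto
    moreover have "D ?z = sqnorm \<Omega> (\<lambda>x. (1/2) *\<^sub>R (grad (y k) x + grad (y m) x))"
      unfolding D_def grad_midpoint[OF C1[OF yC] C1[OF yC], abs_def] ..
    ultimately have "sqnorm \<Omega> (\<lambda>x. grad (y k) x - grad (y m) x) \<le> 2 * D (y k) + 2 * D (y m) - 4 * \<delta> m"
      using sqnorm_parallelogram[OF Lg[OF yC[of k]] Lg[OF yC[of m]]] unfolding D_def by linarith
    moreover have "1 / real (Suc k) \<le> 1 / real (Suc m)" using mk by (intro frac_le) auto
    moreover have "4 / real (Suc m) = 4 * (1 / real (Suc m))" by simp
    ultimately show ?thesis using y(2)[of k] y(2)[of m] \<delta>'(2)[of k] by argo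
  qed
  have inv0: "(\<lambda>m. 1 / real (Suc m)) \<longlonglongrightarrow> 0" using LIMSEQ_inverse_real_of_nat by (simp add: inverse_eq_divide)
  have "(\<lambda>m. 2 * (\<delta>' - \<delta> m) + 4 * (1 / real (Suc m))) \<longlonglongrightarrow> 2 * (\<delta>' - \<delta>') + 4 * 0"
    by (intro tendsto_intros \<delta>'(1) inv0)
  then have bd0: "(\<lambda>m. 2 * (\<delta>' - \<delta> m) + 4 / real (Suc m)) \<longlonglongrightarrow> 0" by simp
  obtain G where G: "L2_on \<Omega> G" "(\<lambda>k. sqnorm \<Omega> (\<lambda>x. grad (y k) x - G x)) \<longlonglongrightarrow> 0"
  proof (rule L2_complete[OF \<Omega>, of "\<lambda>k. grad (y k)"])
    show "L2_on \<Omega> (grad (y k))" for k by (rule Lg[OF yC])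
    fix e :: real assume "e > 0"
    then have "\<forall>\<^sub>F m in sequentially. 2 * (\<delta>' - \<delta> m) + 4 / real (Suc m) < e" using order_tendstoD(2)[OF bd0] by blast
    then obtain N where N: "\<And>m. N \<le> m \<Longrightarrow> 2 * (\<delta>' - \<delta> m) + 4 / real (Suc m) < e" unfolding eventually_sequentially by blast
    show "\<exists>N. \<forall>m\<ge>N. \<forall>k\<ge>m. sqnorm \<Omega> (\<lambda>x. grad (y k) x - grad (y m) x) \<le> e"
    proof (intro exI[of _ N] allI impI)
      fix m k assume "N \<le> m" "m \<le> k"
      then show "sqnorm \<Omega> (\<lambda>x. grad (y k) x - grad (y m) x) \<le> e" using par[of m k] N[of m] by linarith
    qed
  qed blast
  have ylim: "(\<lambda>k. sqnorm \<Omega> (\<lambda>x. y k x - w x)) \<longlonglongrightarrow> 0"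
  proof (rule Lim_null_comparison[OF _ inv0])
    show "\<forall>\<^sub>F k in sequentially. norm (sqnorm \<Omega> (\<lambda>x. y k x - w x)) \<le> 1 / real (Suc k)"
    proof (intro always_eventually allI)
      fix k
      have "sqnorm \<Omega> (\<lambda>x. y k x - w x) \<le> 1 / real (Suc k)" using y(1)[of k] unfolding A_def by blast
      then show "norm (sqnorm \<Omega> (\<lambda>x. y k x - w x)) \<le> 1 / real (Suc k)"
        using sqnorm_nonneg[of \<Omega> "\<lambda>x. y k x - w x"] unfolding real_norm_def by linarith
    qed
  qed
  have "(LINT x|lebesgue_on \<Omega>. w x * ddir b \<phi> x) = - (LINT x|lebesgue_on \<Omega>. (G x \<bullet> b) * \<phi> x)"
    if \<phi>: "\<phi> \<in> Cc_infinity \<Omega>" and b: "b \<in> Basis" for \<phi> b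
  proof -
    have c: "continuous_on UNIV (ddir b \<phi>)" using C1[OF \<phi>] by simp
    have l1: "(\<lambda>k. LINT x|lebesgue_on \<Omega>. y k x * ddir b \<phi> x) \<longlonglongrightarrow> (LINT x|lebesgue_on \<Omega>. w x * ddir b \<phi> x)"
      by (rule L2_tendsto_integral[OF \<Omega> Lf[OF yC] w ylim c ddir_support[OF cs[OF \<phi>]]])
    have gl: "(\<lambda>k. sqnorm \<Omega> (\<lambda>x. grad (y k) x \<bullet> b - G x \<bullet> b)) \<longlonglongrightarrow> 0"
    proof (rule Lim_null_comparison[OF _ G(2)], rule always_eventually, rule allI)
      fix k
      have L: "L2_on \<Omega> (\<lambda>x. grad (y k) x - G x)" by (rule L2_diff[OF Lg[OF yC] G(1)])
      have "sqnorm \<Omega> (\<lambda>x. (grad (y k) x - G x) \<bullet> b) \<le> sqnorm \<Omega> (\<lambda>x. grad (y k) x - G x)"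
        unfolding sqnorm_def
        by (intro integral_mono L2_sq_integrable[OF L] L2_sq_integrable[OF L2_inner[OF L b]])
           (auto simp: abs_le_square_iff[symmetric] Basis_le_norm[OF b])
      then show "norm (sqnorm \<Omega> (\<lambda>x. grad (y k) x \<bullet> b - G x \<bullet> b)) \<le> sqnorm \<Omega> (\<lambda>x. grad (y k) x - G x)"
        using sqnorm_nonneg[of \<Omega> "\<lambda>x. grad (y k) x \<bullet> b - G x \<bullet> b"] by (simp add: inner_diff_left)
    qed
    have l2: "(\<lambda>k. LINT x|lebesgue_on \<Omega>. (grad (y k) x \<bullet> b) * \<phi> x) \<longlonglongrightarrow> (LINT x|lebesgue_on \<Omega>. (G x \<bullet> b) * \<phi> x)"
      by (rule L2_tendsto_integral[OF \<Omega> L2_inner[OF Lg[OF yC] b] L2_inner[OF G(1) b] gl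
            Cc_infinity_continuous[OF \<phi>] cs[OF \<phi>]])
    have "(\<lambda>k. LINT x|lebesgue_on \<Omega>. y k x * ddir b \<phi> x) = (\<lambda>k. - (LINT x|lebesgue_on \<Omega>. (grad (y k) x \<bullet> b) * \<phi> x))"
      by (rule ext) (rule has_L2_gradientD[OF C1_has_L2_gradient[OF \<Omega> C1[OF yC] cs[OF yC]] \<phi> b])
    with l1 have "(\<lambda>k. - (LINT x|lebesgue_on \<Omega>. (grad (y k) x \<bullet> b) * \<phi> x)) \<longlonglongrightarrow> (LINT x|lebesgue_on \<Omega>. w x * ddir b \<phi> x)"
      by (simp only:)
    from LIMSEQ_unique[OF this tendsto_minus[OF l2]] show ?thesis .
  qed
  then have wG: "has_L2_gradient \<Omega> w G" unfolding has_L2_gradient_def using w G(1) by (intro conjI ballI)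
  then have wH: "w \<in> H12 \<Omega>" unfolding H12_def by blast
  show "w \<in> H12_0 \<Omega>" unfolding H12_0_def H12_closure_def
  proof (intro CollectI conjI wH allI impI)
    fix e :: real assume "e > 0"
    then have e2: "e\<^sup>2 / 2 > 0" by simp
    have "\<forall>\<^sub>F k in sequentially. sqnorm \<Omega> (\<lambda>x. y k x - w x) < e\<^sup>2 / 2 \<and> sqnorm \<Omega> (\<lambda>x. grad (y k) x - G x) < e\<^sup>2 / 2"
      using order_tendstoD(2)[OF ylim e2] order_tendstoD(2)[OF G(2) e2] by (rule eventually_conj)
    then obtain k where k: "sqnorm \<Omega> (\<lambda>x. y k x - w x) < e\<^sup>2 / 2" "sqnorm \<Omega> (\<lambda>x. grad (y k) x - G x) < e\<^sup>2 / 2"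
      by (auto simp: eventually_sequentially)
    have yk: "has_L2_gradient \<Omega> (y k) (grad (y k))" by (rule C1_has_L2_gradient[OF \<Omega> C1[OF yC] cs[OF yC]])
    have dg: "has_L2_gradient \<Omega> (\<lambda>x. w x - y k x) (\<lambda>x. G x - grad (y k) x)"
      by (rule has_L2_gradient_diff[OF wG yk \<Omega>])
    then have "(\<lambda>x. w x - y k x) \<in> H12 \<Omega>" unfolding H12_def by blast
    then have wg: "has_L2_gradient \<Omega> (\<lambda>x. w x - y k x) (weak_grad \<Omega> (\<lambda>x. w x - y k x))" by (rule weak_grad)
    have "sqnorm \<Omega> (weak_grad \<Omega> (\<lambda>x. w x - y k x)) = sqnorm \<Omega> (\<lambda>x. G x - grad (y k) x)"
      by (rule sqnorm_cong_AE[OF has_L2_gradient_unique[OF wg dg \<Omega>]]) (use wg dg in \<open>auto simp: has_L2_gradient_def\<close>)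
    then have "(LINT x|lebesgue_on \<Omega>. (norm (weak_grad \<Omega> (\<lambda>x. w x - y k x) x))\<^sup>2) < e\<^sup>2 / 2"
      using k(2) unfolding sqnorm_def by (simp add: norm_minus_commute)
    moreover have "(LINT x|lebesgue_on \<Omega>. (w x - y k x)\<^sup>2) < e\<^sup>2 / 2"
      using k(1) unfolding sqnorm_def by (simp add: power2_commute)
    ultimately have "H12_norm \<Omega> (\<lambda>x. w x - y k x) < sqrt (e\<^sup>2)"
      unfolding H12_norm_def by (intro real_sqrt_less_mono) linarith
    then have "H12_norm \<Omega> (\<lambda>x. w x - y k x) < e" using \<open>e > 0\<close> by simp
    moreover have "y k \<in> Cc_infinity \<Omega> \<inter> H12 \<Omega>" using yC yk unfolding H12_def by blast
    ultimately show "\<exists>\<phi>\<in>Cc_infinity \<Omega> \<inter> H12 \<Omega>. H12_norm \<Omega> (\<lambda>x. w x - \<phi> x) < e" by blast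
  qed
  have "sqnorm \<Omega> (weak_grad \<Omega> w) = sqnorm \<Omega> G"
    by (rule sqnorm_cong_AE[OF has_L2_gradient_unique[OF weak_grad[OF wH] wG \<Omega>]])
       (use weak_grad[OF wH] G(1) in \<open>auto simp: has_L2_gradient_def\<close>)
  moreover have "sqnorm \<Omega> G \<le> R"
  proof (rule field_le_epsilon)
    fix e :: real assume "e > 0"
    have R: "0 \<le> R"
    proof (rule field_le_epsilon)
      fix e :: real assume "0 < e"
      then obtain z where "D z \<le> R + e" using ex by blast
      then show "0 \<le> R + e" using sqnorm_nonneg[of \<Omega> "grad z"] unfolding D_def by linarith
    qed
    define t where "t = e / (R + 1)"
    have t: "t > 0" using R \<open>e > 0\<close> by (simp add: t_def)
    have step: "sqnorm \<Omega> G \<le> (1 + t) * (R + 1 / real (Suc k)) + (1 + 1 / t) * sqnorm \<Omega> (\<lambda>x. grad (y k) x - G x)" for k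
    proof -
      have L: "L2_on \<Omega> (\<lambda>x. G x - grad (y k) x)" by (rule L2_diff[OF G(1) Lg[OF yC]])
      have "sqnorm \<Omega> (\<lambda>x. grad (y k) x + (G x - grad (y k) x)) \<le> (1 + t) * sqnorm \<Omega> (grad (y k)) + (1 + 1 / t) * sqnorm \<Omega> (\<lambda>x. G x - grad (y k) x)"
        by (rule sqnorm_add_le[OF Lg[OF yC] L _ t]) (use G(1) in simp)
      moreover have "sqnorm \<Omega> (grad (y k)) \<le> R + 1 / real (Suc k)" using y(2)[of k] \<delta>R[of k] unfolding D_def by linarith
      then have "(1 + t) * sqnorm \<Omega> (grad (y k)) \<le> (1 + t) * (R + 1 / real (Suc k))" using t by (intro mult_left_mono) auto
      moreover have "sqnorm \<Omega> (\<lambda>x. G x - grad (y k) x) = sqnorm \<Omega> (\<lambda>x. grad (y k) x - G x)"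
        unfolding sqnorm_def by (simp add: norm_minus_commute)
      ultimately show ?thesis by simp
    qed
    have "(\<lambda>k. (1 + t) * (R + 1 / real (Suc k)) + (1 + 1 / t) * sqnorm \<Omega> (\<lambda>x. grad (y k) x - G x)) \<longlonglongrightarrow> (1 + t) * (R + 0) + (1 + 1 / t) * 0"
      by (intro tendsto_intros inv0 G(2))
    from LIMSEQ_le_const[OF this] step have "sqnorm \<Omega> G \<le> (1 + t) * (R + 0) + (1 + 1 / t) * 0" by blast
    also have "\<dots> = R + t * R" by (simp add: distrib_right)
    also have "t * R \<le> e" using R \<open>e > 0\<close> by (simp add: t_def field_simps)
    finally show "sqnorm \<Omega> G \<le> R + e" by simp
  qed
  ultimately show "sqnorm \<Omega> (weak_grad \<Omega> w) \<le> R" by simp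
qed

lemma sqnorm_le_const:
  fixes a :: "'a::euclidean_space \<Rightarrow> 'b::euclidean_space"
  assumes \<Omega>: "open \<Omega>" "bounded \<Omega>" and a: "L2_on \<Omega> a" "\<And>x. x \<in> \<Omega> \<Longrightarrow> (norm (a x))\<^sup>2 \<le> c"
  shows "sqnorm \<Omega> a \<le> measure lebesgue \<Omega> * c"
proof -
  interpret finite_measure "lebesgue_on \<Omega>" by (rule finite_measure_lebesgue_on_open[OF \<Omega>])
  have "sqnorm \<Omega> a \<le> (LINT x|lebesgue_on \<Omega>. c)" unfolding sqnorm_def
    by (rule integral_mono[OF L2_sq_integrable[OF a(1)]]) (use a(2) in \<open>auto simp: space_restrict_space\<close>)
  also have "\<dots> = measure lebesgue \<Omega> * c"
    using measure_lebesgue_on_open[OF \<Omega>(1) subset_refl] by (simp add: space_restrict_space)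
  finally show ?thesis .
qed

lemma L2_add:
  fixes f g :: "'a::euclidean_space \<Rightarrow> 'b::euclidean_space"
  assumes "L2_on \<Omega> f" "L2_on \<Omega> g" shows "L2_on \<Omega> (\<lambda>x. f x + g x)"
proof -
  have "L2_on \<Omega> (\<lambda>x. - g x)" using assms(2) by (simp add: L2_on_def)
  from L2_diff[OF assms(1) this] show ?thesis by simp
qed

text \<open>
  \<open>C\<^sup>1\<close> functions with compact support suffice, because mollification approximates their values and gradients uniformly.
\<close>

lemma H12_0_closed_C1:
  fixes w :: "'a::euclidean_space \<Rightarrow> real"
  assumes \<Omega>: "open \<Omega>" "bounded \<Omega>" and w: "L2_on \<Omega> w"
    and approx: "\<And>e. 0 < e \<Longrightarrow> \<exists>f. Ck 1 f \<and> compactly_supported_in \<Omega> f \<and> sqnorm \<Omega> (\<lambda>x. f x - w x) \<le> e \<and> sqnorm \<Omega> (grad f) \<le> R"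
  shows "w \<in> H12_0 \<Omega>" and "sqnorm \<Omega> (weak_grad \<Omega> w) \<le> R"
proof -
  have "\<exists>y\<in>Cc_infinity \<Omega>. sqnorm \<Omega> (\<lambda>x. y x - w x) \<le> e \<and> sqnorm \<Omega> (grad y) \<le> R + e" if e: "0 < e" for e
  proof -
    have "0 < e / 4" using e by simp
    from approx[OF this] obtain f where f: "Ck 1 f" "compactly_supported_in \<Omega> f" "sqnorm \<Omega> (\<lambda>x. f x - w x) \<le> e / 4" "sqnorm \<Omega> (grad f) \<le> R"
      by blast
    have R: "0 \<le> R" using f(4) sqnorm_nonneg[of \<Omega> "grad f"] by linarith
    define V where "V = measure lebesgue \<Omega>"
    have V: "0 \<le> V" by (simp add: V_def)
    define t where "t = e / (2 * (R + 1))"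
    have t: "0 < t" using e R by (simp add: t_def)
    define c where "c = V * (1 + (1 + 1 / t) * real DIM('a))"
    have c: "0 \<le> c" using V t by (simp add: c_def)
    (* a uniform error eta in values and partial derivatives costs at most eta^2 * c, that is e/4 *)
    define \<eta> where "\<eta> = sqrt (e / (4 * (c + 1)))"
    have \<eta>: "0 < \<eta>" using e c by (simp add: \<eta>_def)
    have "\<eta>\<^sup>2 = e / (4 * (c + 1))" using e c by (simp add: \<eta>_def)
    then have "\<eta>\<^sup>2 * (c + 1) = e / 4" using c by (simp add: field_simps)
    then have \<eta>c: "\<eta>\<^sup>2 * c \<le> e / 4" using zero_le_power2[of \<eta>] unfolding distrib_left mult_1_right by linarith
    from smooth_approx_uniform[OF Ck_1_continuous[OF f(1)] f(2) \<Omega>(1) \<eta>, of Basis] f(1)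
    obtain y where y: "y \<in> Cc_infinity \<Omega>" "\<And>x. \<bar>y x - f x\<bar> \<le> \<eta>" "\<And>b x. b \<in> Basis \<Longrightarrow> \<bar>ddir b y x - ddir b f x\<bar> \<le> \<eta>"
      using finite_Basis by meson
    note yC = Cc_infinityD(1)[OF y(1), of 1] Cc_infinityD(2)[OF y(1)]
    have gf: "has_L2_gradient \<Omega> f (grad f)" and gy: "has_L2_gradient \<Omega> y (grad y)"
      by (rule C1_has_L2_gradient[OF \<Omega> f(1,2)], rule C1_has_L2_gradient[OF \<Omega> yC])
    have L: "L2_on \<Omega> f" "L2_on \<Omega> (grad f)" "L2_on \<Omega> y" "L2_on \<Omega> (grad y)"
      using gf gy by (auto simp: has_L2_gradient_def)
    have a: "sqnorm \<Omega> (\<lambda>x. y x - f x) \<le> V * \<eta>\<^sup>2" unfolding V_def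
    proof (rule sqnorm_le_const[OF \<Omega> L2_diff[OF L(3,1)]])
      show "(norm (y x - f x))\<^sup>2 \<le> \<eta>\<^sup>2" for x using y(2)[of x] by (intro power_mono) auto
    qed
    have b: "sqnorm \<Omega> (\<lambda>x. grad y x - grad f x) \<le> V * (real DIM('a) * \<eta>\<^sup>2)" unfolding V_def
    proof (rule sqnorm_le_const[OF \<Omega> L2_diff[OF L(4,2)]])
      fix x
      have "(norm (grad y x - grad f x))\<^sup>2 = (\<Sum>b\<in>Basis. ((grad y x - grad f x) \<bullet> b)\<^sup>2)"
        unfolding power2_norm_eq_inner by (subst euclidean_inner) (simp add: power2_eq_square)
      also have "\<dots> \<le> (\<Sum>b\<in>(Basis::'a set). \<eta>\<^sup>2)"
      proof (rule sum_mono)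
        fix b :: 'a assume b: "b \<in> Basis"
        then have "\<bar>(grad y x - grad f x) \<bullet> b\<bar> \<le> \<eta>" using y(3)[OF b, of x] by (simp add: inner_diff_left grad_inner)
        then show "((grad y x - grad f x) \<bullet> b)\<^sup>2 \<le> \<eta>\<^sup>2" using \<eta> by (simp add: abs_le_square_iff[symmetric])
      qed
      finally show "(norm (grad y x - grad f x))\<^sup>2 \<le> real DIM('a) * \<eta>\<^sup>2" by simp
    qed
    have "sqnorm \<Omega> (\<lambda>x. (f x - w x) + (y x - f x)) \<le> (1 + 1) * sqnorm \<Omega> (\<lambda>x. f x - w x) + (1 + 1 / 1) * sqnorm \<Omega> (\<lambda>x. y x - f x)"
      by (intro sqnorm_add_le L2_add L2_diff L w) simp
    also have "\<dots> \<le> e / 2 + 2 * (V * \<eta>\<^sup>2)" using f(3) a by simp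
    also have "V * \<eta>\<^sup>2 \<le> \<eta>\<^sup>2 * c" using V t unfolding c_def by (simp add: algebra_simps)
    also note \<eta>c
    finally have 1: "sqnorm \<Omega> (\<lambda>x. y x - w x) \<le> e" by simp
    have "sqnorm \<Omega> (\<lambda>x. grad f x + (grad y x - grad f x)) \<le> (1 + t) * sqnorm \<Omega> (grad f) + (1 + 1 / t) * sqnorm \<Omega> (\<lambda>x. grad y x - grad f x)"
      by (intro sqnorm_add_le L2_add L2_diff L t)
    also have "\<dots> \<le> (1 + t) * R + (1 + 1 / t) * (V * (real DIM('a) * \<eta>\<^sup>2))"
      using f(4) b t by (intro add_mono mult_left_mono) auto
    also have "(1 + 1 / t) * (V * (real DIM('a) * \<eta>\<^sup>2)) \<le> \<eta>\<^sup>2 * c" using V unfolding c_def by (simp add: algebra_simps)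
    also note \<eta>c
    also have "(1 + t) * R \<le> R + e / 2" using R e unfolding t_def by (simp add: field_simps)
    finally have 2: "sqnorm \<Omega> (grad y) \<le> R + e" using e by simp
    show ?thesis using y(1) 1 2 by blast
  qed
  from H12_0_closed[OF \<Omega> w this] show "w \<in> H12_0 \<Omega>" "sqnorm \<Omega> (weak_grad \<Omega> w) \<le> R" by blast+
qed

section \<open>The Schwarz symmetrization\<close>

lemma symmetrized_ball_eq:
  assumes "0 < measure lebesgue (\<Omega> :: 'a::euclidean_space set)"
  shows "symmetrized_ball \<Omega> = {x::'a. ball_vol x < measure lebesgue \<Omega>}"
  unfolding symmetrized_ball_def
  by (rule set_eqI) (simp only: mem_Collect_eq mem_ball_0 ball_vol_less_iff(1)[OF assms])

lemma schwarz_eq: "schwarz_symmetrization \<Omega> u x = decreasing_rearrangement \<Omega> u (ball_vol x)"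
  by (simp add: schwarz_symmetrization_def ball_vol_def)

lemma ball_vol_pos: "x \<noteq> 0 \<Longrightarrow> 0 < ball_vol (x::'a::euclidean_space)"
  by (simp add: ball_vol_def)

lemma less_rearrangement_iff:
  fixes \<Omega> :: "'a::euclidean_space set" and u :: "'a \<Rightarrow> real"
  assumes \<Omega>: "open \<Omega>" "bounded \<Omega>" and u: "u \<in> borel_measurable (lebesgue_on \<Omega>)" "AE x in lebesgue_on \<Omega>. u x \<ge> 0"
    and s: "0 < s" "s < measure lebesgue \<Omega>"
  shows "t < decreasing_rearrangement \<Omega> u s \<longleftrightarrow> s < distribution_fun \<Omega> u t"
proof -
  let ?M = "lebesgue_on \<Omega>"
  interpret finite_measure ?M by (rule finite_measure_lebesgue_on_open[OF \<Omega>])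
  note u(1)[measurable]
  define S where "S = {t. distribution_fun \<Omega> u t \<le> s}"
  have sp: "space ?M = \<Omega>" by (simp add: space_restrict_space)
  have df: "distribution_fun \<Omega> u t = measure ?M {x \<in> space ?M. u x > t}" for t
    unfolding distribution_fun_def sp by (rule measure_lebesgue_on_open[OF \<Omega>(1), symmetric]) auto
  have ms: "{x \<in> space ?M. u x > t} \<in> sets ?M" for t by measurable
  have anti: "distribution_fun \<Omega> u t' \<le> distribution_fun \<Omega> u t" if "t \<le> t'" for t t'
    unfolding df by (rule finite_measure_mono[OF _ ms]) (use that in auto)
  have neg: "distribution_fun \<Omega> u t = measure lebesgue \<Omega>" if "t < 0" for t
  proof -
    have "measure ?M {x \<in> space ?M. u x > t} = measure ?M (space ?M)"
    proof (rule measure_eq_AE)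
      show "AE x in ?M. (x \<in> {x \<in> space ?M. t < u x}) = (x \<in> space ?M)"
        using u(2) by eventually_elim (use that in auto)
    qed (rule ms, rule sets.top)
    then show ?thesis unfolding df using measure_lebesgue_on_open[OF \<Omega>(1) subset_refl] by (simp add: sp)
  qed
  have bdd: "bdd_below S"
  proof (rule bdd_belowI[of _ 0])
    fix t assume "t \<in> S"
    then show "0 \<le> t" using neg[of t] s by (cases "t < 0") (auto simp: S_def)
  qed
  have ne: "S \<noteq> {}"
  proof -
    obtain t where "measure ?M {x \<in> space ?M. u x > t} < s"
      by (rule superlevel_measure_small[OF finite_measure_axioms u(1) s(1)])
    then have "t \<in> S" unfolding S_def df by simp
    then show ?thesis by blast
  qed
  have dr: "decreasing_rearrangement \<Omega> u s = Inf S" by (simp add: decreasing_rearrangement_def S_def)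
  show ?thesis
  proof
    assume "t < decreasing_rearrangement \<Omega> u s"
    then have "t \<notin> S" using cInf_lower[OF _ bdd] unfolding dr by force
    then show "s < distribution_fun \<Omega> u t" by (simp add: S_def)
  next
    assume lt: "s < distribution_fun \<Omega> u t"
    obtain t' where t': "t < t'" "s < distribution_fun \<Omega> u t'"
      unfolding df by (rule superlevel_measure_right_continuous[OF finite_measure_axioms u(1) lt[unfolded df]])
    have "t' \<le> Inf S"
    proof (rule cInf_greatest[OF ne])
      fix r assume "r \<in> S"
      then show "t' \<le> r" using anti[of r t'] t'(2) by (cases "r \<le> t'") (auto simp: S_def)
    qed
    then show "t < decreasing_rearrangement \<Omega> u s" using t'(1) unfolding dr by simp
  qed
qed

text \<open>
  The symmetrization has the same distribution function as \<open>u\<close>: both push Lebesgue measure forward to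
  the same measure on the line, hence their squares have the same integral.
\<close>

lemma schwarz_L2:
  fixes \<Omega> :: "'a::euclidean_space set" and u :: "'a \<Rightarrow> real"
  assumes \<Omega>: "open \<Omega>" "bounded \<Omega>" and pos: "0 < measure lebesgue \<Omega>"
    and u: "L2_on \<Omega> u" "AE x in lebesgue_on \<Omega>. u x \<ge> 0"
  shows "L2_on (symmetrized_ball \<Omega>) (schwarz_symmetrization \<Omega> u)"
proof -
  let ?M = "lebesgue_on \<Omega>" and ?v = "schwarz_symmetrization \<Omega> u"
  define V where "V = measure lebesgue \<Omega>"
  define B where "B = symmetrized_ball \<Omega>"
  have Beq: "B = {x. ball_vol x < V}" unfolding B_def V_def by (rule symmetrized_ball_eq[OF pos])
  have oB: "open B" unfolding B_def symmetrized_ball_def by simp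
  interpret finite_measure ?M by (rule finite_measure_lebesgue_on_open[OF \<Omega>])
  have um[measurable]: "u \<in> borel_measurable ?M" using u(1) by (rule L2_meas)
  have sp: "space ?M = \<Omega>" "space (lebesgue_on B) = B" by (simp_all add: space_restrict_space)
  let ?\<mu> = "distribution_fun \<Omega> u"
  have \<mu>V: "?\<mu> t \<le> V" for t
    unfolding distribution_fun_def V_def
  proof (rule measure_mono_fmeasurable)
    have "{x \<in> space ?M. t < u x} \<in> sets ?M" by measurable
    then show "{x \<in> \<Omega>. t < u x} \<in> sets lebesgue" using sets_lebesgue_on_open_iff[OF \<Omega>(1)] unfolding sp by blast
  qed (use \<Omega> lmeasurable_open in auto)
  (* the value at the centre is arbitrary, so the origin is removed *)
  have level: "{x \<in> B. t < ?v x} - {0} = {x. ball_vol x < ?\<mu> t} - {0}" for t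
  proof -
    have "(x \<in> B \<and> t < ?v x) \<longleftrightarrow> ball_vol x < ?\<mu> t" if "x \<noteq> 0" for x :: 'a
    proof (cases "x \<in> B")
      case True
      then show ?thesis unfolding schwarz_eq
        using less_rearrangement_iff[OF \<Omega> um u(2) ball_vol_pos[OF that]] by (simp add: Beq V_def)
    next
      case False
      then show ?thesis using \<mu>V[of t] by (simp add: Beq)
    qed
    then show ?thesis by blast
  qed
  have borel: "{x. ball_vol x < c} \<in> sets borel" for c
  proof -
    have "{x \<in> space borel. ball_vol x < c} \<in> sets borel" by measurable
    then show ?thesis by simp
  qed
  have lev_borel: "{x \<in> B. t < ?v x} \<in> sets borel" for t
  proof -
    have e: "{x \<in> B. t < ?v x} = ({x. ball_vol x < ?\<mu> t} - {0}) \<union> ({x \<in> B. t < ?v x} \<inter> {0})"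
      unfolding level[symmetric] by blast
    have s2: "{x \<in> B. t < ?v x} \<inter> {0} \<in> sets borel" by (cases "0 \<in> B \<and> t < ?v 0") auto
    have "({x. ball_vol x < ?\<mu> t} - {0}) \<union> ({x \<in> B. t < ?v x} \<inter> {0}) \<in> sets borel"
      by (intro sets.Un sets.Diff borel s2 borel_closed[OF closed_singleton])
    then show ?thesis unfolding e[symmetric] .
  qed
  have vm[measurable]: "?v \<in> borel_measurable (lebesgue_on B)"
    unfolding borel_measurable_iff_greater sp
  proof
    fix t show "{x \<in> B. t < ?v x} \<in> sets (lebesgue_on B)"
      unfolding sets_lebesgue_on_open_iff[OF oB] using lev_borel[of t] by auto
  qed
  have em: "emeasure (distr (lebesgue_on B) borel ?v) {t<..} = ennreal (?\<mu> t)" for t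
  proof -
    have "emeasure (distr (lebesgue_on B) borel ?v) {t<..} = emeasure (lebesgue_on B) {x \<in> B. t < ?v x}"
      by (subst emeasure_distr) (auto simp: sp vimage_def Int_def conj_commute)
    also have "\<dots> = emeasure lebesgue {x \<in> B. t < ?v x}"
      by (rule emeasure_restrict_space) (use oB in auto)
    also have "\<dots> = emeasure lborel {x \<in> B. t < ?v x}" using lev_borel by simp
    also have "\<dots> = emeasure lborel ({x \<in> B. t < ?v x} - {0})"
      using lev_borel by (subst emeasure_Diff_null_set) auto
    also have "\<dots> = emeasure lborel {x::'a. ball_vol x < ?\<mu> t}"
      unfolding level using borel by (subst emeasure_Diff_null_set) auto
    finally show ?thesis unfolding emeasure_ball_vol_less .
  qed
  have emu: "emeasure (distr ?M borel u) {t<..} = ennreal (?\<mu> t)" for t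
  proof -
    have "emeasure (distr ?M borel u) {t<..} = emeasure ?M {x \<in> \<Omega>. t < u x}"
      by (subst emeasure_distr) (auto simp: sp vimage_def Int_def conj_commute)
    also have "\<dots> = ennreal (?\<mu> t)"
      unfolding emeasure_eq_measure distribution_fun_def by (subst measure_lebesgue_on_open[OF \<Omega>(1)]) auto
    finally show ?thesis .
  qed
  have "distr (lebesgue_on B) borel ?v = distr ?M borel u"
    by (rule measure_eqI_lessThan) (simp_all add: em emu)
  moreover have "integrable (distr ?M borel u) (\<lambda>y. y\<^sup>2)"
    using L2_sq_integrable[OF u(1)] by (subst integrable_distr_eq) auto
  ultimately have "integrable (distr (lebesgue_on B) borel ?v) (\<lambda>y. y\<^sup>2)" by simp
  then have "integrable (lebesgue_on B) (\<lambda>x. (?v x)\<^sup>2)" by (subst (asm) integrable_distr_eq) auto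
  then show ?thesis using vm unfolding L2_on_def B_def by simp
qed

text \<open>
  The strip inequality squared, with the Cauchy-Schwarz inequality on the strip.
\<close>

lemma strip_energy_of_closure:
  fixes \<Omega> :: "'a::euclidean_space set" and u :: "'a \<Rightarrow> real"
  assumes \<Omega>: "open \<Omega>" "bounded \<Omega>" and u: "u \<in> H12_closure \<Omega> (Lip_vanishing_near \<Omega> F)"
    and K: "K > 0" and \<alpha>: "\<alpha> \<ge> 0"
    and iso: "\<And>\<phi> t. \<phi> \<in> Lip_vanishing_near \<Omega> F \<Longrightarrow> 0 \<le> t \<Longrightarrow>
          ennreal (measure lebesgue {x \<in> \<Omega>. \<phi> x > t} powr \<alpha>) \<le> ennreal K * perimeter \<Omega> {x \<in> \<Omega>. \<phi> x > t}"
  shows "strip_energy (lebesgue_on \<Omega>) u (\<lambda>x. (norm (weak_grad \<Omega> u x))\<^sup>2) K \<alpha>"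
proof -
  let ?M = "lebesgue_on \<Omega>" and ?G = "weak_grad \<Omega> u"
  interpret finite_measure ?M by (rule finite_measure_lebesgue_on_open[OF \<Omega>])
  have G: "has_L2_gradient \<Omega> u ?G" using u by (intro weak_grad) (simp add: H12_closure_def)
  have [measurable]: "u \<in> borel_measurable ?M" and LG: "L2_on \<Omega> ?G"
    using G by (auto simp: has_L2_gradient_def L2_on_def)
  have sp: "space ?M = \<Omega>" by (simp add: space_restrict_space)
  show ?thesis
  proof unfold_locales
    show "u \<in> borel_measurable ?M" by measurable
    show "integrable ?M (\<lambda>x. (norm (?G x))\<^sup>2)" by (rule L2_sq_integrable[OF LG])
    show "0 \<le> (norm (?G x))\<^sup>2" for x by simp
    show "0 < K" "0 \<le> \<alpha>" by fact+
    fix a b s :: real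
    assume ab: "0 \<le> a" "a < b" "0 \<le> s" and lev: "\<And>t. a < t \<Longrightarrow> t < b \<Longrightarrow> s < measure ?M {x \<in> space ?M. t < u x}"
    define A where "A = {x \<in> space ?M. a < u x \<and> u x < b}"
    have A: "A \<in> sets ?M" unfolding A_def by measurable
    have A\<Omega>: "A \<subseteq> \<Omega>" by (auto simp: A_def sp)
    have ind: "(LINT x|?M. indicator {x. a < u x \<and> u x < b} x * h x) = (LINT x|?M. indicator A x * h x)" for h :: "'a \<Rightarrow> real"
      by (rule Bochner_Integration.integral_cong) (auto simp: A_def indicator_def)
    have "(b - a) * s powr \<alpha> \<le> K * (LINT x|?M. indicator {x. a < u x \<and> u x < b} x * norm (?G x))"
    proof (rule closure_gradient_mass_strip[OF \<Omega> u K \<alpha> iso ab])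
      show "s < measure lebesgue {x \<in> \<Omega>. t < u x}" if "a < t" "t < b" for t
        using lev[OF that] measure_lebesgue_on_open[OF \<Omega>(1), of "{x \<in> \<Omega>. t < u x}"] by (simp add: sp)
    qed
    then have "((b - a) * s powr \<alpha>)\<^sup>2 \<le> (K * (LINT x|?M. indicator A x * norm (?G x)))\<^sup>2"
      unfolding ind using ab by (intro power_mono) auto
    also have "\<dots> = K\<^sup>2 * (LINT x|?M. indicator A x * norm (?G x))\<^sup>2" by (simp add: power_mult_distrib)
    also have "\<dots> \<le> K\<^sup>2 * (measure lebesgue A * (LINT x|?M. indicator A x * (norm (?G x))\<^sup>2))"
      using L1_le_L2(1)[OF \<Omega> L2_norm[OF LG] A] by (intro mult_left_mono) auto
    also have "\<dots> = K\<^sup>2 * measure ?M A * (LINT x|?M. indicator A x * (norm (?G x))\<^sup>2)"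
      using measure_lebesgue_on_open[OF \<Omega>(1) A\<Omega>] by simp
    finally show "((b - a) * s powr \<alpha>)\<^sup>2 \<le> K\<^sup>2 * measure ?M {x \<in> space ?M. a < u x \<and> u x < b} *
        (LINT x|?M. indicator {x. a < u x \<and> u x < b} x * (norm (?G x))\<^sup>2)"
      unfolding ind A_def .
  qed
qed

lemma (in strip_energy) profile_eq_clamp:
  assumes dN: "0 < d" "d < N" and s: "0 < s" and v: "\<And>t. t < v \<longleftrightarrow> s < \<mu> t"
  shows "profile d N s = max d (min N v) - d"
proof -
  let ?r = "trunc_level d N s"
  note r = trunc_level_range[OF dN, of s]
  have iff: "t < ?r \<longleftrightarrow> t < v" if "d \<le> t" "t < N" for t
    using less_trunc_level_iff[OF dN that] v by blast
  have "?r = max d (min N v)"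
  proof (rule antisym)
    show "?r \<le> max d (min N v)"
    proof (rule ccontr)
      assume "\<not> ?thesis"
      then have lt: "max d (min N v) < ?r" by (simp only: not_le)
      then have "max d (min N v) < N" using r by simp
      from iff[OF _ this] lt have "max d (min N v) < v" by simp
      then show False using \<open>max d (min N v) < N\<close> by (simp add: max_def min_def split: if_splits)
    qed
    show "max d (min N v) \<le> ?r"
    proof (rule ccontr)
      assume "\<not> ?thesis"
      then have "?r < max d (min N v)" by (simp only: not_le)
      then have "?r < min N v" using r by (simp add: max_def split: if_splits)
      then show False using iff[of ?r] r by simp
    qed
  qed
  moreover have "max 0 s = s" using s by simp
  ultimately show ?thesis by (simp only: profile_def[OF dN])
qed

text \<open>
  On the punctured ball the profile with cut-offs \<open>d < N\<close> is \<open>max d (min N v) - d\<close>, which lies between \<open>0\<close> and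
  the symmetrization \<open>v\<close>; as \<open>d\<close> tends to \<open>0\<close> and \<open>N\<close> to infinity, dominated convergence applies.
\<close>

lemma schwarz_truncations_converge:
  fixes \<Omega> :: "'a::euclidean_space set" and u :: "'a \<Rightarrow> real"
  assumes \<Omega>: "open \<Omega>" "bounded \<Omega>" and pos: "0 < measure lebesgue \<Omega>"
    and u: "L2_on \<Omega> u" "AE x in lebesgue_on \<Omega>. u x \<ge> 0"
    and S: "strip_energy (lebesgue_on \<Omega>) u g K \<alpha>"
  shows "(\<lambda>k. sqnorm (symmetrized_ball \<Omega>) (\<lambda>x. strip_energy.profile (lebesgue_on \<Omega>) u (1 / real (Suc k)) (real k + 2) (ball_vol x) - schwarz_symmetrization \<Omega> u x)) \<longlonglongrightarrow> 0"
proof -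
  interpret S: strip_energy "lebesgue_on \<Omega>" u g K \<alpha> by fact
  let ?v = "schwarz_symmetrization \<Omega> u"
  define B where "B = symmetrized_ball \<Omega>"
  let ?p = "\<lambda>k x. S.profile (1 / real (Suc k)) (real k + 2) (ball_vol x)"
  have Beq: "B = {x. ball_vol x < measure lebesgue \<Omega>}" unfolding B_def by (rule symmetrized_ball_eq[OF pos])
  have oB: "open B" "bounded B" unfolding B_def symmetrized_ball_def by auto
  have Lv: "L2_on B ?v" unfolding B_def by (rule schwarz_L2[OF \<Omega> pos u])
  have [measurable]: "?v \<in> borel_measurable (lebesgue_on B)" by (rule L2_meas[OF Lv])
  have sp: "space (lebesgue_on B) = B" "space (lebesgue_on \<Omega>) = \<Omega>" by (simp_all add: space_restrict_space)
  have \<mu>: "S.\<mu> t = distribution_fun \<Omega> u t" for t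
    unfolding S.\<mu>_def distribution_fun_def sp by (rule measure_lebesgue_on_open[OF \<Omega>(1)]) auto
  have dN: "0 < 1 / real (Suc k)" "1 / real (Suc k) < real k + 2" for k
  proof -
    show "0 < 1 / real (Suc k)" by simp
    have "1 / real (Suc k) \<le> 1" by simp
    then show "1 / real (Suc k) < real k + 2" using of_nat_0_le_iff[of k, where 'a=real] by linarith
  qed
  have [measurable]: "?p k \<in> borel_measurable (lebesgue_on B)" for k
  proof -
    have "continuous_on UNIV (S.profile (1 / real (Suc k)) (real k + 2))"
      by (intro continuous_at_imp_continuous_on ballI S.continuous_profile dN)
    then have "continuous_on UNIV (?p k)" by (rule continuous_on_compose2[OF _ ball_vol_continuous]) auto
    then show ?thesis by (rule borel_lebesgue_on[OF borel_measurable_continuous_onI])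
  qed
  have clamp: "?p k x = max (1 / real (Suc k)) (min (real k + 2) (?v x)) - 1 / real (Suc k)" and v0: "0 \<le> ?v x"
    if x: "x \<in> B" "x \<noteq> 0" for x k
  proof -
    have s: "0 < ball_vol x" "ball_vol x < measure lebesgue \<Omega>" using x ball_vol_pos by (auto simp: Beq)
    note iff = less_rearrangement_iff[OF \<Omega> L2_meas[OF u(1)] u(2) s]
    show "?p k x = max (1 / real (Suc k)) (min (real k + 2) (?v x)) - 1 / real (Suc k)"
      unfolding schwarz_eq by (rule S.profile_eq_clamp[OF dN s(1)]) (simp add: iff \<mu>)
    show "0 \<le> ?v x"
    proof (rule ccontr)
      assume "\<not> ?thesis"
      then have "?v x / 2 < 0" "\<not> ?v x / 2 < ?v x" by auto
      then have le: "distribution_fun \<Omega> u (?v x / 2) \<le> ball_vol x"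
        using iff[of "?v x / 2"] unfolding schwarz_eq by simp
      have mset: "{y \<in> space (lebesgue_on \<Omega>). u y > ?v x / 2} \<in> sets (lebesgue_on \<Omega>)" by measurable
      have "measure (lebesgue_on \<Omega>) {y \<in> space (lebesgue_on \<Omega>). u y > ?v x / 2} = measure (lebesgue_on \<Omega>) (space (lebesgue_on \<Omega>))"
      proof (rule measure_eq_AE)
        show "AE y in lebesgue_on \<Omega>. (y \<in> {y \<in> space (lebesgue_on \<Omega>). ?v x / 2 < u y}) = (y \<in> space (lebesgue_on \<Omega>))"
          using u(2) by eventually_elim (use \<open>?v x / 2 < 0\<close> in auto)
      qed (rule mset, rule sets.top)
      then have "distribution_fun \<Omega> u (?v x / 2) = measure lebesgue \<Omega>"
        using \<mu>[of "?v x / 2"] measure_lebesgue_on_open[OF \<Omega>(1) subset_refl] unfolding S.\<mu>_def by (simp add: sp)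
      then show False using le s by simp
    qed
  qed
  have "AE x in lebesgue. x \<noteq> (0::'a)" by (rule AE_not_in[of "{0}", simplified]) (simp add: negligible_iff_null_sets[symmetric])
  then have ae: "AE x in lebesgue_on B. x \<noteq> 0" using oB(1) by (subst AE_restrict_space_iff) auto
  have aeB: "AE x in lebesgue_on B. x \<in> B" using AE_space[of "lebesgue_on B"] unfolding sp .
  have "(\<lambda>k. LINT x|lebesgue_on B. (norm (?p k x - ?v x))\<^sup>2) \<longlonglongrightarrow> (LINT x|lebesgue_on B. 0)"
  proof (rule integral_dominated_convergence[where w="\<lambda>x. (norm (?v x))\<^sup>2"])
    show "integrable (lebesgue_on B) (\<lambda>x. (norm (?v x))\<^sup>2)" by (rule L2_sq_integrable[OF Lv])
    show "AE x in lebesgue_on B. (\<lambda>k. (norm (?p k x - ?v x))\<^sup>2) \<longlonglongrightarrow> 0"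
      using ae aeB
    proof eventually_elim
      case (elim x)
      note v0 = v0[OF elim(2,1)] and clamp = clamp[OF elim(2,1)]
      have "(\<lambda>k. ?p k x - ?v x) \<longlonglongrightarrow> 0"
      proof (rule Lim_null_comparison)
        obtain k0 where k0: "?v x < real k0" using reals_Archimedean2 by blast
        show "\<forall>\<^sub>F k in sequentially. norm (?p k x - ?v x) \<le> 1 / real (Suc k)"
          unfolding eventually_sequentially
        proof (intro exI[of _ k0] allI impI)
          fix k assume "k0 \<le> k"
          then have "min (real k + 2) (?v x) = ?v x" using k0 by simp
          then show "norm (?p k x - ?v x) \<le> 1 / real (Suc k)" unfolding clamp using v0 dN(1)[of k] by (auto simp: max_def)
        qed
        show "(\<lambda>k. 1 / real (Suc k)) \<longlonglongrightarrow> 0" using LIMSEQ_inverse_real_of_nat by (simp add: inverse_eq_divide)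
      qed
      then have "(\<lambda>k. (norm (?p k x - ?v x))\<^sup>2) \<longlonglongrightarrow> (norm (0::real))\<^sup>2" by (intro tendsto_intros)
      then show ?case by simp
    qed
    show "AE x in lebesgue_on B. norm ((norm (?p k x - ?v x))\<^sup>2) \<le> (norm (?v x))\<^sup>2" for k
      using ae aeB
    proof eventually_elim
      case (elim x)
      have c: "\<bar>max d (min N v) - d - v\<bar> \<le> \<bar>v\<bar>" if "0 < d" "d < N" "0 \<le> v" for d N v :: real
        using that unfolding max_def min_def by (auto split: if_splits)
      have "\<bar>?p k x - ?v x\<bar> \<le> \<bar>?v x\<bar>"
        unfolding clamp[OF elim(2,1)] by (rule c[OF dN v0[OF elim(2,1)]])
      then show ?case by (simp add: abs_le_square_iff)
    qed
    show "(\<lambda>x. (norm (?p k x - ?v x))\<^sup>2) \<in> borel_measurable (lebesgue_on B)" for k by measurable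
  qed simp
  then show ?thesis unfolding sqnorm_def B_def by simp
qed

text \<open>
  The approximating functions are moving averages of truncated rearrangements, composed with
  \<open>ball_vol\<close>. Integration in radial coordinates turns their energy into the weighted one-dimensional
  energy.
\<close>

lemma schwarz_dirichlet_bound:
  fixes \<Omega> :: "'a::euclidean_space set" and u :: "'a \<Rightarrow> real"
  assumes n: "DIM('a) \<ge> 2" and \<Omega>: "open \<Omega>" "bounded \<Omega>" and pos: "0 < measure lebesgue \<Omega>"
    and u: "L2_on \<Omega> u" "AE x in lebesgue_on \<Omega>. u x \<ge> 0"
    and S: "strip_energy (lebesgue_on \<Omega>) u (\<lambda>x. (norm (G x))\<^sup>2) K (1 - 1 / real DIM('a))"
  defines "B \<equiv> symmetrized_ball \<Omega>"
    and "R \<equiv> (real DIM('a) * unit_ball_vol (real DIM('a)) powr (1 / real DIM('a)) * K)\<^sup>2 * sqnorm \<Omega> G"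
  shows "schwarz_symmetrization \<Omega> u \<in> H12_0 B" "sqnorm B (weak_grad B (schwarz_symmetrization \<Omega> u)) \<le> R"
proof -
  define \<alpha> where "\<alpha> = 1 - 1 / real DIM('a)"
  define \<gamma> where "\<gamma> = real DIM('a) * unit_ball_vol (real DIM('a)) powr (1 / real DIM('a))"
  interpret S: strip_energy "lebesgue_on \<Omega>" u "\<lambda>x. (norm (G x))\<^sup>2" K \<alpha> unfolding \<alpha>_def by (rule S)
  let ?v = "schwarz_symmetrization \<Omega> u"
  have Beq: "B = {x. ball_vol x < measure lebesgue \<Omega>}" unfolding B_def by (rule symmetrized_ball_eq[OF pos])
  have oB: "open B" "bounded B" unfolding B_def symmetrized_ball_def by auto
  have Lv: "L2_on B ?v" unfolding B_def by (rule schwarz_L2[OF \<Omega> pos u])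
  have total: "S.total = measure lebesgue \<Omega>"
    unfolding S.total_def using measure_lebesgue_on_open[OF \<Omega>(1) subset_refl] by (simp add: space_restrict_space)
  have SE: "S.E = sqnorm \<Omega> G" by (simp add: S.E_def sqnorm_def)
  have mB: "measure lebesgue B = measure lebesgue \<Omega>" unfolding B_def by (rule measure_symmetrized_ball)
  have ap: "\<exists>f. Ck 1 f \<and> compactly_supported_in B f \<and> sqnorm B (\<lambda>x. f x - ?v x) \<le> e \<and> sqnorm B (grad f) \<le> R" if e: "0 < e" for e
  proof -
    let ?p = "\<lambda>k x. S.profile (1 / real (Suc k)) (real k + 2) (ball_vol x)"
    have "\<forall>\<^sub>F k in sequentially. sqnorm B (\<lambda>x. ?p k x - ?v x) < e / 4"
      unfolding B_def by (rule order_tendstoD(2)[OF schwarz_truncations_converge[OF \<Omega> pos u S]]) (use e in simp)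
    then obtain k where k: "sqnorm B (\<lambda>x. ?p k x - ?v x) < e / 4" by (auto simp: eventually_sequentially)
    define d N where "d = 1 / real (Suc k)" and "N = real k + 2"
    have dN: "0 < d" "d < N"
    proof -
      show "0 < d" by (simp add: d_def)
      have "d \<le> 1" by (simp add: d_def)
      then show "d < N" by (simp add: N_def)
    qed
    have k': "sqnorm B (\<lambda>x. S.profile d N (ball_vol x) - ?v x) < e / 4" using k by (simp add: d_def N_def)
    define V where "V = measure lebesgue \<Omega>"
    define \<eta> where "\<eta> = sqrt (e / (4 * V))"
    have V: "V > 0" using pos by (simp add: V_def)
    have \<eta>: "0 < \<eta>" "\<eta>\<^sup>2 = e / (4 * V)" using e V by (auto simp: \<eta>_def)
    have tp: "0 < S.total" using pos total by simp
    obtain v p where v: "\<And>s. (v has_real_derivative p s) (at s)" "continuous_on UNIV p"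
      "\<exists>\<eta>>0. \<eta> < S.total \<and> (\<forall>s\<ge>S.total - \<eta>. v s = 0)" "\<And>s. \<bar>v s - S.profile d N s\<bar> \<le> \<eta>"
      "(\<integral>\<^sup>+s. indicator {0<..} s * ennreal ((p s * s powr \<alpha>)\<^sup>2) \<partial>lborel) \<le> ennreal (K\<^sup>2 * S.E)"
      by (rule S.smooth_profile[OF dN tp \<eta>(1)]) blast
    define f where "f x = v (ball_vol (x::'a))" for x
    have f1: "Ck 1 f" unfolding f_def by (rule radial_C1(1)[OF n v(1,2)])
    have fc: "compactly_supported_in B f"
    proof -
      obtain \<eta>' where "0 < \<eta>'" "\<eta>' < S.total" "\<And>s. S.total - \<eta>' \<le> s \<Longrightarrow> v s = 0" using v(3) by blast
      from radial_compact_support[OF this] show ?thesis unfolding Beq f_def total .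
    qed
    have gn: "norm (grad f x) = \<bar>\<gamma> * (p (ball_vol x) * ball_vol x powr \<alpha>)\<bar>" for x
      unfolding f_def \<gamma>_def \<alpha>_def by (rule radial_C1(2)[OF n v(1,2)])
    have gf: "has_L2_gradient B f (grad f)" by (rule C1_has_L2_gradient[OF oB f1 fc])
    have L: "L2_on B f" "L2_on B (grad f)" using gf by (auto simp: has_L2_gradient_def)
    have pm[measurable]: "p \<in> borel_measurable borel" by (rule borel_measurable_continuous_onI[OF v(2)])
    have "ennreal (sqnorm B (grad f)) = (\<integral>\<^sup>+x. ennreal ((norm (grad f x))\<^sup>2) \<partial>lebesgue_on B)"
      unfolding sqnorm_def by (rule nn_integral_eq_integral[OF L2_sq_integrable[OF L(2)], symmetric]) simp
    also have "\<dots> \<le> (\<integral>\<^sup>+x. ennreal ((norm (grad f x))\<^sup>2) \<partial>lebesgue)"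
      using oB(1) by (subst nn_integral_restrict_space) (auto intro!: nn_integral_mono simp: indicator_def)
    also have "\<dots> = (\<integral>\<^sup>+x. ennreal ((norm (grad f x))\<^sup>2) \<partial>lborel)" by (rule nn_integral_completion)
    also have "\<dots> = (\<integral>\<^sup>+x. ennreal ((\<gamma> * (p (ball_vol (x::'a)) * ball_vol x powr \<alpha>))\<^sup>2) \<partial>lborel)" unfolding gn by simp
    also have "\<dots> = (\<integral>\<^sup>+s. indicator {0<..} s * ennreal ((\<gamma> * (p s * s powr \<alpha>))\<^sup>2) \<partial>lborel)"
      by (rule nn_integral_radial[where f="\<lambda>s. ennreal ((\<gamma> * (p s * s powr \<alpha>))\<^sup>2)"]) measurable
    also have "\<dots> = (\<integral>\<^sup>+s. ennreal (\<gamma>\<^sup>2) * (indicator {0<..} s * ennreal ((p s * s powr \<alpha>)\<^sup>2)) \<partial>lborel)"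
      by (rule nn_integral_cong) (simp add: power_mult_distrib ennreal_mult ac_simps)
    also have "\<dots> = ennreal (\<gamma>\<^sup>2) * (\<integral>\<^sup>+s. indicator {0<..} s * ennreal ((p s * s powr \<alpha>)\<^sup>2) \<partial>lborel)"
      by (rule nn_integral_cmult) measurable
    also have "\<dots> \<le> ennreal (\<gamma>\<^sup>2) * ennreal (K\<^sup>2 * S.E)" by (intro mult_left_mono v(5)) simp
    also have "\<dots> = ennreal R"
      using S.E_nonneg by (simp add: R_def \<gamma>_def SE power_mult_distrib ennreal_mult[symmetric] mult.assoc)
    finally have gR: "sqnorm B (grad f) \<le> R"
      using sqnorm_nonneg[of \<Omega> G] by (subst (asm) ennreal_le_iff) (auto simp: R_def)
    have pc: "continuous_on UNIV (\<lambda>x::'a. S.profile d N (ball_vol x))"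
      by (rule continuous_on_compose2[OF continuous_at_imp_continuous_on ball_vol_continuous])
         (use S.continuous_profile[OF dN] in auto)
    have Lp: "L2_on B (\<lambda>x. S.profile d N (ball_vol x))"
    proof -
      interpret B: finite_measure "lebesgue_on B" by (rule finite_measure_lebesgue_on_open[OF oB])
      have m: "(\<lambda>x. S.profile d N (ball_vol x)) \<in> borel_measurable (lebesgue_on B)"
        by (rule borel_lebesgue_on[OF borel_measurable_continuous_onI[OF pc]])
      have "\<bar>S.profile d N s\<bar> \<le> N - d" for s
        using S.trunc_level_range[OF dN, of "max 0 s"] by (simp add: S.profile_def[OF dN])
      then have "(S.profile d N s)\<^sup>2 \<le> (N - d)\<^sup>2" for s using dN by (simp add: abs_le_square_iff[symmetric])
      then have "integrable (lebesgue_on B) (\<lambda>x. (S.profile d N (ball_vol x))\<^sup>2)"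
        using m by (intro B.integrable_const_bound[of _ "(N - d)\<^sup>2"]) auto
      with m show ?thesis by (simp add: L2_on_def)
    qed
    have a: "sqnorm B (\<lambda>x. f x - S.profile d N (ball_vol x)) \<le> V * \<eta>\<^sup>2" unfolding V_def mB[symmetric]
    proof (rule sqnorm_le_const[OF oB L2_diff[OF L(1) Lp]])
      show "(norm (f x - S.profile d N (ball_vol x)))\<^sup>2 \<le> \<eta>\<^sup>2" for x
        using v(4)[of "ball_vol x"] unfolding f_def by (intro power_mono) auto
    qed
    have "sqnorm B (\<lambda>x. (S.profile d N (ball_vol x) - ?v x) + (f x - S.profile d N (ball_vol x)))
      \<le> (1 + 1) * sqnorm B (\<lambda>x. S.profile d N (ball_vol x) - ?v x) + (1 + 1 / 1) * sqnorm B (\<lambda>x. f x - S.profile d N (ball_vol x))"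
      by (intro sqnorm_add_le L2_add L2_diff L Lp Lv) simp
    also have "\<dots> \<le> e / 2 + 2 * (V * \<eta>\<^sup>2)" using k' a by simp
    also have "\<dots> = e" using V \<eta>(2) by simp
    finally have "sqnorm B (\<lambda>x. f x - ?v x) \<le> e" by simp
    then show ?thesis using f1 fc gR by blast
  qed
  from H12_0_closed_C1[OF oB Lv ap] show "?v \<in> H12_0 B" "sqnorm B (weak_grad B ?v) \<le> R" by blast+
qed

theorem theorem1p3:
  fixes \<Omega> F :: "(real ^ 'n) set" and u :: "real ^ 'n \<Rightarrow> real" and \<epsilon> Q C :: real
  assumes "CARD('n) \<ge> 2"
    and "bounded_lipschitz_domain \<Omega>"
    and "closed F" and "F \<subseteq> frontier \<Omega>"
    and "hausdorff_measure (CARD('n) - 1) F = ennreal \<epsilon>" and "\<epsilon> > 0"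
    and "u \<in> H12_closure \<Omega> (Lip_vanishing_near \<Omega> F)"
    and "AE x in lebesgue_on \<Omega>. u x \<ge> 0"
    and "Q > 0"
    and "\<And>E. E \<in> sets lebesgue \<Longrightarrow> E \<subseteq> \<Omega> \<Longrightarrow>
           ennreal (min (measure lebesgue E) (measure lebesgue (\<Omega> - E)) powr (1 - 1 / real CARD('n)))
             \<le> ennreal Q * perimeter \<Omega> E"
    and "C > 0"
    and "\<And>E. E \<in> sets lebesgue \<Longrightarrow> E \<subseteq> \<Omega> \<Longrightarrow> measure lebesgue E \<le> measure lebesgue \<Omega> / 2 \<Longrightarrow>
           hausdorff_measure (CARD('n) - 1) (ess_boundary E \<inter> frontier \<Omega>)
             \<le> ennreal C * perimeter \<Omega> E"
  shows "let n = real CARD('n); c = unit_ball_vol n;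
             L = max (Q * n * c powr (1 / n))
                     (C * n * c powr (1 / n) * measure lebesgue \<Omega> powr (1 - 1 / n) / \<epsilon>)
         in schwarz_symmetrization \<Omega> u \<in> H12_0 (symmetrized_ball \<Omega>) \<and>
            (LINT x|lebesgue_on (symmetrized_ball \<Omega>).
               (norm (weak_grad (symmetrized_ball \<Omega>) (schwarz_symmetrization \<Omega> u) x))\<^sup>2)
              \<le> L\<^sup>2 * (LINT x|lebesgue_on \<Omega>. (norm (weak_grad \<Omega> u x))\<^sup>2)"
proof -
  have DIM: "DIM(real ^ 'n) = CARD('n)" by simp
  define \<alpha> where "\<alpha> = 1 - 1 / real CARD('n)"
  have \<alpha>: "0 \<le> \<alpha>" using assms(1) by (simp add: \<alpha>_def)
  have \<Omega>: "open \<Omega>" "bounded \<Omega>" "\<Omega> \<noteq> {}" using assms(2) by (auto simp: bounded_lipschitz_domain_def)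
  define V where "V = measure lebesgue \<Omega>"
  have pos: "0 < measure lebesgue \<Omega>"
  proof -
    obtain x r where "0 < r" "ball x r \<subseteq> \<Omega>" using \<Omega>(1,3) openE by blast
    then have "measure lebesgue (ball x r) \<le> measure lebesgue \<Omega>"
      using \<Omega> lmeasurable_open by (intro measure_mono_fmeasurable) auto
    moreover have "0 < measure lebesgue (ball x r)" using content_ball_pos[OF \<open>0 < r\<close>, of x] by simp
    ultimately show ?thesis by linarith
  qed
  define K where "K = max Q (C * V powr \<alpha> / \<epsilon>)"
  have K: "0 < K" using assms(9) by (simp add: K_def)
  have iso: "ennreal (measure lebesgue {x \<in> \<Omega>. \<phi> x > t} powr \<alpha>) \<le> ennreal K * perimeter \<Omega> {x \<in> \<Omega>. \<phi> x > t}"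
    if "\<phi> \<in> Lip_vanishing_near \<Omega> F" "0 \<le> t" for \<phi> t
    unfolding K_def V_def
    by (rule isoperimetric_superlevel[OF assms(2,4,5,6,9) _ assms(11,12) \<alpha> that]) (simp_all add: \<alpha>_def assms(10))
  have S: "strip_energy (lebesgue_on \<Omega>) u (\<lambda>x. (norm (weak_grad \<Omega> u x))\<^sup>2) K (1 - 1 / real DIM(real ^ 'n))"
    using strip_energy_of_closure[OF \<Omega>(1,2) assms(7) K \<alpha> iso] unfolding DIM \<alpha>_def .
  have Lu: "L2_on \<Omega> u"
    using assms(7) weak_grad[of u \<Omega>] by (simp add: H12_closure_def has_L2_gradient_def)
  define \<gamma> where "\<gamma> = real CARD('n) * unit_ball_vol (real CARD('n)) powr (1 / real CARD('n))"
  have "0 \<le> \<gamma>" by (simp add: \<gamma>_def)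
  then have L: "max (Q * real CARD('n) * unit_ball_vol (real CARD('n)) powr (1 / real CARD('n)))
        (C * real CARD('n) * unit_ball_vol (real CARD('n)) powr (1 / real CARD('n)) * V powr \<alpha> / \<epsilon>) = \<gamma> * K"
    unfolding K_def max_mult_distrib_left by (simp add: \<gamma>_def ac_simps)
  from schwarz_dirichlet_bound[OF _ \<Omega>(1,2) pos Lu assms(8) S] assms(1)
  show ?thesis
    unfolding Let_def sqnorm_def DIM \<gamma>_def[symmetric] V_def[symmetric] \<alpha>_def[symmetric] L by simp
qed

end
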